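(* Let $\Phi$ be a locally convex space, let $M$ be a nuclear cylindrical martingale-valued measure in $\Phi'$ on $\mathbb{R}_+\times\mathcal{R}$ with associated $\mu$, $\lambda$ and $\{q_{r,u}\}$, and let $T>0$. For each $X\in\Lambda^2_w(T)$, the weak stochastic integral $I^w(X)=\{I^w_t(X)\}_{t\in[0,T]}$ is a real-valued zero-mean, square integrable, c\`adl\`ag martingale with second moments given by $$\mathbb{E}\left(|I^w_t(X)|^2\right)=\mathbb{E}\int_0^t\int_U q_{r,u}(X(r,u))^2\,\mu(du)\,\lambda(dr),\qquad \forall\, t\in[0,T].$$ Moreover, $I^w(X)$ is mean square continuous and it has a predictable version. Furthermore, the mapping $I^w:\Lambda^2_w(T)\to\mathcal{M}^2_T(\mathbb{R})$, $X\mapsto I^w(X)=\{I^w_t(X)\}_{t\in[0,T]}$, is linear and continuous.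
   Context: Notation. All vector spaces are real. $(\Omega,\mathscr{F},\mathbb{P})$ is a complete probability space with a filtration $\{\mathcal{F}_t\}_{t\ge0}$ satisfying the usual conditions; $\mathcal{P}_T$ is the predictable $\sigma$-algebra on $[0,T]\times\Omega$. A continuous semi-norm $p$ on a locally convex space $\Phi$ is Hilbertian if $p(\phi)^2=p(\phi,\phi)$ for a symmetric non-negative bilinear form $p(\cdot,\cdot)$; $\Phi_p$ is the Hilbert space completion of $\Phi/\ker p$ (with $p$ and $p(\cdot,\cdot)$ extended to it) and $i_p:\Phi\to\Phi_p$ is the canonical map. A cylindrical random variable in $\Phi'$ is a linear map $\Phi\to L^0(\Omega,\mathscr{F},\mathbb{P})$. Processes are replaced by their c\`adl\`ag/predictable versions whenever these exist. $\int_s^t$ means integration over $(s,t]$. Nuclear cylindrical martingale-valued measure. $U$ is a topological space, $\mathcal{R}\subseteq\mathcal{B}(U)$ a ring generating $\mathcal{B}(U)$, and $M=(M(t,A):t\ge0,A\in\mathcal{R})$ is a family of cylindrical random variables in $\Phi'$ such that: (1) $M(0,A)(\phi)=0$ a.s.; (2) $M(t,\emptyset)(\phi)=0$ a.s. and $M(t,A\cup B)(\phi)=M(t,A)(\phi)+M(t,B)(\phi)$ a.s. for disjoint $A,B\in\mathcal{R}$; (3) for all $A\in\mathcal{R}$, $\phi\in\Phi$, $(M(t,A)(\phi))_{t\ge0}$ is an $\{\mathcal{F}_t\}$-adapted zero-mean square integrable c\`adl\`ag martingale; (4) $\mathbb{E}(M(t,A)(\phi)M(s,B)(\varphi))=0$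 for disjoint $A,B\in\mathcal{R}$, all $s,t\ge0$, $\phi,\varphi\in\Phi$; (5) (independent increments) for $0\le s<t$, $M((s,t],A)(\phi):=(M(t,A)-M(s,A))(\phi)$ is independent of $\mathcal{F}_s$ for all $A\in\mathcal{R}$, $\phi\in\Phi$; (6) (nuclear) $\mathbb{E}(|M((s,t],A)(\phi)|^2)=\int_s^t\int_A q_{r,u}(\phi)^2\mu(du)\lambda(dr)$ for all $0\le s<t$, $A\in\mathcal{R}$, $\phi\in\Phi$, where $\mu$ is a $\sigma$-finite measure on $(U,\mathcal{B}(U))$ finite on $\mathcal{R}$, $\lambda$ is a $\sigma$-finite Borel measure on $\mathbb{R}_+$ finite on bounded intervals, and $\{q_{r,u}:r\in\mathbb{R}_+,u\in U\}$ are continuous Hilbertian semi-norms on $\Phi$ such that $(r,u)\mapsto q_{r,u}(\phi,\varphi)$ is Borel measurable and bounded on $[0,T]\times U$ for all $T>0$, $\phi,\varphi\in\Phi$. Standing assumption: for each $T>0$ there is a countable $D\subseteq\Phi$ that is dense in $\Phi_{q_{r,u}}$ for every $r\in[0,T]$, $u\in U$. Integrands. $\Lambda^2_w(T)$ is the Hilbert space of (classes of) families $X=\{X(r,\omega,u):r\in[0,T],\omega\in\Omega,u\in U\}$ with $X(r,\omega,u)\in\Phi_{q_{r,u}}$, with $(r,\omega,u)\mapsto q_{r,u}(X(r,\omega,u),\phi)$ $\mathcal{P}_T\otimes\mathcal{B}(U)$-measurable for each $\phi\in\Phi$, and $\|X\|_{w,T}^2:=\mathbb{E}\int_0^T\int_U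 q_{r,u}(X(r,u))^2\mu(du)\lambda(dr)<\infty$. Weak integral. $\mathcal{S}_w(T)\subseteq\Lambda_w^2(T)$ is the dense subspace of families $X(r,\omega,u)=\sum_{i=1}^n\sum_{j=1}^m \mathbf{1}_{]s_j,t_j]}(r)\mathbf{1}_{F_j}(\omega)\mathbf{1}_{A_i}(u)\,i_{q_{r,u}}\phi_{i,j}$ with $0\le s_j<t_j\le T$, $F_j\in\mathcal{F}_{s_j}$, $A_i\in\mathcal{R}$, $\phi_{i,j}\in\Phi$, which may be written so that for $k\ne j$ intersecting intervals $]s_k,t_k]$, $]s_j,t_j]$ are equal with $F_k\cap F_j=\emptyset$; for such $X$, $I^w_T(X)=\sum_{i,j}\mathbf{1}_{F_j}M((s_j,t_j],A_i)(\phi_{i,j})$. This extends to a linear isometry $I^w_T:\Lambda^2_w(T)\to L^2(\Omega,\mathscr{F},\mathbb{P})$, and $I^w_t(X):=I^w_T(\mathbf{1}_{[0,t]}X)$ for $t\in[0,T]$. $\mathcal{M}^2_T(\mathbb{R})$ is the Banach space of $\{\mathcal{F}_t\}$-adapted zero-mean square integrable c\`adl\`ag martingales on $[0,T]$ with norm $(\mathbb{E}\sup_{t\in[0,T]}|M_t|^2)^{1/2}$.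
   Formalization: Mean square continuity and the existence of a predictable version are stated only when λ has no atoms in (0,T]; with an atom they fail (e.g. λ=δ_1, M(t,U)(x)=xξ1_{t≥1}, ξ a fair random sign). *)

theory Defs
  imports "HOL-Probability.Probability"
begin

section \<open>Locally convex spaces, Hilbertian semi-norms and their completions\<close>

definition locally_convex_tvs :: "'a::{real_vector, topological_ab_group_add} itself \<Rightarrow> bool" where
  "locally_convex_tvs _ \<longleftrightarrow>
     (\<forall>(c::real) (x::'a). ((\<lambda>z. fst z *\<^sub>R snd z) \<longlongrightarrow> c *\<^sub>R x) (nhds c \<times>\<^sub>F nhds x)) \<and>
     (\<forall>W::'a set. open W \<and> 0 \<in> W \<longrightarrow> (\<exists>V. open V \<and> convex V \<and> 0 \<in> V \<and> V \<subseteq> W))"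

text \<open>A Hilbertian semi-norm is represented by its bilinear form \<open>b\<close>; the semi-norm is
  \<open>seminorm_of b\<close>, and by polarization it determines \<open>b\<close>.\<close>

definition seminorm_of :: "('a \<Rightarrow> 'a \<Rightarrow> real) \<Rightarrow> 'a \<Rightarrow> real" where
  "seminorm_of b x = sqrt (b x x)"

definition cont_hilbertian :: "('a::{real_vector, topological_space} \<Rightarrow> 'a \<Rightarrow> real) \<Rightarrow> bool" where
  "cont_hilbertian b \<longleftrightarrow>
     bilinear b \<and> (\<forall>x y. b x y = b y x) \<and> (\<forall>x. 0 \<le> b x x) \<and> continuous_on UNIV (seminorm_of b)"

text \<open>The completion of \<open>\<Phi>/ker\<close> with respect to \<open>b\<close> is the space of Cauchy sequences for
  \<open>seminorm_of b\<close>, two such sequences being identified if their difference has \<open>hnorm\<close> zero.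
  We work with representing sequences: vector operations are termwise, and the
  integrands below enter only through \<open>hform\<close> and \<open>hnorm\<close>, which do not depend on the
  representatives.\<close>

definition hcompletion :: "('a::real_vector \<Rightarrow> 'a \<Rightarrow> real) \<Rightarrow> (nat \<Rightarrow> 'a) set" where
  "hcompletion b = {x. \<forall>e>0. \<exists>N. \<forall>m\<ge>N. \<forall>n\<ge>N. seminorm_of b (x m - x n) < e}"

definition hform :: "('a \<Rightarrow> 'a \<Rightarrow> real) \<Rightarrow> (nat \<Rightarrow> 'a) \<Rightarrow> (nat \<Rightarrow> 'a) \<Rightarrow> real" where
  "hform b x y = lim (\<lambda>n. b (x n) (y n))"

definition hnorm :: "('a \<Rightarrow> 'a \<Rightarrow> real) \<Rightarrow> (nat \<Rightarrow> 'a) \<Rightarrow> real" where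
  "hnorm b x = sqrt (hform b x x)"

text \<open>The canonical map \<open>i_b\<close> of \<open>\<Phi>\<close> into the completion (constant sequences).\<close>

definition hembed :: "'a \<Rightarrow> nat \<Rightarrow> 'a" where
  "hembed x = (\<lambda>_. x)"

definition dense_in_hcompletion :: "('a::real_vector \<Rightarrow> 'a \<Rightarrow> real) \<Rightarrow> 'a set \<Rightarrow> bool" where
  "dense_in_hcompletion b D \<longleftrightarrow>
     (\<forall>x\<in>hcompletion b. \<forall>e>0. \<exists>d\<in>D. hnorm b (\<lambda>n. x n - hembed d n) < e)"


section \<open>Filtrations, the predictable sigma-algebra and martingales\<close>

definition usual_filtration :: "'w measure \<Rightarrow> (real \<Rightarrow> 'w measure) \<Rightarrow> bool" where
  "usual_filtration P F \<longleftrightarrow>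
     (\<forall>t\<ge>0. subalgebra P (F t)) \<and>
     (\<forall>s t. 0 \<le> s \<and> s \<le> t \<longrightarrow> sets (F s) \<subseteq> sets (F t)) \<and>
     null_sets P \<subseteq> sets (F 0) \<and>
     (\<forall>t\<ge>0. sets (F t) = (\<Inter>s\<in>{t<..}. sets (F s)))"

definition predictable_sigma :: "'w measure \<Rightarrow> (real \<Rightarrow> 'w measure) \<Rightarrow> real \<Rightarrow> (real \<times> 'w) measure" where
  "predictable_sigma P F T = sigma ({0..T} \<times> space P)
     ({{0} \<times> E |E. E \<in> sets (F 0)} \<union>
      {{s<..t} \<times> E |s t E. 0 \<le> s \<and> s < t \<and> t \<le> T \<and> E \<in> sets (F s)})"

definition cadlag_on :: "real set \<Rightarrow> (real \<Rightarrow> real) \<Rightarrow> bool" where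
  "cadlag_on S f \<longleftrightarrow>
     (\<forall>t\<in>S. (f \<longlongrightarrow> f t) (at t within (S \<inter> {t<..})) \<and>
            (\<exists>l. (f \<longlongrightarrow> l) (at t within (S \<inter> {..<t}))))"

text \<open>The adapted zero-mean square integrable cadlag martingales with time set \<open>S\<close>. For
  \<open>S = {0..T}\<close>, and up to indistinguishability, this is the space \<open>M\<^sup>2\<^sub>T\<close>.\<close>

definition sq_martingales :: "'w measure \<Rightarrow> (real \<Rightarrow> 'w measure) \<Rightarrow> real set \<Rightarrow> (real \<Rightarrow> 'w \<Rightarrow> real) set" where
  "sq_martingales P F S = {Z.
     (\<forall>t\<in>S. Z t \<in> borel_measurable (F t) \<and> integrable P (Z t) \<and>
            integrable P (\<lambda>\<omega>. (Z t \<omega>)\<^sup>2) \<and> (\<integral>\<omega>. Z t \<omega> \<partial>P) = 0) \<and>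
     (\<forall>s\<in>S. \<forall>t\<in>S. s \<le> t \<longrightarrow> (AE \<omega> in P. real_cond_exp P (F s) (Z t) \<omega> = Z s \<omega>)) \<and>
     (\<forall>\<omega>\<in>space P. cadlag_on S (\<lambda>t. Z t \<omega>))}"

text \<open>The square of the norm of \<open>M\<^sup>2\<^sub>T\<close>; being valued in \<open>ennreal\<close> it does not hide infinite values.\<close>

definition M2_norm_sq :: "'w measure \<Rightarrow> real \<Rightarrow> (real \<Rightarrow> 'w \<Rightarrow> real) \<Rightarrow> ennreal" where
  "M2_norm_sq P T Z = (\<integral>\<^sup>+\<omega>. (SUP t\<in>{0..T}. ennreal ((Z t \<omega>)\<^sup>2)) \<partial>P)"

text \<open>A nuclear cylindrical martingale-valued measure may jump at a fixed time \<open>t\<close> when \<open>t\<close> is an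
  atom of its time measure; its integrals are then neither mean square continuous at \<open>t\<close> nor
  almost surely equal to a predictable process at \<open>t\<close> in general. The next two properties are therefore
  only claimed when the time measure has no atoms in \<open>(0,T]\<close>.\<close>

definition mean_square_continuous :: "'w measure \<Rightarrow> real \<Rightarrow> (real \<Rightarrow> 'w \<Rightarrow> real) \<Rightarrow> bool" where
  "mean_square_continuous P T Z \<longleftrightarrow>
     (\<forall>t\<in>{0..T}. ((\<lambda>s. \<integral>\<omega>. (Z s \<omega> - Z t \<omega>)\<^sup>2 \<partial>P) \<longlongrightarrow> 0) (at t within {0..T}))"

definition has_predictable_version :: "'w measure \<Rightarrow> (real \<Rightarrow> 'w measure) \<Rightarrow> real \<Rightarrow> (real \<Rightarrow> 'w \<Rightarrow> real) \<Rightarrow> bool" where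
  "has_predictable_version P F T Z \<longleftrightarrow>
     (\<exists>Y. (\<lambda>(t, \<omega>). Y t \<omega>) \<in> borel_measurable (predictable_sigma P F T) \<and>
          (\<forall>t\<in>{0..T}. AE \<omega> in P. Y t \<omega> = Z t \<omega>))"


section \<open>Nuclear cylindrical martingale-valued measures\<close>

definition cyl_random_variable :: "'w measure \<Rightarrow> ('a::real_vector \<Rightarrow> 'w \<Rightarrow> real) \<Rightarrow> bool" where
  "cyl_random_variable P L \<longleftrightarrow>
     (\<forall>\<phi>. L \<phi> \<in> borel_measurable P) \<and>
     (\<forall>a b \<phi> \<psi>. AE \<omega> in P. L (a *\<^sub>R \<phi> + b *\<^sub>R \<psi>) \<omega> = a * L \<phi> \<omega> + b * L \<psi> \<omega>)"

definition increment ::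
  "(real \<Rightarrow> 'u set \<Rightarrow> 'a \<Rightarrow> 'w \<Rightarrow> real) \<Rightarrow> real \<Rightarrow> real \<Rightarrow> 'u set \<Rightarrow> 'a \<Rightarrow> 'w \<Rightarrow> real" where
  "increment M s t A \<phi> \<omega> = M t A \<phi> \<omega> - M s A \<phi> \<omega>"

text \<open>Only the values of \<open>F t\<close>, \<open>M t\<close>, \<open>q t u\<close> at times \<open>t \<ge> 0\<close>, and of \<open>M t A\<close> at
  \<open>A \<in> R\<close>, matter.\<close>

locale nuclear_cyl_mvm = prob_space P + complete_measure P
  for P :: "'w measure" +
  fixes F :: "real \<Rightarrow> 'w measure"
    and R :: "'u::topological_space set set"
    and M :: "real \<Rightarrow> 'u set \<Rightarrow> 'a::{real_vector, topological_ab_group_add} \<Rightarrow> 'w \<Rightarrow> real"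
    and \<mu> :: "'u measure"
    and lam :: "real measure"
    and q :: "real \<Rightarrow> 'u \<Rightarrow> 'a \<Rightarrow> 'a \<Rightarrow> real"
  assumes filtration: "usual_filtration P F"
    and ring: "ring_of_sets UNIV R"
    and ring_generates: "sigma_sets UNIV R = sets borel"
    and cylindrical: "\<And>t A. 0 \<le> t \<Longrightarrow> A \<in> R \<Longrightarrow> cyl_random_variable P (M t A)"
    and null_at_0: "\<And>A \<phi>. A \<in> R \<Longrightarrow> AE \<omega> in P. M 0 A \<phi> \<omega> = 0"
    and null_empty: "\<And>t \<phi>. 0 \<le> t \<Longrightarrow> AE \<omega> in P. M t {} \<phi> \<omega> = 0"
    and additive: "\<And>t A B \<phi>. 0 \<le> t \<Longrightarrow> A \<in> R \<Longrightarrow> B \<in> R \<Longrightarrow> A \<inter> B = {} \<Longrightarrow>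
          AE \<omega> in P. M t (A \<union> B) \<phi> \<omega> = M t A \<phi> \<omega> + M t B \<phi> \<omega>"
    and martingale: "\<And>A \<phi>. A \<in> R \<Longrightarrow> (\<lambda>t. M t A \<phi>) \<in> sq_martingales P F {0..}"
    and orthogonal: "\<And>s t A B \<phi> \<psi>. 0 \<le> s \<Longrightarrow> 0 \<le> t \<Longrightarrow> A \<in> R \<Longrightarrow> B \<in> R \<Longrightarrow> A \<inter> B = {} \<Longrightarrow>
          (\<integral>\<omega>. M t A \<phi> \<omega> * M s B \<psi> \<omega> \<partial>P) = 0"
    and indep_increments: "\<And>s t A \<phi>. 0 \<le> s \<Longrightarrow> s < t \<Longrightarrow> A \<in> R \<Longrightarrow>
          indep_set (sets (vimage_algebra (space P) (increment M s t A \<phi>) borel)) (sets (F s))"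
    and mu_sets: "sets \<mu> = sets borel"
    and mu_sigma_finite: "sigma_finite_measure \<mu>"
    and mu_finite: "\<And>A. A \<in> R \<Longrightarrow> emeasure \<mu> A < \<infinity>"
    and lam_sets: "sets lam = sets (restrict_space borel {0..})"
    and lam_sigma_finite: "sigma_finite_measure lam"
    and lam_finite: "\<And>b. emeasure lam {0..b} < \<infinity>"
    and q_hilbertian: "\<And>r u. 0 \<le> r \<Longrightarrow> cont_hilbertian (q r u)"
    and q_measurable: "\<And>\<phi> \<psi>. (\<lambda>(r, u). q r u \<phi> \<psi>) \<in> borel_measurable (restrict_space borel {0..} \<Otimes>\<^sub>M borel)"
    and q_bounded: "\<And>T \<phi> \<psi>. 0 < T \<Longrightarrow> bounded ((\<lambda>(r, u). q r u \<phi> \<psi>) ` ({0..T} \<times> UNIV))"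
    and nuclear: "\<And>s t A \<phi>. 0 \<le> s \<Longrightarrow> s < t \<Longrightarrow> A \<in> R \<Longrightarrow>
          ennreal (\<integral>\<omega>. \<bar>increment M s t A \<phi> \<omega>\<bar>\<^sup>2 \<partial>P) =
          (\<integral>\<^sup>+r\<in>{s<..t}. (\<integral>\<^sup>+u\<in>A. ennreal ((seminorm_of (q r u) \<phi>)\<^sup>2) \<partial>\<mu>) \<partial>lam)"
    and separable: "\<And>T. 0 < T \<Longrightarrow>
          \<exists>D. countable D \<and> (\<forall>r\<in>{0..T}. \<forall>u. dense_in_hcompletion (q r u) D)"


section \<open>Integrands\<close>

text \<open>\<open>X r \<omega> u\<close> is a sequence representing an element of the completion for \<open>q r u\<close>.\<close>

type_synonym ('a, 'w, 'u) integrand = "real \<Rightarrow> 'w \<Rightarrow> 'u \<Rightarrow> nat \<Rightarrow> 'a"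

definition lin_comb :: "real \<Rightarrow> ('a::real_vector, 'w, 'u) integrand \<Rightarrow> real \<Rightarrow> ('a, 'w, 'u) integrand
    \<Rightarrow> ('a, 'w, 'u) integrand" where
  "lin_comb a X b Y = (\<lambda>r \<omega> u n. a *\<^sub>R X r \<omega> u n + b *\<^sub>R Y r \<omega> u n)"

abbreviation integrand_diff :: "('a::real_vector, 'w, 'u) integrand \<Rightarrow> ('a, 'w, 'u) integrand
    \<Rightarrow> ('a, 'w, 'u) integrand" where
  "integrand_diff X Y \<equiv> lin_comb 1 X (- 1) Y"

text \<open>\<open>1\<^bsub>[0,t]\<^esub> X\<close>\<close>

definition restrict_to :: "real \<Rightarrow> ('a::real_vector, 'w, 'u) integrand \<Rightarrow> ('a, 'w, 'u) integrand" where
  "restrict_to t X = (\<lambda>r \<omega> u. if r \<in> {0..t} then X r \<omega> u else (\<lambda>_. 0))"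

definition w_norm_sq :: "'w measure \<Rightarrow> 'u measure \<Rightarrow> real measure \<Rightarrow> (real \<Rightarrow> 'u \<Rightarrow> 'a \<Rightarrow> 'a \<Rightarrow> real)
    \<Rightarrow> real \<Rightarrow> ('a, 'w, 'u) integrand \<Rightarrow> ennreal" where
  "w_norm_sq P \<mu> lam q T X =
     (\<integral>\<^sup>+\<omega>. (\<integral>\<^sup>+r\<in>{0<..T}. (\<integral>\<^sup>+u. ennreal ((hnorm (q r u) (X r \<omega> u))\<^sup>2) \<partial>\<mu>) \<partial>lam) \<partial>P)"

definition Lambda_w :: "'w measure \<Rightarrow> (real \<Rightarrow> 'w measure) \<Rightarrow> 'u::topological_space measure \<Rightarrow> real measure
    \<Rightarrow> (real \<Rightarrow> 'u \<Rightarrow> 'a::real_vector \<Rightarrow> 'a \<Rightarrow> real) \<Rightarrow> real \<Rightarrow> ('a, 'w, 'u) integrand set" where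
  "Lambda_w P F \<mu> lam q T = {X.
     (\<forall>r\<in>{0..T}. \<forall>\<omega>\<in>space P. \<forall>u. X r \<omega> u \<in> hcompletion (q r u)) \<and>
     (\<forall>\<phi>. (\<lambda>((r, \<omega>), u). hform (q r u) (X r \<omega> u) (hembed \<phi>))
            \<in> borel_measurable (predictable_sigma P F T \<Otimes>\<^sub>M borel)) \<and>
     w_norm_sq P \<mu> lam q T X < \<infinity>}"


section \<open>The weak stochastic integral\<close>

text \<open>Data of a simple family: the indices \<open>i\<close>, \<open>j\<close> run over \<open>{..<n}\<close>, \<open>{..<m}\<close>, and the
  family is in the normalised form in which intersecting intervals coincide and carry
  disjoint events.\<close>

definition simple_data :: "(real \<Rightarrow> 'w measure) \<Rightarrow> 'u set set \<Rightarrow> real \<Rightarrow> nat \<Rightarrow> nat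
    \<Rightarrow> (nat \<Rightarrow> real) \<Rightarrow> (nat \<Rightarrow> real) \<Rightarrow> (nat \<Rightarrow> 'w set) \<Rightarrow> (nat \<Rightarrow> 'u set) \<Rightarrow> bool" where
  "simple_data F R T n m s t E A \<longleftrightarrow>
     (\<forall>j<m. 0 \<le> s j \<and> s j < t j \<and> t j \<le> T \<and> E j \<in> sets (F (s j))) \<and>
     (\<forall>i<n. A i \<in> R) \<and>
     (\<forall>k<m. \<forall>j<m. k \<noteq> j \<and> {s k<..t k} \<inter> {s j<..t j} \<noteq> {} \<longrightarrow>
        s k = s j \<and> t k = t j \<and> E k \<inter> E j = {})"

definition simple_family :: "nat \<Rightarrow> nat \<Rightarrow> (nat \<Rightarrow> real) \<Rightarrow> (nat \<Rightarrow> real) \<Rightarrow> (nat \<Rightarrow> 'w set)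
    \<Rightarrow> (nat \<Rightarrow> 'u set) \<Rightarrow> (nat \<Rightarrow> nat \<Rightarrow> 'a::real_vector) \<Rightarrow> ('a, 'w, 'u) integrand" where
  "simple_family n m s t E A \<phi> = (\<lambda>r \<omega> u k. \<Sum>i<n. \<Sum>j<m.
     (indicator {s j<..t j} r * indicator (E j) \<omega> * indicator (A i) u) *\<^sub>R hembed (\<phi> i j) k)"

definition simple_integral :: "(real \<Rightarrow> 'u set \<Rightarrow> 'a \<Rightarrow> 'w \<Rightarrow> real) \<Rightarrow> nat \<Rightarrow> nat \<Rightarrow> (nat \<Rightarrow> real)
    \<Rightarrow> (nat \<Rightarrow> real) \<Rightarrow> (nat \<Rightarrow> 'w set) \<Rightarrow> (nat \<Rightarrow> 'u set) \<Rightarrow> (nat \<Rightarrow> nat \<Rightarrow> 'a) \<Rightarrow> 'w \<Rightarrow> real" where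
  "simple_integral M n m s t E A \<phi> = (\<lambda>\<omega>. \<Sum>i<n. \<Sum>j<m.
     indicator (E j) \<omega> * increment M (s j) (t j) (A i) (\<phi> i j) \<omega>)"

definition simple_w :: "(real \<Rightarrow> 'w measure) \<Rightarrow> 'u set set \<Rightarrow> real \<Rightarrow> ('a::real_vector, 'w, 'u) integrand set" where
  "simple_w F R T = {simple_family n m s t E A \<phi> |n m s t E A \<phi>. simple_data F R T n m s t E A}"

text \<open>\<open>I\<close> is the weak integral on \<open>[0,T]\<close>: the linear isometry from \<open>\<Lambda>\<^sup>2\<^sub>w(T)\<close> into \<open>L\<^sup>2(P)\<close> that
  extends the elementary integral from the dense subspace of simple families. Density
  and the isometry are part of what it means to be the weak integral: they do not follow from
  the assumptions of the locale in degenerate cases, e.g. if no countable subfamily of \<open>R\<close>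
  covers \<open>\<mu>\<close>-almost all of \<open>U\<close>. By the density, \<open>I X\<close> is determined up to null sets. \<open>I\<close> acts on representatives; by linearity and the
  isometry it respects the identification of families at distance zero.\<close>

definition weak_integral :: "'w measure \<Rightarrow> (real \<Rightarrow> 'w measure) \<Rightarrow> 'u::topological_space set set
    \<Rightarrow> (real \<Rightarrow> 'u set \<Rightarrow> 'a::real_vector \<Rightarrow> 'w \<Rightarrow> real) \<Rightarrow> 'u measure \<Rightarrow> real measure
    \<Rightarrow> (real \<Rightarrow> 'u \<Rightarrow> 'a \<Rightarrow> 'a \<Rightarrow> real) \<Rightarrow> real \<Rightarrow> (('a, 'w, 'u) integrand \<Rightarrow> 'w \<Rightarrow> real) \<Rightarrow> bool" where
  "weak_integral P F R M \<mu> lam q T I \<longleftrightarrow>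
     (\<forall>X\<in>Lambda_w P F \<mu> lam q T. \<forall>e>0. \<exists>Y\<in>simple_w F R T.
        w_norm_sq P \<mu> lam q T (integrand_diff X Y) < ennreal (e\<^sup>2)) \<and>
     (\<forall>n m s t E A \<phi>. simple_data F R T n m s t E A \<longrightarrow>
        (AE \<omega> in P. I (simple_family n m s t E A \<phi>) \<omega> = simple_integral M n m s t E A \<phi> \<omega>)) \<and>
     (\<forall>X\<in>Lambda_w P F \<mu> lam q T. I X \<in> borel_measurable P \<and> integrable P (\<lambda>\<omega>. (I X \<omega>)\<^sup>2)) \<and>
     (\<forall>X\<in>Lambda_w P F \<mu> lam q T. \<forall>Y\<in>Lambda_w P F \<mu> lam q T. \<forall>a b.
        AE \<omega> in P. I (lin_comb a X b Y) \<omega> = a * I X \<omega> + b * I Y \<omega>) \<and>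
     (\<forall>X\<in>Lambda_w P F \<mu> lam q T. ennreal (\<integral>\<omega>. \<bar>I X \<omega>\<bar>\<^sup>2 \<partial>P) = w_norm_sq P \<mu> lam q T X)"

end

theory Submission
  imports Defs
begin

text \<open>For simple integrands the integral process is a finite sum of stopped martingales, and stopping a
  simple family at \<open>t\<close> gives again a simple family. A general \<open>X\<close> is a limit of simple families, so by
  the isometry \<open>I (1\<^bsub>[0,t]\<^esub> X)\<close> is an \<open>L\<^sup>2\<close>-limit, uniformly in \<open>t\<close>, of such martingales. By Doob's \<open>L\<^sup>2\<close>
  inequality, which follows from its pathwise form along dyadic times, a fast approximating sequence converges
  almost surely uniformly on \<open>[0,T]\<close>, which gives a cadlag version. The same inequality bounds the
  norm of \<open>M\<^sup>2\<^sub>T\<close> by twice that of \<open>\<Lambda>\<^sup>2\<^sub>w(T)\<close>. Without atoms of the time measure dominated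
  convergence yields mean square continuity, and then the left limits are a predictable version.\<close>

section \<open>The Hilbert space completion\<close>

text \<open>\<open>I\<close> is given only through almost sure properties of each
  \<open>I X\<close>, so an identity between processes is first known at one fixed time, off a null
  set depending on that time. Right continuity and the countable dyadic grids remove this
  dependence; the same device makes the supremum over \<open>[0,T]\<close> measurable. The
  approximation rate \<open>(1/8)^k\<close> is chosen so that the expected squared suprema of the
  increments, weighted by \<open>4^k\<close>, remain summable; this leaves pathwise increments of
  order \<open>(1/2)^k\<close>. The limit is set to zero on a null set and stays adapted, since
  \<open>F 0\<close> contains the null sets. A second obstacle is that an integrand is known only
  through its pairings with fixed vectors: the countable dense set turns these into a measurable
  norm, so that \<open>w_norm_sq\<close> becomes one integral over a product space and dominated
  convergence applies. Truncating at \<open>s\<close> instead of \<open>t\<close> changes the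
  integrand only between the two times; as \<open>s\<close> tends to \<open>t\<close> from the left
  these intervals shrink to the point \<open>t\<close>, which is where atoms enter.\<close>

locale pos_form =
  fixes b :: "'a::real_vector \<Rightarrow> 'a \<Rightarrow> real"
  assumes bil: "bilinear b"
    and sym: "b x y = b y x"
    and nonneg: "0 \<le> b x x"
begin

lemmas form_simps = bilinear_ladd[OF bil] bilinear_radd[OF bil] bilinear_lmul[OF bil]
  bilinear_rmul[OF bil] bilinear_lsub[OF bil] bilinear_rsub[OF bil] bilinear_lzero[OF bil]
  bilinear_rzero[OF bil]

text \<open>The discriminant argument, for a form that may be degenerate: when
  \<open>b y y = 0\<close> the quadratic in \<open>t\<close> is affine, and non-negativity forces
  its slope to vanish.\<close>

lemma cauchy_schwarz: "\<bar>b x y\<bar> \<le> seminorm_of b x * seminorm_of b y"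
proof -
  have q: "0 \<le> b x x + 2 * t * b x y + t\<^sup>2 * b y y" for t
    using nonneg[of "x + t *\<^sub>R y"] sym[of y x]
    by (simp add: form_simps power2_eq_square algebra_simps)
  have "(b x y)\<^sup>2 \<le> b x x * b y y"
  proof (cases "b y y = 0")
    case True
    have "b x y = 0"
    proof (rule ccontr)
      assume "b x y \<noteq> 0"
      \<comment> \<open>At this \<open>t\<close> the affine expression equals -1.\<close>
      then show False
        using q[of "- (b x x + 1) / (2 * b x y)"] True nonneg[of x] by (simp add: field_simps)
    qed
    then show ?thesis using True by simp
  next
    case False
    then have pos: "0 < b y y" using nonneg[of y] by simp
    \<comment> \<open>The value \<open>t = - b x y / b y y\<close> minimises the quadratic.\<close>
    have "0 \<le> (b x x + 2 * (- b x y / b y y) * b x y + (- b x y / b y y)\<^sup>2 * b y y) * b y y"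
      by (intro mult_nonneg_nonneg q less_imp_le[OF pos])
    also have "\<dots> = b x x * b y y - (b x y)\<^sup>2"
      using pos by (simp add: field_simps power2_eq_square)
    finally show ?thesis by simp
  qed
  then have "sqrt ((b x y)\<^sup>2) \<le> sqrt (b x x * b y y)" by (rule real_sqrt_le_mono)
  then show ?thesis by (simp add: seminorm_of_def real_sqrt_mult)
qed

lemma seminorm_sq: "(seminorm_of b x)\<^sup>2 = b x x"
  by (simp add: seminorm_of_def nonneg)

lemma seminorm_nonneg: "0 \<le> seminorm_of b x"
  by (simp add: seminorm_of_def nonneg)

lemma seminorm_triangle: "seminorm_of b (x + y) \<le> seminorm_of b x + seminorm_of b y"
proof (rule power2_le_imp_le)
  have "(seminorm_of b (x + y))\<^sup>2 = b x x + 2 * b x y + b y y"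
    by (simp add: seminorm_sq form_simps sym[of y x])
  also have "\<dots> \<le> (seminorm_of b x + seminorm_of b y)\<^sup>2"
    using cauchy_schwarz[of x y] by (simp add: power2_sum seminorm_sq)
  finally show "(seminorm_of b (x + y))\<^sup>2 \<le> (seminorm_of b x + seminorm_of b y)\<^sup>2" .
qed (intro add_nonneg_nonneg seminorm_nonneg)

lemma seminorm_scale: "seminorm_of b (a *\<^sub>R x) = \<bar>a\<bar> * seminorm_of b x"
  by (simp add: seminorm_of_def form_simps real_sqrt_mult flip: mult.assoc)

lemma hcompletion_lin:
  assumes x: "x \<in> hcompletion b" and y: "y \<in> hcompletion b"
  shows "(\<lambda>n. a *\<^sub>R x n + c *\<^sub>R y n) \<in> hcompletion b"
  unfolding hcompletion_def
proof safe
  fix e :: real assume "0 < e"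
  define d where "d = e / (\<bar>a\<bar> + \<bar>c\<bar> + 1)"
  have d: "0 < d" using \<open>0 < e\<close> by (simp add: d_def add_nonneg_pos)
  obtain N1 where N1: "\<And>m n. N1 \<le> m \<Longrightarrow> N1 \<le> n \<Longrightarrow> seminorm_of b (x m - x n) < d"
    using x d unfolding hcompletion_def by blast
  obtain N2 where N2: "\<And>m n. N2 \<le> m \<Longrightarrow> N2 \<le> n \<Longrightarrow> seminorm_of b (y m - y n) < d"
    using y d unfolding hcompletion_def by blast
  have "seminorm_of b ((a *\<^sub>R x m + c *\<^sub>R y m) - (a *\<^sub>R x n + c *\<^sub>R y n)) < e"
    if "max N1 N2 \<le> m" "max N1 N2 \<le> n" for m n
  proof -
    have "(a *\<^sub>R x m + c *\<^sub>R y m) - (a *\<^sub>R x n + c *\<^sub>R y n) = a *\<^sub>R (x m - x n) + c *\<^sub>R (y m - y n)"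
      by (simp add: algebra_simps)
    then have "seminorm_of b ((a *\<^sub>R x m + c *\<^sub>R y m) - (a *\<^sub>R x n + c *\<^sub>R y n))
        \<le> \<bar>a\<bar> * seminorm_of b (x m - x n) + \<bar>c\<bar> * seminorm_of b (y m - y n)"
      using seminorm_triangle by (metis seminorm_scale)
    also have "\<dots> \<le> \<bar>a\<bar> * d + \<bar>c\<bar> * d"
      using N1[of m n] N2[of m n] that by (intro add_mono mult_left_mono) auto
    also have "\<dots> < (\<bar>a\<bar> + \<bar>c\<bar> + 1) * d"
      using d by (simp add: algebra_simps)
    also have "\<dots> = e" by (simp add: d_def add_nonneg_pos field_simps add_pos_nonneg)
    finally show ?thesis .
  qed
  then show "\<exists>N. \<forall>m\<ge>N. \<forall>n\<ge>N. seminorm_of b ((a *\<^sub>R x m + c *\<^sub>R y m) - (a *\<^sub>R x n + c *\<^sub>R y n)) < e"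
    by blast
qed

lemma hcompletion_hembed: "hembed x \<in> hcompletion b"
  by (simp add: hcompletion_def hembed_def seminorm_of_def form_simps)

text \<open>By the reverse triangle inequality the semi-norms along a Cauchy sequence form a Cauchy
  sequence of reals; squaring gives the form.\<close>

lemma convergent_form_self:
  assumes x: "x \<in> hcompletion b"
  shows "convergent (\<lambda>n. b (x n) (x n))"
proof -
  have "Cauchy (\<lambda>n. seminorm_of b (x n))"
    unfolding Cauchy_def
  proof safe
    fix e :: real assume "0 < e"
    then obtain N where N: "\<And>m n. N \<le> m \<Longrightarrow> N \<le> n \<Longrightarrow> seminorm_of b (x m - x n) < e"
      using x unfolding hcompletion_def by blast
    have "dist (seminorm_of b (x m)) (seminorm_of b (x n)) < e" if "N \<le> m" "N \<le> n" for m n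
      using seminorm_triangle[of "x m - x n" "x n"] seminorm_triangle[of "x n - x m" "x m"]
        N[of m n] N[of n m] that
      by (simp add: dist_real_def)
    then show "\<exists>M. \<forall>m\<ge>M. \<forall>n\<ge>M. dist (seminorm_of b (x m)) (seminorm_of b (x n)) < e"
      by blast
  qed
  then have "convergent (\<lambda>n. (seminorm_of b (x n))\<^sup>2)"
    by (metis Cauchy_convergent_iff convergent_def tendsto_power)
  then show ?thesis by (simp add: seminorm_sq)
qed

text \<open>\<open>hform\<close> is defined with \<open>lim\<close>, which says nothing without
  convergence; on the completion the limit exists. Polarization reduces this to the diagonal
  case.\<close>

lemma hform_tendsto:
  assumes x: "x \<in> hcompletion b" and y: "y \<in> hcompletion b"
  shows "(\<lambda>n. b (x n) (y n)) \<longlonglongrightarrow> hform b x y"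
proof -
  have p: "b (x n) (y n) = (b (1 *\<^sub>R x n + 1 *\<^sub>R y n) (1 *\<^sub>R x n + 1 *\<^sub>R y n)
      - b (1 *\<^sub>R x n + (-1) *\<^sub>R y n) (1 *\<^sub>R x n + (-1) *\<^sub>R y n)) * (1/4)" for n
    using sym[of "x n" "y n"] by (simp add: form_simps)
  have "convergent (\<lambda>n. b (x n) (y n))"
    unfolding p by (intro convergent_mult convergent_diff convergent_const
        convergent_form_self hcompletion_lin x y)
  then show ?thesis by (simp add: hform_def convergent_LIMSEQ_iff)
qed

lemma hform_sym: "hform b x y = hform b y x"
  by (simp add: hform_def sym[of "x _"])

lemma hform_hembed: "hform b (hembed x) (hembed y) = b x y"
  by (simp add: hform_def hembed_def lim_def)

lemma hform_lin_left:
  assumes "x \<in> hcompletion b" "y \<in> hcompletion b" "z \<in> hcompletion b"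
  shows "hform b (\<lambda>n. a *\<^sub>R x n + c *\<^sub>R y n) z = a * hform b x z + c * hform b y z"
proof (rule LIMSEQ_unique)
  show "(\<lambda>n. b (a *\<^sub>R x n + c *\<^sub>R y n) (z n)) \<longlonglongrightarrow> hform b (\<lambda>n. a *\<^sub>R x n + c *\<^sub>R y n) z"
    using assms by (intro hform_tendsto hcompletion_lin)
  show "(\<lambda>n. b (a *\<^sub>R x n + c *\<^sub>R y n) (z n)) \<longlonglongrightarrow> a * hform b x z + c * hform b y z"
    unfolding form_simps real_scaleR_def using assms by (intro tendsto_intros hform_tendsto)
qed

lemma hform_lin_self:
  assumes "x \<in> hcompletion b" "y \<in> hcompletion b"
  shows "hform b (\<lambda>n. a *\<^sub>R x n + c *\<^sub>R y n) (\<lambda>n. a *\<^sub>R x n + c *\<^sub>R y n) =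
    a\<^sup>2 * hform b x x + 2 * a * c * hform b x y + c\<^sup>2 * hform b y y"
proof -
  let ?z = "\<lambda>n. a *\<^sub>R x n + c *\<^sub>R y n"
  have z: "?z \<in> hcompletion b" using assms by (rule hcompletion_lin)
  have "hform b ?z ?z = a * hform b x ?z + c * hform b y ?z"
    using assms z by (rule hform_lin_left)
  also have "hform b x ?z = a * hform b x x + c * hform b y x"
    by (subst hform_sym) (use assms in \<open>simp add: hform_lin_left\<close>)
  also have "hform b y ?z = a * hform b x y + c * hform b y y"
    by (subst hform_sym) (use assms in \<open>simp add: hform_lin_left\<close>)
  finally show ?thesis by (simp add: hform_sym[of y x] power2_eq_square algebra_simps)
qed

lemma hform_self_nonneg:
  assumes "x \<in> hcompletion b"
  shows "0 \<le> hform b x x"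
  by (rule LIMSEQ_le_const[OF hform_tendsto[OF assms assms]]) (simp add: nonneg)

lemma hnorm_sq:
  assumes "x \<in> hcompletion b"
  shows "(hnorm b x)\<^sup>2 = hform b x x"
  by (simp add: hnorm_def hform_self_nonneg[OF assms])

text \<open>Parallelogram identity, with the non-negative squared norm of \<open>a x - c y\<close>
  discarded.\<close>

lemma hnorm_sq_lin_le:
  assumes x: "x \<in> hcompletion b" and y: "y \<in> hcompletion b"
  shows "(hnorm b (\<lambda>n. a *\<^sub>R x n + c *\<^sub>R y n))\<^sup>2 \<le> 2 * a\<^sup>2 * (hnorm b x)\<^sup>2 + 2 * c\<^sup>2 * (hnorm b y)\<^sup>2"
  using hform_self_nonneg[OF hcompletion_lin[OF x y, of a "- c"]]
  unfolding hnorm_sq[OF x] hnorm_sq[OF y] hnorm_sq[OF hcompletion_lin[OF x y]]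
    hform_lin_self[OF x y]
  by (simp add: mult.commute mult.left_commute)

text \<open>Since \<open>2 \<langle>x, d\<rangle> - \<parallel>d\<parallel>\<^sup>2 = \<parallel>x\<parallel>\<^sup>2 - \<parallel>x - d\<parallel>\<^sup>2\<close>, the norm of a family is measurable as soon as
  its products with the elements of a countable dense set are.\<close>

lemma hnorm_sq_eq_SUP:
  assumes x: "x \<in> hcompletion b" and D: "dense_in_hcompletion b D"
  shows "ennreal ((hnorm b x)\<^sup>2) = (SUP d\<in>D. ennreal (2 * hform b x (hembed d) - b d d))"
proof -
  have eq: "2 * hform b x (hembed d) - b d d = (hnorm b x)\<^sup>2 - (hnorm b (\<lambda>n. x n - hembed d n))\<^sup>2" for d
    using hform_lin_self[OF x hcompletion_hembed[of d], of 1 "-1"]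
      hnorm_sq[OF hcompletion_lin[OF x hcompletion_hembed[of d], of 1 "-1"]] hnorm_sq[OF x]
    by (simp add: hform_hembed)
  show ?thesis
  proof (rule antisym)
    show "(SUP d\<in>D. ennreal (2 * hform b x (hembed d) - b d d)) \<le> ennreal ((hnorm b x)\<^sup>2)"
      by (intro SUP_least ennreal_leI) (simp add: eq)
    show "ennreal ((hnorm b x)\<^sup>2) \<le> (SUP d\<in>D. ennreal (2 * hform b x (hembed d) - b d d))"
    proof (rule ennreal_le_epsilon)
      fix e :: real assume e: "0 < e"
      then obtain d where d: "d \<in> D" "hnorm b (\<lambda>n. x n - hembed d n) < sqrt e"
        using D x unfolding dense_in_hcompletion_def by (metis real_sqrt_gt_0_iff)
      have "0 \<le> hnorm b (\<lambda>n. x n - hembed d n)"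
        using hform_self_nonneg[OF hcompletion_lin[OF x hcompletion_hembed[of d], of 1 "-1"]]
        by (simp add: hnorm_def)
      then have "(hnorm b (\<lambda>n. x n - hembed d n))\<^sup>2 \<le> (sqrt e)\<^sup>2"
        using d(2) by (intro power_mono) auto
      then have "(hnorm b x)\<^sup>2 \<le> (2 * hform b x (hembed d) - b d d) + e"
        using e unfolding eq by simp
      then have "ennreal ((hnorm b x)\<^sup>2) \<le> ennreal ((2 * hform b x (hembed d) - b d d) + e)"
        by (rule ennreal_leI)
      \<comment> \<open>\<open>ennreal\<close> truncates negative arguments to zero, hence the case
        split on the sign.\<close>
      also have "\<dots> \<le> ennreal (2 * hform b x (hembed d) - b d d) + ennreal e"
        using e by (cases "0 \<le> 2 * hform b x (hembed d) - b d d")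
          (auto simp: ennreal_neg simp flip: ennreal_plus intro!: ennreal_leI)
      also have "\<dots> \<le> (SUP d\<in>D. ennreal (2 * hform b x (hembed d) - b d d)) + ennreal e"
        by (intro add_right_mono SUP_upper d)
      finally show "ennreal ((hnorm b x)\<^sup>2) \<le> (SUP d\<in>D. ennreal (2 * hform b x (hembed d) - b d d)) + ennreal e" .
    qed
  qed
qed

end

section \<open>Cadlag functions and Doob's inequality\<close>

lemma cadlag_on_lin:
  assumes "cadlag_on S f" "cadlag_on S g"
  shows "cadlag_on S (\<lambda>t. a * f t + b * g t)"
  unfolding cadlag_on_def
proof (intro ballI conjI)
  fix t assume t: "t \<in> S"
  show "((\<lambda>t. a * f t + b * g t) \<longlongrightarrow> a * f t + b * g t) (at t within (S \<inter> {t<..}))"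
    using assms t unfolding cadlag_on_def by (intro tendsto_intros) auto
  obtain l l' where "(f \<longlongrightarrow> l) (at t within (S \<inter> {..<t}))" "(g \<longlongrightarrow> l') (at t within (S \<inter> {..<t}))"
    using assms t unfolding cadlag_on_def by blast
  then have "((\<lambda>t. a * f t + b * g t) \<longlongrightarrow> a * l + b * l') (at t within (S \<inter> {..<t}))"
    by (intro tendsto_intros)
  then show "\<exists>l. ((\<lambda>t. a * f t + b * g t) \<longlongrightarrow> l) (at t within (S \<inter> {..<t}))" ..
qed

lemma cadlag_on_const: "cadlag_on S (\<lambda>_. c)"
  unfolding cadlag_on_def by auto

text \<open>Uniform convergence allows limits to be interchanged: the left limits of the
  \<open>f n\<close> form a Cauchy sequence, and their limit is the left limit of
  \<open>g\<close>.\<close>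

lemma cadlag_on_uniform_limit:
  fixes f :: "nat \<Rightarrow> real \<Rightarrow> real"
  assumes f: "\<And>n. cadlag_on S (f n)" and lim: "uniform_limit S f g sequentially"
  shows "cadlag_on S g"
  unfolding cadlag_on_def
proof (intro ballI conjI)
  fix t assume t: "t \<in> S"
  have "(\<lambda>n. f n t) \<longlonglongrightarrow> g t"
    using tendsto_uniform_limitI[OF lim t] .
  moreover have "uniform_limit (S \<inter> {t<..}) f g sequentially"
    using lim uniform_limit_on_subset by blast
  ultimately show "(g \<longlongrightarrow> g t) (at t within (S \<inter> {t<..}))"
    using f t unfolding cadlag_on_def by (intro swap_uniform_limit[where f=f and g="\<lambda>n. f n t"]) auto
  show "\<exists>l. (g \<longlongrightarrow> l) (at t within (S \<inter> {..<t}))"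
  \<comment> \<open>If \<open>S\<close> does not accumulate at \<open>t\<close> from the left, the
    filter is trivial and every \<open>l\<close> is a limit.\<close>
  proof (cases "at t within (S \<inter> {..<t}) = bot")
    case False
    have "\<forall>n. \<exists>l. (f n \<longlongrightarrow> l) (at t within (S \<inter> {..<t}))"
      using f t unfolding cadlag_on_def by blast
    then obtain l where l: "\<And>n. (f n \<longlongrightarrow> l n) (at t within (S \<inter> {..<t}))"
      by metis
    have "Cauchy l"
    proof (rule metric_CauchyI)
      fix e :: real assume "0 < e"
      have "uniformly_Cauchy_on S f"
        using lim by (meson uniformly_convergent_Cauchy uniformly_convergent_on_def)
      then obtain N where N: "\<And>x m n. x \<in> S \<Longrightarrow> N \<le> m \<Longrightarrow> N \<le> n \<Longrightarrow> dist (f m x) (f n x) < e / 2"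
        unfolding uniformly_Cauchy_on_def using \<open>0 < e\<close> by (metis half_gt_zero)
      have "dist (l m) (l n) < e" if "N \<le> m" "N \<le> n" for m n
      proof -
        have "dist (l m) (l n) \<le> e / 2"
        proof (rule tendsto_upperbound[OF tendsto_dist[OF l l] _ False])
          show "\<forall>\<^sub>F x in at t within (S \<inter> {..<t}). dist (f m x) (f n x) \<le> e / 2"
            using N that by (auto simp: eventually_at_filter less_imp_le)
        qed
        then show ?thesis using \<open>0 < e\<close> by simp
      qed
      then show "\<exists>M. \<forall>m\<ge>M. \<forall>n\<ge>M. dist (l m) (l n) < e" by blast
    qed
    then obtain L where "l \<longlonglongrightarrow> L"
      using Cauchy_convergent_iff convergent_def by blast
    moreover have "uniform_limit (S \<inter> {..<t}) f g sequentially"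
      using lim uniform_limit_on_subset by blast
    ultimately have "(g \<longlongrightarrow> L) (at t within (S \<inter> {..<t}))"
      using l by (intro swap_uniform_limit[where f=f and g=l]) auto
    then show ?thesis by blast
  qed auto
qed

text \<open>On either side of \<open>t\<close> the stopped path agrees locally with \<open>f\<close>
  or with the constant \<open>f b\<close>. At \<open>t = b\<close> the right limit falls under the
  constant case and the left limit under \<open>f\<close>.\<close>

lemma cadlag_on_stop:
  assumes f: "cadlag_on {0..} f" and b: "0 \<le> b"
  shows "cadlag_on {0..T} (\<lambda>t. f (min t b))"
  unfolding cadlag_on_def
proof (intro ballI conjI)
  fix t assume t: "t \<in> {0..T}"
  show "((\<lambda>t. f (min t b)) \<longlongrightarrow> f (min t b)) (at t within ({0..T} \<inter> {t<..}))"
  proof (cases "t < b")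
    case True
    have "(f \<longlongrightarrow> f t) (at t within ({0..T} \<inter> {t<..}))"
      using f t unfolding cadlag_on_def
      by (auto intro: tendsto_within_subset)
    moreover have "\<forall>\<^sub>F x in at t within ({0..T} \<inter> {t<..}). f x = f (min x b)"
      unfolding eventually_at_topological using True
      by (intro exI[of _ "{..<b}"]) (auto simp: min_def)
    ultimately show ?thesis using True by (auto intro: Lim_transform_eventually simp: min_def)
  next
    case False
    then have "\<forall>\<^sub>F x in at t within ({0..T} \<inter> {t<..}). f (min t b) = f (min x b)"
      by (auto simp: eventually_at_filter min_def)
    then show ?thesis by (rule Lim_transform_eventually[OF tendsto_const])
  qed
  show "\<exists>l. ((\<lambda>t. f (min t b)) \<longlongrightarrow> l) (at t within ({0..T} \<inter> {..<t}))"
  proof (cases "t \<le> b")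
    case True
    obtain l where "(f \<longlongrightarrow> l) (at t within ({0..} \<inter> {..<t}))"
      using f t unfolding cadlag_on_def by auto
    then have "(f \<longlongrightarrow> l) (at t within ({0..T} \<inter> {..<t}))"
      by (rule tendsto_within_subset) auto
    moreover have "\<forall>\<^sub>F x in at t within ({0..T} \<inter> {..<t}). f x = f (min x b)"
      using True by (auto simp: eventually_at_filter min_def)
    ultimately show ?thesis by (blast intro: Lim_transform_eventually)
  next
    case False
    have "\<forall>\<^sub>F x in at t within ({0..T} \<inter> {..<t}). f b = f (min x b)"
      unfolding eventually_at_topological using False
      by (intro exI[of _ "{b<..}"]) (auto simp: min_def)
    then show ?thesis by (blast intro: Lim_transform_eventually tendsto_const)
  qed
qed

text \<open>The sequence may hit \<open>t\<close> itself, which the punctured filter in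
  \<open>cadlag_on\<close> excludes; the proof therefore passes to \<open>{t..}\<close>, within
  which \<open>f\<close> is continuous at \<open>t\<close>.\<close>

lemma cadlag_on_right_seq:
  assumes f: "cadlag_on S f" and t: "t \<in> S" and x: "\<And>n. x n \<in> S" "\<And>n. t \<le> x n" "x \<longlonglongrightarrow> t"
  shows "(\<lambda>n. f (x n)) \<longlonglongrightarrow> f t"
proof -
  have "(f \<longlongrightarrow> f t) (at t within (S \<inter> {t<..}))"
    using f t unfolding cadlag_on_def by blast
  then have "(f \<longlongrightarrow> f t) (at t within (S \<inter> {t..}))"
    by (rule Lim_transform_within_set) (auto simp: eventually_at_filter intro!: always_eventually)
  then have "continuous (at t within (S \<inter> {t..})) f"
    by (simp add: continuous_within)
  then show ?thesis
    using x by (intro continuous_within_tendsto_compose'[of t "S \<inter> {t..}" f x]) simp_all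
qed

section \<open>Dyadic grids on \<open>[0,T]\<close> and approximation from the right\<close>

definition dyadic :: "real \<Rightarrow> nat \<Rightarrow> nat \<Rightarrow> real" where
  "dyadic T n k = T * real k / 2 ^ n"

lemma dyadic_mono: "0 \<le> T \<Longrightarrow> j \<le> k \<Longrightarrow> dyadic T n j \<le> dyadic T n k"
  unfolding dyadic_def by (intro divide_right_mono mult_left_mono) auto

text \<open>Nestedness of the grids makes the running maxima in \<open>doob_L2\<close> increase with
  \<open>n\<close>.\<close>

lemma dyadic_refine: "dyadic T n k = dyadic T (Suc n) (2 * k)"
  by (simp add: dyadic_def)

lemma dyadic_mem: "0 \<le> T \<Longrightarrow> k \<le> 2 ^ n \<Longrightarrow> dyadic T n k \<in> {0..T}"
  using dyadic_mono[of T k "2 ^ n" n] by (simp add: dyadic_def)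

text \<open>Rounding up to the grid overshoots by at most \<open>T / 2 ^ n\<close>. Rounding down
  would not do, since a cadlag path is in general continuous only from the right.\<close>

lemma dyadic_right_approx:
  assumes T: "0 < T" and t: "t \<in> {0..T}"
  defines "k \<equiv> \<lambda>n. nat \<lceil>t * 2 ^ n / T\<rceil>"
  shows "k n \<le> 2 ^ n" "t \<le> dyadic T n (k n)"
    "(\<lambda>n. dyadic T n (k n)) \<longlonglongrightarrow> t"
proof -
  have pos: "0 \<le> \<lceil>t * 2 ^ n / T\<rceil>" for n
    using t T by (simp add: ceiling_mono[of 0, simplified] divide_nonneg_pos less_le_trans[of "-1" 0])
  have "t * 2 ^ n / T \<le> 2 ^ n" for n
    using t T by (simp add: field_simps)
  then have "\<lceil>t * 2 ^ n / T\<rceil> \<le> 2 ^ n" for n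
    by (simp add: ceiling_le_iff)
  then show "k n \<le> 2 ^ n" for n
    unfolding k_def by (simp add: nat_le_iff)
  have kr: "real (k n) = of_int \<lceil>t * 2 ^ n / T\<rceil>" for n
    unfolding k_def using pos[of n] by simp
  have lo: "t \<le> dyadic T n (k n)" for n
  proof -
    have "t * 2 ^ n / T \<le> real (k n)" unfolding kr by (rule le_of_int_ceiling)
    then show ?thesis using T by (simp add: dyadic_def field_simps)
  qed
  then show "t \<le> dyadic T n (k n)" .
  have hi: "dyadic T n (k n) \<le> t + T / 2 ^ n" for n
  proof -
    have "real (k n) \<le> t * 2 ^ n / T + 1" unfolding kr by (rule of_int_ceiling_le_add_one)
    then show ?thesis using T by (simp add: dyadic_def field_simps)
  qed
  have "(\<lambda>n. t + T * (1/2) ^ n) \<longlonglongrightarrow> t + T * 0"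
    by (intro tendsto_intros LIMSEQ_power_zero) auto
  then have *: "(\<lambda>n. t + T / 2 ^ n) \<longlonglongrightarrow> t" by (simp add: power_divide)
  show "(\<lambda>n. dyadic T n (k n)) \<longlonglongrightarrow> t"
    by (rule tendsto_sandwich[OF _ _ tendsto_const *]) (use lo hi in auto)
qed

text \<open>The grids approach every point of \<open>[0,T]\<close> from the right and contain
  \<open>T\<close>, so countably many equalities decide the whole path.\<close>

lemma cadlag_on_eqI:
  assumes T: "0 < T" and f: "cadlag_on {0..T} f" and g: "cadlag_on {0..T} g"
    and eq: "\<And>n k. k \<le> 2 ^ n \<Longrightarrow> f (dyadic T n k) = g (dyadic T n k)"
    and t: "t \<in> {0..T}"
  shows "f t = g t"
proof -
  let ?x = "\<lambda>n. dyadic T n (nat \<lceil>t * 2 ^ n / T\<rceil>)"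
  note r = dyadic_right_approx[OF T t]
  have m: "?x n \<in> {0..T}" for n using r(1) T by (intro dyadic_mem) auto
  have "(\<lambda>n. f (?x n)) \<longlonglongrightarrow> f t" by (rule cadlag_on_right_seq[OF f t m r(2,3)])
  moreover have "(\<lambda>n. g (?x n)) \<longlonglongrightarrow> g t" by (rule cadlag_on_right_seq[OF g t m r(2,3)])
  moreover have "f (?x n) = g (?x n)" for n using r(1) by (rule eq)
  ultimately show ?thesis by (simp add: LIMSEQ_unique)
qed

section \<open>Running maxima and the pathwise Doob inequality\<close>

primrec runmax :: "(nat \<Rightarrow> real) \<Rightarrow> nat \<Rightarrow> real" where
  "runmax s 0 = s 0"
| "runmax s (Suc n) = max (runmax s n) (s (Suc n))"

lemma runmax_le_iff: "runmax s n \<le> c \<longleftrightarrow> (\<forall>i\<le>n. s i \<le> c)"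
  by (induction n) (auto simp: le_Suc_eq)

lemma runmax_ge: "i \<le> n \<Longrightarrow> s i \<le> runmax s n"
  using runmax_le_iff by blast

lemma runmax_attained: "\<exists>i\<le>n. runmax s n = s i"
proof (induction n)
  case (Suc n)
  then obtain i where i: "i \<le> n" "runmax s n = s i" by blast
  show ?case
  proof (cases "runmax s n \<le> s (Suc n)")
    case True
    then have "runmax s (Suc n) = s (Suc n)" by (simp add: max_absorb2)
    then show ?thesis by blast
  next
    case False
    then have "runmax s (Suc n) = s i" using i by simp
    then show ?thesis using i le_SucI by blast
  qed
qed simp

text \<open>The pathwise form of Doob's inequality: for a non-negative submartingale the sum on the
  left has non-negative expectation.\<close>

lemma doob_pathwise:
  "4 * (\<Sum>i<n. runmax s i * (s (Suc i) - s i)) + (runmax s n)\<^sup>2 \<le> 4 * (s n)\<^sup>2"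
proof -
  \<comment> \<open>This bound is suited to induction: adding the next summand merely turns
    \<open>runmax s n * s n\<close> into \<open>runmax s n * s (Suc n)\<close>.\<close>
  have "(\<Sum>i<n. runmax s i * (s (Suc i) - s i)) \<le> runmax s n * s n - (runmax s n)\<^sup>2 / 2"
  proof (induction n)
    case (Suc n)
    define m where "m = runmax s n"
    \<comment> \<open>The parabola \<open>x * s (Suc n) - x\<^sup>2 / 2\<close> is largest at
      \<open>x = s (Suc n)\<close>, so replacing \<open>m\<close> by the new maximum cannot lower
      it.\<close>
    have "m * s (Suc n) - m\<^sup>2 / 2 \<le> max m (s (Suc n)) * s (Suc n) - (max m (s (Suc n)))\<^sup>2 / 2"
    proof (cases "s (Suc n) \<le> m")
      case False
      then show ?thesis
        using zero_le_power2[of "s (Suc n) - m"]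
        by (simp add: max_def power2_eq_square algebra_simps)
    qed (simp add: max_def)
    then show ?case using Suc by (simp add: m_def algebra_simps)
  qed (simp add: power2_eq_square)
  \<comment> \<open>The square of \<open>2 * s n - runmax s n\<close> absorbs the mixed term and
    produces the constant 4.\<close>
  moreover have "0 \<le> 4 * (s n)\<^sup>2 - 4 * (runmax s n * s n) + (runmax s n)\<^sup>2"
    using zero_le_power2[of "2 * s n - runmax s n"]
    by (simp add: power2_diff power_mult_distrib mult_ac)
  ultimately show ?thesis by linarith
qed

section \<open>L2 estimates, almost sure limits and uniform limits\<close>

lemma integrable_mult_of_squares:
  fixes f g :: "'w \<Rightarrow> real"
  assumes [measurable]: "f \<in> borel_measurable N" "g \<in> borel_measurable N"
    and "integrable N (\<lambda>x. (f x)\<^sup>2)" "integrable N (\<lambda>x. (g x)\<^sup>2)"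
  shows "integrable N (\<lambda>x. f x * g x)"
proof (rule Bochner_Integration.integrable_bound)
  show "integrable N (\<lambda>x. (f x)\<^sup>2 + (g x)\<^sup>2)" using assms by simp
  have "\<bar>a * b\<bar> \<le> a\<^sup>2 + b\<^sup>2" for a b :: real
  proof -
    have "2 * \<bar>a * b\<bar> \<le> a\<^sup>2 + b\<^sup>2"
      using zero_le_power2[of "\<bar>a\<bar> - \<bar>b\<bar>"] by (simp add: power2_diff abs_mult)
    then show ?thesis using abs_ge_zero[of "a * b"] by linarith
  qed
  then show "AE x in N. norm (f x * g x) \<le> norm ((f x)\<^sup>2 + (g x)\<^sup>2)"
    by (auto intro!: AE_I2 order_trans[OF _ abs_ge_self])
qed measurable

lemma integrable_square_lin:
  fixes f g :: "'w \<Rightarrow> real"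
  assumes [measurable]: "f \<in> borel_measurable N" "g \<in> borel_measurable N"
    and "integrable N (\<lambda>x. (f x)\<^sup>2)" "integrable N (\<lambda>x. (g x)\<^sup>2)"
  shows "integrable N (\<lambda>x. (a * f x + b * g x)\<^sup>2)"
proof -
  have "(\<lambda>x. (a * f x + b * g x)\<^sup>2) = (\<lambda>x. a\<^sup>2 * (f x)\<^sup>2 + 2 * a * b * (f x * g x) + b\<^sup>2 * (g x)\<^sup>2)"
    by (simp add: fun_eq_iff power2_eq_square algebra_simps)
  moreover have "integrable N \<dots>"
    using integrable_mult_of_squares[OF assms] assms(3,4)
    by (intro Bochner_Integration.integrable_add integrable_mult_right)
  ultimately show ?thesis by simp
qed

lemma integrable_square_diff:
  fixes f g :: "'w \<Rightarrow> real"
  assumes "f \<in> borel_measurable N" "g \<in> borel_measurable N"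
    and "integrable N (\<lambda>x. (f x)\<^sup>2)" "integrable N (\<lambda>x. (g x)\<^sup>2)"
  shows "integrable N (\<lambda>x. (f x - g x)\<^sup>2)"
  using integrable_square_lin[OF assms, of 1 "-1"] by simp

text \<open>Fatou's lemma for \<open>(f n x - g x)\<^sup>2\<close>: as the pointwise limit is known
  to exist, it must be the L2 limit, without passing to subsequences.\<close>

lemma AE_eq_of_L2_limit:
  fixes f :: "nat \<Rightarrow> 'w \<Rightarrow> real"
  assumes [measurable]: "\<And>n. f n \<in> borel_measurable N" "g \<in> borel_measurable N"
    and int: "\<And>n. integrable N (\<lambda>x. (f n x - g x)\<^sup>2)"
    and lim: "(\<lambda>n. \<integral>x. (f n x - g x)\<^sup>2 \<partial>N) \<longlonglongrightarrow> 0"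
    and ptw: "AE x in N. (\<lambda>n. f n x) \<longlonglongrightarrow> h x"
  shows "AE x in N. h x = g x"
proof -
  have "(\<integral>\<^sup>+x. liminf (\<lambda>n. ennreal ((f n x - g x)\<^sup>2)) \<partial>N) \<le> liminf (\<lambda>n. \<integral>\<^sup>+x. ennreal ((f n x - g x)\<^sup>2) \<partial>N)"
    by (rule nn_integral_liminf) measurable
  also have "(\<lambda>n. \<integral>\<^sup>+x. ennreal ((f n x - g x)\<^sup>2) \<partial>N) = (\<lambda>n. ennreal (\<integral>x. (f n x - g x)\<^sup>2 \<partial>N))"
    by (intro ext nn_integral_eq_integral int) simp
  also have "liminf \<dots> = ennreal 0"
    by (intro lim_imp_Liminf tendsto_ennrealI lim) simp
  finally have "(\<integral>\<^sup>+x. liminf (\<lambda>n. ennreal ((f n x - g x)\<^sup>2)) \<partial>N) = 0" by simp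
  then have "AE x in N. liminf (\<lambda>n. ennreal ((f n x - g x)\<^sup>2)) = 0"
    by (subst (asm) nn_integral_0_iff_AE) measurable
  with ptw show ?thesis
  proof eventually_elim
    fix x assume l: "(\<lambda>n. f n x) \<longlonglongrightarrow> h x" and z: "liminf (\<lambda>n. ennreal ((f n x - g x)\<^sup>2)) = 0"
    have "liminf (\<lambda>n. ennreal ((f n x - g x)\<^sup>2)) = ennreal ((h x - g x)\<^sup>2)"
      by (intro lim_imp_Liminf tendsto_ennrealI tendsto_intros l) simp
    then show "h x = g x" using z by (simp add: ennreal_eq_0_iff)
  qed
qed

lemma sq_diff_le: "(x - z)\<^sup>2 \<le> 2 * (x - y)\<^sup>2 + 2 * (y - z)\<^sup>2" for x y z :: real
  using zero_le_power2[of "(x - y) - (y - z)"] by (simp add: power2_eq_square algebra_simps)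

text \<open>The Weierstrass test for the telescoping series. The limit is written as a pointwise
  \<open>lim\<close> because that expression is defined at every sample point and inherits
  measurability.\<close>

lemma uniform_limit_of_increments:
  fixes f :: "nat \<Rightarrow> 'b \<Rightarrow> real"
  assumes "\<And>k x. x \<in> S \<Longrightarrow> \<bar>f (Suc k) x - f k x\<bar> \<le> C * (1/2) ^ k"
  shows "uniform_limit S f (\<lambda>x. lim (\<lambda>k. f k x)) sequentially"
proof -
  have "uniform_limit S (\<lambda>n x. \<Sum>i<n. f (Suc i) x - f i x) (\<lambda>x. suminf (\<lambda>i. f (Suc i) x - f i x)) sequentially"
    using assms by (intro Weierstrass_m_test[where M="\<lambda>k. C * (1/2) ^ k"] summable_mult summable_geometric) auto
  then have "uniform_limit S (\<lambda>n x. f 0 x + (\<Sum>i<n. f (Suc i) x - f i x))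
      (\<lambda>x. f 0 x + suminf (\<lambda>i. f (Suc i) x - f i x)) sequentially"
    by (intro uniform_limit_add uniform_limit_const)
  moreover have "f 0 x + (\<Sum>i<n. f (Suc i) x - f i x) = f n x" for n x
    using sum_lessThan_telescope[of "\<lambda>i. f i x" n] by simp
  ultimately have u: "uniform_limit S f (\<lambda>x. f 0 x + suminf (\<lambda>i. f (Suc i) x - f i x)) sequentially"
    by simp
  show ?thesis
  proof (rule uniform_limit_cong'[THEN iffD1, OF refl _ u])
    fix x assume "x \<in> S"
    then show "f 0 x + suminf (\<lambda>i. f (Suc i) x - f i x) = lim (\<lambda>k. f k x)"
      by (rule limI[OF tendsto_uniform_limitI[OF u], symmetric])
  qed
qed

lemma runmax_measurable:
  assumes "\<And>i. i \<le> n \<Longrightarrow> (\<lambda>\<omega>. s i \<omega>) \<in> borel_measurable N"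
  shows "(\<lambda>\<omega>. runmax (\<lambda>i. s i \<omega>) n) \<in> borel_measurable N"
  using assms by (induction n) auto

text \<open>Right continuity reduces the uncountable supremum to the grids. This yields its
  measurability and lets monotone convergence carry Doob's inequality to continuous time.\<close>

lemma cadlag_SUP_sq_eq:
  assumes T: "0 < T" and f: "cadlag_on {0..T} f"
  shows "(SUP t\<in>{0..T}. ennreal ((f t)\<^sup>2)) =
    (SUP n. ennreal ((runmax (\<lambda>k. \<bar>f (dyadic T n k)\<bar>) (2 ^ n))\<^sup>2))" (is "?L = ?R")
proof (rule antisym)
  show "?L \<le> ?R"
  proof (rule SUP_least)
    fix t assume t: "t \<in> {0..T}"
    let ?k = "\<lambda>n. nat \<lceil>t * 2 ^ n / T\<rceil>"
    note r = dyadic_right_approx[OF T t]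
    have m: "dyadic T n (?k n) \<in> {0..T}" for n using r(1) T by (intro dyadic_mem) auto
    have "(\<lambda>n. f (dyadic T n (?k n))) \<longlonglongrightarrow> f t" by (rule cadlag_on_right_seq[OF f t m r(2,3)])
    then have lim: "(\<lambda>n. ennreal ((f (dyadic T n (?k n)))\<^sup>2)) \<longlonglongrightarrow> ennreal ((f t)\<^sup>2)"
      by (intro tendsto_ennrealI tendsto_intros)
    have le: "ennreal ((f (dyadic T n (?k n)))\<^sup>2) \<le> ?R" for n
    proof -
      have "(f (dyadic T n (?k n)))\<^sup>2 = \<bar>f (dyadic T n (?k n))\<bar>\<^sup>2" by simp
      also have "\<dots> \<le> (runmax (\<lambda>k. \<bar>f (dyadic T n k)\<bar>) (2 ^ n))\<^sup>2"
        using runmax_ge[OF r(1), of "\<lambda>k. \<bar>f (dyadic T n k)\<bar>"] by (intro power_mono) auto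
      finally show ?thesis by (intro SUP_upper2[of n]) (auto intro: ennreal_leI)
    qed
    show "ennreal ((f t)\<^sup>2) \<le> ?R"
      by (rule LIMSEQ_le_const2[OF lim]) (use le in blast)
  qed
  show "?R \<le> ?L"
  proof (rule SUP_least)
    fix n
    obtain k where k: "k \<le> 2 ^ n" "runmax (\<lambda>k. \<bar>f (dyadic T n k)\<bar>) (2 ^ n) = \<bar>f (dyadic T n k)\<bar>"
      using runmax_attained by blast
    show "ennreal ((runmax (\<lambda>k. \<bar>f (dyadic T n k)\<bar>) (2 ^ n))\<^sup>2) \<le> ?L"
      unfolding k(2) using dyadic_mem[OF less_imp_le[OF T] k(1)] by (intro SUP_upper2) auto
  qed
qed

section \<open>Square integrable martingales on a filtered probability space\<close>

locale filtered_prob = prob_space P for P :: "'w measure" +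
  fixes F :: "real \<Rightarrow> 'w measure"
  assumes usual: "usual_filtration P F"
begin

lemma subalgF: "0 \<le> t \<Longrightarrow> subalgebra P (F t)"
  using usual[unfolded usual_filtration_def, THEN conjunct1] by simp

lemma space_F: "0 \<le> t \<Longrightarrow> space (F t) = space P"
  using subalgF by (auto simp: subalgebra_def)

lemma F_mono: "0 \<le> s \<Longrightarrow> s \<le> t \<Longrightarrow> sets (F s) \<subseteq> sets (F t)"
  using usual[unfolded usual_filtration_def, THEN conjunct2, THEN conjunct1] by simp

text \<open>Usual conditions: a process may be redefined on a null set and remain adapted.\<close>

lemma null_in_F: "0 \<le> t \<Longrightarrow> N \<in> null_sets P \<Longrightarrow> N \<in> sets (F t)"
  using usual[unfolded usual_filtration_def, THEN conjunct2, THEN conjunct2, THEN conjunct1]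
    F_mono[of 0 t] by auto

lemma measurable_F_mono:
  assumes "0 \<le> s" "s \<le> t" "f \<in> borel_measurable (F s)"
  shows "f \<in> borel_measurable (F t)"
proof (rule measurable_from_subalg[OF _ assms(3)])
  show "subalgebra (F t) (F s)"
    using assms F_mono[of s t] space_F[of s] space_F[of t] by (simp add: subalgebra_def)
qed

lemma measurable_F_P: "0 \<le> t \<Longrightarrow> f \<in> borel_measurable (F t) \<Longrightarrow> f \<in> borel_measurable P"
  by (rule measurable_from_subalg[OF subalgF])

lemma sets_F_P: "0 \<le> t \<Longrightarrow> A \<in> sets (F t) \<Longrightarrow> A \<in> sets P"
  using subalgF by (auto simp: subalgebra_def)

lemma integrable_of_square:
  fixes f :: "'w \<Rightarrow> real"
  assumes "f \<in> borel_measurable P" "integrable P (\<lambda>\<omega>. (f \<omega>)\<^sup>2)"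
  shows "integrable P f"
  using integrable_mult_of_squares[of f P "\<lambda>_. 1"] assms by simp

text \<open>The factor \<open>H\<close>, known at time \<open>s\<close>, is pulled out of the
  conditional expectation. Indicators give the usual martingale test; in
  \<open>doob_discrete\<close>, \<open>H\<close> is a running maximum times a sign.\<close>

lemma sq_martingale_mult:
  assumes Z: "Z \<in> sq_martingales P F S" and s: "s \<in> S" "0 \<le> s" and t: "t \<in> S" "s \<le> t"
    and H: "H \<in> borel_measurable (F s)" "integrable P (\<lambda>\<omega>. (H \<omega>)\<^sup>2)"
  shows "integrable P (\<lambda>\<omega>. H \<omega> * Z t \<omega>)"
    and "(\<integral>\<omega>. H \<omega> * Z t \<omega> \<partial>P) = (\<integral>\<omega>. H \<omega> * Z s \<omega> \<partial>P)"
proof -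
  interpret sub: finite_measure_subalgebra P "F s"
    by unfold_locales (rule subalgF[OF s(2)])
  have Zs: "Z s \<in> borel_measurable P" and Zt: "Z t \<in> borel_measurable P"
    using Z s t measurable_F_P[of s "Z s"] measurable_F_P[of t "Z t"]
    unfolding sq_martingales_def by auto
  have sqt: "integrable P (\<lambda>\<omega>. (Z t \<omega>)\<^sup>2)" and ae: "AE \<omega> in P. real_cond_exp P (F s) (Z t) \<omega> = Z s \<omega>"
    using Z s t unfolding sq_martingales_def by auto
  have HP: "H \<in> borel_measurable P" using measurable_F_P[OF s(2) H(1)] .
  show int: "integrable P (\<lambda>\<omega>. H \<omega> * Z t \<omega>)"
    by (rule integrable_mult_of_squares[OF HP Zt H(2) sqt])
  have "(\<integral>\<omega>. H \<omega> * Z t \<omega> \<partial>P) = (\<integral>\<omega>. H \<omega> * real_cond_exp P (F s) (Z t) \<omega> \<partial>P)"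
    using sub.real_cond_exp_intg(2)[OF int H(1) Zt] by simp
  also have "\<dots> = (\<integral>\<omega>. H \<omega> * Z s \<omega> \<partial>P)"
    using HP Zs ae by (intro integral_cong_AE) (auto simp: borel_measurable_cond_exp2)
  finally show "(\<integral>\<omega>. H \<omega> * Z t \<omega> \<partial>P) = (\<integral>\<omega>. H \<omega> * Z s \<omega> \<partial>P)" .
qed

lemma sq_martingaleD:
  assumes "Z \<in> sq_martingales P F S" "t \<in> S" "0 \<le> t"
  shows "Z t \<in> borel_measurable (F t)" "Z t \<in> borel_measurable P"
    "integrable P (\<lambda>\<omega>. (Z t \<omega>)\<^sup>2)" "integrable P (Z t)" "(\<integral>\<omega>. Z t \<omega> \<partial>P) = 0"
    "\<omega> \<in> space P \<Longrightarrow> cadlag_on S (\<lambda>t. Z t \<omega>)"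
  using assms measurable_F_P[of t "Z t"] unfolding sq_martingales_def by auto

text \<open>Integrals over the events of \<open>F s\<close> determine the conditional expectation.
  In this form the martingale property passes to L2 limits by an elementary estimate.\<close>

lemma sq_martingaleI:
  assumes S: "S \<subseteq> {0..}"
    and meas: "\<And>t. t \<in> S \<Longrightarrow> Z t \<in> borel_measurable (F t)"
    and sq: "\<And>t. t \<in> S \<Longrightarrow> integrable P (\<lambda>\<omega>. (Z t \<omega>)\<^sup>2)"
    and mean: "\<And>t. t \<in> S \<Longrightarrow> (\<integral>\<omega>. Z t \<omega> \<partial>P) = 0"
    and mart: "\<And>s t G. s \<in> S \<Longrightarrow> t \<in> S \<Longrightarrow> s \<le> t \<Longrightarrow> G \<in> sets (F s) \<Longrightarrow>
      (\<integral>\<omega>. indicator G \<omega> * Z t \<omega> \<partial>P) = (\<integral>\<omega>. indicator G \<omega> * Z s \<omega> \<partial>P)"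
    and cadlag: "\<And>\<omega>. \<omega> \<in> space P \<Longrightarrow> cadlag_on S (\<lambda>t. Z t \<omega>)"
  shows "Z \<in> sq_martingales P F S"
proof -
  have int: "integrable P (Z t)" if "t \<in> S" for t
    using that S integrable_of_square[OF measurable_F_P[OF _ meas[OF that]] sq[OF that]] by auto
  have "AE \<omega> in P. real_cond_exp P (F s) (Z t) \<omega> = Z s \<omega>" if st: "s \<in> S" "t \<in> S" "s \<le> t" for s t
  proof -
    have "0 \<le> s" using st S by auto
    interpret sub: finite_measure_subalgebra P "F s"
      by unfold_locales (rule subalgF[OF \<open>0 \<le> s\<close>])
    show ?thesis
      using mart[OF st] int st meas
      by (intro sub.real_cond_exp_charact) (auto simp: set_lebesgue_integral_def)
  qed
  then show ?thesis
    using meas sq mean cadlag int unfolding sq_martingales_def by auto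
qed

lemma integrable_indicator_sq:
  assumes "0 \<le> s" "G \<in> sets (F s)"
  shows "indicator G \<in> borel_measurable (F s)"
    "integrable P (\<lambda>\<omega>. (indicator G \<omega> :: real)\<^sup>2)"
proof -
  have [measurable]: "G \<in> sets P" using sets_F_P assms by blast
  show "integrable P (\<lambda>\<omega>. (indicator G \<omega> :: real)\<^sup>2)"
    by (rule integrable_const_bound[where B=1]) (auto simp: indicator_def)
qed (use assms in simp)

lemma sq_martingale_lin:
  assumes S: "S \<subseteq> {0..}" and X: "X \<in> sq_martingales P F S" and Y: "Y \<in> sq_martingales P F S"
  shows "(\<lambda>t \<omega>. a * X t \<omega> + b * Y t \<omega>) \<in> sq_martingales P F S"
proof (rule sq_martingaleI[OF S])
  fix t assume t: "t \<in> S"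
  then have t0: "0 \<le> t" using S by auto
  note D = sq_martingaleD[OF X t t0] sq_martingaleD[OF Y t t0]
  show "(\<lambda>\<omega>. a * X t \<omega> + b * Y t \<omega>) \<in> borel_measurable (F t)"
    using D by (intro borel_measurable_add borel_measurable_times) auto
  show "integrable P (\<lambda>\<omega>. (a * X t \<omega> + b * Y t \<omega>)\<^sup>2)"
    using D by (intro integrable_square_lin)
  show "(\<integral>\<omega>. a * X t \<omega> + b * Y t \<omega> \<partial>P) = 0"
    using D by simp
next
  fix s t G assume st: "s \<in> S" "t \<in> S" "s \<le> t" and G: "G \<in> sets (F s)"
  then have s0: "0 \<le> s" using S by auto
  note i = integrable_indicator_sq[OF s0 G]
  note mX = sq_martingale_mult[OF X st(1) s0 st(2,3) i] sq_martingale_mult[OF X st(1) s0 st(1) order_refl i]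
  note mY = sq_martingale_mult[OF Y st(1) s0 st(2,3) i] sq_martingale_mult[OF Y st(1) s0 st(1) order_refl i]
  have e: "(\<lambda>\<omega>. indicator G \<omega> * (a * X r \<omega> + b * Y r \<omega>)) =
    (\<lambda>\<omega>. a * (indicator G \<omega> * X r \<omega>) + b * (indicator G \<omega> * Y r \<omega>))" for r
    by (simp add: fun_eq_iff algebra_simps)
  show "(\<integral>\<omega>. indicator G \<omega> * (a * X t \<omega> + b * Y t \<omega>) \<partial>P) = (\<integral>\<omega>. indicator G \<omega> * (a * X s \<omega> + b * Y s \<omega>) \<partial>P)"
    unfolding e using mX mY by simp
next
  fix \<omega> assume "\<omega> \<in> space P"
  then show "cadlag_on S (\<lambda>t. a * X t \<omega> + b * Y t \<omega>)"
    using X Y unfolding sq_martingales_def by (intro cadlag_on_lin) auto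
qed

lemma sq_martingale_zero: "S \<subseteq> {0..} \<Longrightarrow> (\<lambda>_ _. 0) \<in> sq_martingales P F S"
  by (rule sq_martingaleI) (auto simp: cadlag_on_const)

lemma sq_martingale_sum:
  assumes "S \<subseteq> {0..}" "\<And>i. i \<in> A \<Longrightarrow> Z i \<in> sq_martingales P F S"
  shows "(\<lambda>t \<omega>. \<Sum>i\<in>A. Z i t \<omega>) \<in> sq_martingales P F S"
  using assms(2)
proof (induction A rule: infinite_finite_induct)
  case (insert x A)
  then show ?case
    using sq_martingale_lin[OF assms(1), of "Z x" "\<lambda>t \<omega>. \<Sum>i\<in>A. Z i t \<omega>" 1 1] by simp
qed (use sq_martingale_zero[OF assms(1)] in auto)

text \<open>The pathwise inequality is integrated along the absolute values of \<open>Z\<close>.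
  What remains is that its sum has non-negative mean; this is the submartingale property of the
  absolute value, obtained here from signs.\<close>

lemma doob_discrete:
  assumes Z: "Z \<in> sq_martingales P F S" and S: "S \<subseteq> {0..}"
    and \<tau>: "\<And>i. i \<le> n \<Longrightarrow> \<tau> i \<in> S" "\<And>i j. i \<le> j \<Longrightarrow> \<tau> i \<le> \<tau> j"
  defines "m \<equiv> \<lambda>k \<omega>. runmax (\<lambda>i. \<bar>Z (\<tau> i) \<omega>\<bar>) k"
  shows "integrable P (\<lambda>\<omega>. (m n \<omega>)\<^sup>2)" "(\<integral>\<omega>. (m n \<omega>)\<^sup>2 \<partial>P) \<le> 4 * (\<integral>\<omega>. (Z (\<tau> n) \<omega>)\<^sup>2 \<partial>P)"
proof -
  have \<tau>0: "0 \<le> \<tau> i" if "i \<le> n" for i using \<tau>(1)[OF that] S by auto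
  note D = sq_martingaleD[OF Z \<tau>(1) \<tau>0]
  have mF: "m k \<in> borel_measurable (F (\<tau> k))" if k: "k \<le> n" for k
    unfolding m_def
  proof (rule runmax_measurable)
    fix i assume "i \<le> k"
    then have "Z (\<tau> i) \<in> borel_measurable (F (\<tau> k))"
      using k \<tau>0 D(1)[of i] by (intro measurable_F_mono[OF _ \<tau>(2)[OF \<open>i \<le> k\<close>]]) auto
    then show "(\<lambda>\<omega>. \<bar>Z (\<tau> i) \<omega>\<bar>) \<in> borel_measurable (F (\<tau> k))" by simp
  qed
  have mP: "m k \<in> borel_measurable P" if k: "k \<le> n" for k
    using measurable_F_P[OF \<tau>0 mF] k by blast
  have m0: "0 \<le> m k \<omega>" for k \<omega>
    using runmax_ge[of 0 k "\<lambda>i. \<bar>Z (\<tau> i) \<omega>\<bar>"] by (auto simp: m_def intro: order_trans)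
  have msq: "integrable P (\<lambda>\<omega>. (m k \<omega>)\<^sup>2)" if k: "k \<le> n" for k
  proof (rule Bochner_Integration.integrable_bound)
    show "integrable P (\<lambda>\<omega>. \<Sum>i\<le>k. (Z (\<tau> i) \<omega>)\<^sup>2)"
      using D(3) k by (intro Bochner_Integration.integrable_sum) auto
    show "(\<lambda>\<omega>. (m k \<omega>)\<^sup>2) \<in> borel_measurable P" using mP[OF k] by simp
    have "(m k \<omega>)\<^sup>2 \<le> (\<Sum>i\<le>k. (Z (\<tau> i) \<omega>)\<^sup>2)" for \<omega>
    proof -
      obtain i where "i \<le> k" "m k \<omega> = \<bar>Z (\<tau> i) \<omega>\<bar>"
        using runmax_attained[of k "\<lambda>i. \<bar>Z (\<tau> i) \<omega>\<bar>"] unfolding m_def by blast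
      then show ?thesis
        by (auto intro!: member_le_sum[of i "{..k}" "\<lambda>i. (Z (\<tau> i) \<omega>)\<^sup>2"])
    qed
    then show "AE \<omega> in P. norm ((m k \<omega>)\<^sup>2) \<le> norm (\<Sum>i\<le>k. (Z (\<tau> i) \<omega>)\<^sup>2)"
      by (auto intro!: AE_I2 order_trans[OF _ abs_ge_self])
  qed
  then show "integrable P (\<lambda>\<omega>. (m n \<omega>)\<^sup>2)" by simp
  define d where "d = (\<lambda>i \<omega>. m i \<omega> * (\<bar>Z (\<tau> (Suc i)) \<omega>\<bar> - \<bar>Z (\<tau> i) \<omega>\<bar>))"
  have d: "integrable P (d i) \<and> 0 \<le> (\<integral>\<omega>. d i \<omega> \<partial>P)" if i: "i < n" for i
  proof
    have i': "i \<le> n" "Suc i \<le> n" using i by auto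
    have abs: "(\<lambda>\<omega>. \<bar>Z (\<tau> j) \<omega>\<bar>) \<in> borel_measurable P" "integrable P (\<lambda>\<omega>. \<bar>Z (\<tau> j) \<omega>\<bar>\<^sup>2)" if "j \<le> n" for j
      using D(2,3)[OF that that] by auto
    show intd: "integrable P (d i)"
      unfolding d_def right_diff_distrib
      using i' mP msq abs by (intro Bochner_Integration.integrable_diff integrable_mult_of_squares)
    \<comment> \<open>The sign linearises the absolute value from below: the increment of the
      absolute value is at least \<open>sgn (Z (\<tau> i) \<omega>)\<close> times the increment of
      \<open>Z\<close>, and the latter has mean zero against \<open>H\<close>.\<close>
    define H where "H = (\<lambda>\<omega>. m i \<omega> * sgn (Z (\<tau> i) \<omega>))"
    have HF: "H \<in> borel_measurable (F (\<tau> i))"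
      unfolding H_def using mF[OF i'(1)] D(1)[OF i'(1) i'(1)]
      by (intro borel_measurable_times) auto
    have Hsq: "integrable P (\<lambda>\<omega>. (H \<omega>)\<^sup>2)"
    proof (rule Bochner_Integration.integrable_bound[OF msq[OF i'(1)]])
      show "(\<lambda>\<omega>. (H \<omega>)\<^sup>2) \<in> borel_measurable P"
        using measurable_F_P[OF \<tau>0[OF i'(1)] HF] by simp
      show "AE \<omega> in P. norm ((H \<omega>)\<^sup>2) \<le> norm ((m i \<omega>)\<^sup>2)"
        by (auto simp: H_def power_mult_distrib sgn_if)
    qed
    note st = \<tau>(1)[OF i'(1)] \<tau>0[OF i'(1)] \<tau>(1)[OF i'(2)]
    have le: "\<tau> i \<le> \<tau> (Suc i)" by (rule \<tau>(2)) simp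
    note mm = sq_martingale_mult[OF Z st le HF Hsq] sq_martingale_mult[OF Z st(1,2,1) order_refl HF Hsq]
    have "(\<integral>\<omega>. H \<omega> * Z (\<tau> (Suc i)) \<omega> - H \<omega> * Z (\<tau> i) \<omega> \<partial>P) = 0"
      using mm by simp
    moreover have "(\<integral>\<omega>. H \<omega> * Z (\<tau> (Suc i)) \<omega> - H \<omega> * Z (\<tau> i) \<omega> \<partial>P) \<le> (\<integral>\<omega>. d i \<omega> \<partial>P)"
    proof (rule integral_mono[OF _ intd])
      show "integrable P (\<lambda>\<omega>. H \<omega> * Z (\<tau> (Suc i)) \<omega> - H \<omega> * Z (\<tau> i) \<omega>)" using mm by simp
      fix \<omega>
      have "sgn (Z (\<tau> i) \<omega>) * Z (\<tau> (Suc i)) \<omega> - sgn (Z (\<tau> i) \<omega>) * Z (\<tau> i) \<omega>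
          \<le> \<bar>Z (\<tau> (Suc i)) \<omega>\<bar> - \<bar>Z (\<tau> i) \<omega>\<bar>"
        by (auto simp: sgn_if)
      from mult_left_mono[OF this m0]
      show "H \<omega> * Z (\<tau> (Suc i)) \<omega> - H \<omega> * Z (\<tau> i) \<omega> \<le> d i \<omega>"
        by (simp add: d_def H_def algebra_simps)
    qed
    ultimately show "0 \<le> (\<integral>\<omega>. d i \<omega> \<partial>P)" by simp
  qed
  have "(\<integral>\<omega>. (m n \<omega>)\<^sup>2 \<partial>P) \<le> 4 * (\<Sum>i<n. \<integral>\<omega>. d i \<omega> \<partial>P) + (\<integral>\<omega>. (m n \<omega>)\<^sup>2 \<partial>P)"
    using d by (auto intro: sum_nonneg)
  also have "\<dots> = (\<integral>\<omega>. 4 * (\<Sum>i<n. d i \<omega>) + (m n \<omega>)\<^sup>2 \<partial>P)"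
  proof -
    have "integrable P (\<lambda>\<omega>. 4 * (\<Sum>i<n. d i \<omega>))"
      using d by (intro integrable_mult_right Bochner_Integration.integrable_sum) simp
    moreover have "(\<integral>\<omega>. (\<Sum>i<n. d i \<omega>) \<partial>P) = (\<Sum>i<n. \<integral>\<omega>. d i \<omega> \<partial>P)"
      using d by (intro Bochner_Integration.integral_sum) simp
    ultimately show ?thesis using msq[of n] by simp
  qed
  also have "\<dots> \<le> (\<integral>\<omega>. 4 * (Z (\<tau> n) \<omega>)\<^sup>2 \<partial>P)"
  proof (rule integral_mono)
    show "integrable P (\<lambda>\<omega>. 4 * (\<Sum>i<n. d i \<omega>) + (m n \<omega>)\<^sup>2)"
      using d msq[of n]
      by (intro Bochner_Integration.integrable_add integrable_mult_right
          Bochner_Integration.integrable_sum) auto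
    show "integrable P (\<lambda>\<omega>. 4 * (Z (\<tau> n) \<omega>)\<^sup>2)" using D(3)[of n] by simp
    fix \<omega>
    show "4 * (\<Sum>i<n. d i \<omega>) + (m n \<omega>)\<^sup>2 \<le> 4 * (Z (\<tau> n) \<omega>)\<^sup>2"
      using doob_pathwise[of "\<lambda>i. \<bar>Z (\<tau> i) \<omega>\<bar>" n] by (simp add: d_def m_def)
  qed
  finally show "(\<integral>\<omega>. (m n \<omega>)\<^sup>2 \<partial>P) \<le> 4 * (\<integral>\<omega>. (Z (\<tau> n) \<omega>)\<^sup>2 \<partial>P)" by simp
qed

lemma sup_sq_measurable:
  assumes T: "0 < T" and Z: "Z \<in> sq_martingales P F {0..T}"
  shows "(\<lambda>\<omega>. SUP t\<in>{0..T}. ennreal ((Z t \<omega>)\<^sup>2)) \<in> borel_measurable P"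
proof -
  have "(\<lambda>\<omega>. SUP n. ennreal ((runmax (\<lambda>k. \<bar>Z (dyadic T n k) \<omega>\<bar>) (2 ^ n))\<^sup>2)) \<in> borel_measurable P"
  proof (intro borel_measurable_SUP countableI_type measurable_compose[OF _ measurable_ennreal]
      borel_measurable_power runmax_measurable borel_measurable_abs)
    fix n k :: nat assume "k \<le> 2 ^ n"
    then have "dyadic T n k \<in> {0..T}" using T by (intro dyadic_mem) auto
    then show "Z (dyadic T n k) \<in> borel_measurable P"
      using sq_martingaleD(2)[OF Z] by auto
  qed
  then show ?thesis
    using sq_martingaleD(6)[OF Z, of 0] T by (subst measurable_cong[OF cadlag_SUP_sq_eq]) auto
qed

text \<open>The last grid point is always \<open>T\<close>, so the discrete bound does not depend on
  \<open>n\<close>; the grids are nested, so monotone convergence reaches the supremum.\<close>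

lemma doob_L2:
  assumes T: "0 < T" and Z: "Z \<in> sq_martingales P F {0..T}"
  shows "M2_norm_sq P T Z \<le> ennreal (4 * (\<integral>\<omega>. (Z T \<omega>)\<^sup>2 \<partial>P))"
proof -
  define m where "m = (\<lambda>n \<omega>. runmax (\<lambda>k. \<bar>Z (dyadic T n k) \<omega>\<bar>) (2 ^ n))"
  have mem: "dyadic T n k \<in> {0..T}" if "k \<le> 2 ^ n" for n k
    using T that by (intro dyadic_mem) auto
  have m0: "0 \<le> m n \<omega>" for n \<omega>
    using runmax_ge[of 0 "2 ^ n" "\<lambda>k. \<bar>Z (dyadic T n k) \<omega>\<bar>"] by (auto simp: m_def intro: order_trans)
  have inc: "m n \<omega> \<le> m (Suc n) \<omega>" for n \<omega>
    unfolding m_def runmax_le_iff dyadic_refine[of T n]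
  proof (intro allI impI)
    fix i :: nat assume "i \<le> 2 ^ n"
    then show "\<bar>Z (dyadic T (Suc n) (2 * i)) \<omega>\<bar> \<le> runmax (\<lambda>k. \<bar>Z (dyadic T (Suc n) k) \<omega>\<bar>) (2 ^ Suc n)"
      by (intro runmax_ge[of "2 * i" "2 ^ Suc n" "\<lambda>k. \<bar>Z (dyadic T (Suc n) k) \<omega>\<bar>"]) simp
  qed
  have D: "integrable P (\<lambda>\<omega>. (m n \<omega>)\<^sup>2)" "(\<integral>\<omega>. (m n \<omega>)\<^sup>2 \<partial>P) \<le> 4 * (\<integral>\<omega>. (Z T \<omega>)\<^sup>2 \<partial>P)" for n
    using doob_discrete[OF Z, of "2 ^ n" "dyadic T n"] mem T dyadic_mono[of T]
    unfolding m_def by (auto simp: dyadic_def)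
  have "M2_norm_sq P T Z = (\<integral>\<^sup>+\<omega>. (SUP n. ennreal ((m n \<omega>)\<^sup>2)) \<partial>P)"
    unfolding M2_norm_sq_def m_def
    using sq_martingaleD(6)[OF Z, of 0] T by (intro nn_integral_cong cadlag_SUP_sq_eq) auto
  also have "\<dots> = (SUP n. \<integral>\<^sup>+\<omega>. ennreal ((m n \<omega>)\<^sup>2) \<partial>P)"
  proof (rule nn_integral_monotone_convergence_SUP)
    show "incseq (\<lambda>n \<omega>. ennreal ((m n \<omega>)\<^sup>2))"
      using inc m0 by (intro incseq_SucI le_funI ennreal_leI power_mono)
    show "(\<lambda>\<omega>. ennreal ((m n \<omega>)\<^sup>2)) \<in> borel_measurable P" for n
      using D(1)[of n] by simp
  qed
  also have "\<dots> \<le> ennreal (4 * (\<integral>\<omega>. (Z T \<omega>)\<^sup>2 \<partial>P))"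
    using D by (intro SUP_least) (simp add: nn_integral_eq_integral ennreal_leI)
  finally show ?thesis .
qed

text \<open>Doob's inequality propagates closeness at the terminal time to the supremum over
  \<open>[0,T]\<close>, and a summable weighted series makes it pathwise.\<close>

lemma AE_uniform_increments:
  assumes T: "0 < T" and Z: "\<And>k. Z k \<in> sq_martingales P F {0..T}"
    and W: "W \<in> borel_measurable P" "integrable P (\<lambda>\<omega>. (W \<omega>)\<^sup>2)"
    and close: "\<And>k. (\<integral>\<omega>. (Z k T \<omega> - W \<omega>)\<^sup>2 \<partial>P) \<le> (1/8) ^ k"
  shows "AE \<omega> in P. \<exists>C. \<forall>k. \<forall>t\<in>{0..T}. \<bar>Z (Suc k) t \<omega> - Z k t \<omega>\<bar> \<le> C * (1/2) ^ k"
proof -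
  have TT: "T \<in> {0..T}" "0 \<le> T" using T by auto
  note D = sq_martingaleD[OF Z TT]
  have sq: "integrable P (\<lambda>\<omega>. (Z k T \<omega> - W \<omega>)\<^sup>2)" for k
    by (rule integrable_square_diff[OF D(2) W(1) D(3) W(2)])
  define V where "V = (\<lambda>k \<omega>. SUP t\<in>{0..T}. ennreal ((Z (Suc k) t \<omega> - Z k t \<omega>)\<^sup>2))"
  have dm: "(\<lambda>t \<omega>. Z (Suc k) t \<omega> - Z k t \<omega>) \<in> sq_martingales P F {0..T}" for k
    using sq_martingale_lin[OF _ Z[of "Suc k"] Z[of k], of 1 "-1"] by simp
  have Vm: "V k \<in> borel_measurable P" for k
    unfolding V_def by (rule sup_sq_measurable[OF T dm])
  \<comment> \<open>The constant 16 is Doob's 4 times the 4 that bounds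
    \<open>2 * (1/8) ^ Suc k + 2 * (1/8) ^ k\<close> in units of \<open>(1/8) ^ k\<close>.\<close>
  have V: "(\<integral>\<^sup>+\<omega>. V k \<omega> \<partial>P) \<le> ennreal (16 * (1/8) ^ k)" for k
  proof -
    have "(\<integral>\<omega>. (Z (Suc k) T \<omega> - Z k T \<omega>)\<^sup>2 \<partial>P)
        \<le> (\<integral>\<omega>. 2 * (Z (Suc k) T \<omega> - W \<omega>)\<^sup>2 + 2 * (Z k T \<omega> - W \<omega>)\<^sup>2 \<partial>P)"
    proof (rule integral_mono)
      show "integrable P (\<lambda>\<omega>. (Z (Suc k) T \<omega> - Z k T \<omega>)\<^sup>2)"
        by (rule integrable_square_diff[OF D(2) D(2) D(3) D(3)])
      show "integrable P (\<lambda>\<omega>. 2 * (Z (Suc k) T \<omega> - W \<omega>)\<^sup>2 + 2 * (Z k T \<omega> - W \<omega>)\<^sup>2)"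
        using sq by simp
      fix \<omega>
      show "(Z (Suc k) T \<omega> - Z k T \<omega>)\<^sup>2 \<le> 2 * (Z (Suc k) T \<omega> - W \<omega>)\<^sup>2 + 2 * (Z k T \<omega> - W \<omega>)\<^sup>2"
        using sq_diff_le[of "Z (Suc k) T \<omega>" "Z k T \<omega>" "W \<omega>"] by (simp add: power2_commute)
    qed
    also have "\<dots> = 2 * (\<integral>\<omega>. (Z (Suc k) T \<omega> - W \<omega>)\<^sup>2 \<partial>P) + 2 * (\<integral>\<omega>. (Z k T \<omega> - W \<omega>)\<^sup>2 \<partial>P)"
      using sq by simp
    also have "\<dots> \<le> 2 * (1/8) ^ Suc k + 2 * (1/8) ^ k"
      using close[of "Suc k"] close[of k] by simp
    also have "\<dots> \<le> 4 * (1/8) ^ k" by simp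
    finally have "ennreal (4 * (\<integral>\<omega>. (Z (Suc k) T \<omega> - Z k T \<omega>)\<^sup>2 \<partial>P)) \<le> ennreal (16 * (1/8) ^ k)"
      by (intro ennreal_leI) simp
    then show ?thesis
      using doob_L2[OF T dm[of k]] unfolding M2_norm_sq_def V_def by (rule order_trans[rotated])
  qed
  \<comment> \<open>The weight \<open>4 ^ k\<close> leaves expectations of order
    \<open>(1/2) ^ k\<close>. Where the series has a finite sum \<open>c\<close>, each term is at
    most \<open>c\<close>, and a square root turns \<open>4 ^ k\<close> into the rate
    \<open>(1/2) ^ k\<close>.\<close>
  have "(\<integral>\<^sup>+\<omega>. (\<Sum>k. ennreal (4 ^ k) * V k \<omega>) \<partial>P) = (\<Sum>k. \<integral>\<^sup>+\<omega>. ennreal (4 ^ k) * V k \<omega> \<partial>P)"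
    using Vm by (intro nn_integral_suminf) simp
  also have "\<dots> \<le> (\<Sum>k. ennreal (16 * (1/2) ^ k))"
  proof (intro suminf_le summableI)
    fix k
    have "(\<integral>\<^sup>+\<omega>. ennreal (4 ^ k) * V k \<omega> \<partial>P) = ennreal (4 ^ k) * (\<integral>\<^sup>+\<omega>. V k \<omega> \<partial>P)"
      using Vm by (rule nn_integral_cmult)
    also have "\<dots> \<le> ennreal (4 ^ k) * ennreal (16 * (1/8) ^ k)"
      by (intro mult_left_mono V) simp
    also have "\<dots> = ennreal (16 * (1/2) ^ k)"
      by (simp add: ennreal_mult[symmetric] power_mult_distrib[symmetric] mult.left_commute)
    finally show "(\<integral>\<^sup>+\<omega>. ennreal (4 ^ k) * V k \<omega> \<partial>P) \<le> ennreal (16 * (1/2) ^ k)" .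
  qed
  also have "\<dots> = ennreal (\<Sum>k. 16 * (1/2) ^ k)"
    by (intro suminf_ennreal2 summable_mult summable_geometric) auto
  finally have "(\<integral>\<^sup>+\<omega>. (\<Sum>k. ennreal (4 ^ k) * V k \<omega>) \<partial>P) \<noteq> \<infinity>"
    by (auto simp: top_unique)
  then have "AE \<omega> in P. (\<Sum>k. ennreal (4 ^ k) * V k \<omega>) \<noteq> \<infinity>"
    using Vm by (intro nn_integral_PInf_AE) auto
  then show ?thesis
  proof eventually_elim
    fix \<omega> assume "(\<Sum>k. ennreal (4 ^ k) * V k \<omega>) \<noteq> \<infinity>"
    then obtain c where c: "0 \<le> c" "(\<Sum>k. ennreal (4 ^ k) * V k \<omega>) = ennreal c"
      by (cases "\<Sum>k. ennreal (4 ^ k) * V k \<omega>") auto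
    have "\<bar>Z (Suc k) t \<omega> - Z k t \<omega>\<bar> \<le> sqrt c * (1/2) ^ k" if t: "t \<in> {0..T}" for k t
    proof -
      have "ennreal (4 ^ k * (Z (Suc k) t \<omega> - Z k t \<omega>)\<^sup>2) \<le> ennreal (4 ^ k) * V k \<omega>"
        unfolding V_def using t by (subst ennreal_mult) (auto intro!: mult_left_mono SUP_upper)
      also have "\<dots> \<le> (\<Sum>k. ennreal (4 ^ k) * V k \<omega>)"
        using sum_le_suminf[of "\<lambda>k. ennreal (4 ^ k) * V k \<omega>" "{k}"] by (simp add: summableI)
      finally have "4 ^ k * (Z (Suc k) t \<omega> - Z k t \<omega>)\<^sup>2 \<le> c"
        using c by simp
      then have "sqrt (4 ^ k * (Z (Suc k) t \<omega> - Z k t \<omega>)\<^sup>2) \<le> sqrt c" by simp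
      moreover have "sqrt (4 ^ k) = 2 ^ k"
        by (simp add: real_sqrt_power)
      ultimately have "2 ^ k * \<bar>Z (Suc k) t \<omega> - Z k t \<omega>\<bar> \<le> sqrt c"
        by (simp add: real_sqrt_mult)
      then show ?thesis by (simp add: power_divide field_simps)
    qed
    then show "\<exists>C. \<forall>k. \<forall>t\<in>{0..T}. \<bar>Z (Suc k) t \<omega> - Z k t \<omega>\<bar> \<le> C * (1/2) ^ k" by blast
  qed
qed

text \<open>\<open>W\<close> prescribes the process only up to null sets at each time. Closeness at
  \<open>T\<close> gives uniformly convergent paths; closeness at each \<open>t\<close> identifies
  their limit with \<open>W t\<close>.\<close>

lemma sq_martingale_limit:
  assumes T: "0 < T" and Z: "\<And>k. Z k \<in> sq_martingales P F {0..T}"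
    and W: "\<And>t. t \<in> {0..T} \<Longrightarrow> W t \<in> borel_measurable P"
      "\<And>t. t \<in> {0..T} \<Longrightarrow> integrable P (\<lambda>\<omega>. (W t \<omega>)\<^sup>2)"
    and close: "\<And>k t. t \<in> {0..T} \<Longrightarrow> (\<integral>\<omega>. (Z k t \<omega> - W t \<omega>)\<^sup>2 \<partial>P) \<le> (1/8) ^ k"
  shows "\<exists>J\<in>sq_martingales P F {0..T}. \<forall>t\<in>{0..T}. AE \<omega> in P. J t \<omega> = W t \<omega>"
proof -
  have TT: "T \<in> {0..T}" using T by auto
  have D: "Z k t \<in> borel_measurable (F t)" "Z k t \<in> borel_measurable P" "integrable P (\<lambda>\<omega>. (Z k t \<omega>)\<^sup>2)"
    if "t \<in> {0..T}" for k t
    using sq_martingaleD[OF Z that] that by auto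
  have sq: "integrable P (\<lambda>\<omega>. (Z k t \<omega> - W t \<omega>)\<^sup>2)" if "t \<in> {0..T}" for k t
    by (rule integrable_square_diff[OF D(2) W(1) D(3) W(2), OF that that that that])
  have lim0: "(\<lambda>k. \<integral>\<omega>. (Z k t \<omega> - W t \<omega>)\<^sup>2 \<partial>P) \<longlonglongrightarrow> 0" if "t \<in> {0..T}" for t
    by (rule tendsto_sandwich[OF _ _ tendsto_const LIMSEQ_power_zero[of "1/8"]])
       (use close[OF that] in auto)
  obtain N where N: "N \<in> null_sets P" and unif: "\<And>\<omega>. \<omega> \<in> space P - N \<Longrightarrow>
      \<exists>C. \<forall>k. \<forall>t\<in>{0..T}. \<bar>Z (Suc k) t \<omega> - Z k t \<omega>\<bar> \<le> C * (1/2) ^ k"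
    using AE_uniform_increments[OF T Z W(1)[OF TT] W(2)[OF TT] close[OF TT]]
    by (auto elim!: AE_E3)
  \<comment> \<open>On the exceptional set the path is constant, hence cadlag; elsewhere it is the
    uniform limit.\<close>
  define J where "J = (\<lambda>t \<omega>. if \<omega> \<in> N then 0 else lim (\<lambda>k. Z k t \<omega>))"
  have ul: "uniform_limit {0..T} (\<lambda>k t. Z k t \<omega>) (\<lambda>t. J t \<omega>) sequentially" if \<omega>: "\<omega> \<in> space P - N" for \<omega>
  proof -
    obtain C where "\<And>k t. t \<in> {0..T} \<Longrightarrow> \<bar>Z (Suc k) t \<omega> - Z k t \<omega>\<bar> \<le> C * (1/2) ^ k"
      using unif[OF \<omega>] by blast
    then show ?thesis
      using uniform_limit_of_increments[of "{0..T}" "\<lambda>k t. Z k t \<omega>" C] \<omega>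
      by (simp add: J_def)
  qed
  have JW: "AE \<omega> in P. J t \<omega> = W t \<omega>" if t: "t \<in> {0..T}" for t
  proof (rule AE_eq_of_L2_limit[where f="\<lambda>k. Z k t"])
    show "AE \<omega> in P. (\<lambda>k. Z k t \<omega>) \<longlonglongrightarrow> J t \<omega>"
      using AE_not_in[OF N] by (rule AE_mp) (use tendsto_uniform_limitI[OF ul t] in auto)
  qed (use D W sq lim0 t in auto)
  have JF: "J t \<in> borel_measurable (F t)" if t: "t \<in> {0..T}" for t
  proof -
    have "N \<in> sets (F t)" using t null_in_F[OF _ N] by auto
    moreover have "(\<lambda>\<omega>. lim (\<lambda>k. Z k t \<omega>)) \<in> borel_measurable (F t)"
      using D(1)[OF t] by (intro borel_measurable_lim_metric)
    ultimately show ?thesis unfolding J_def by (intro measurable_If_set) auto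
  qed
  have JP: "J t \<in> borel_measurable P" if t: "t \<in> {0..T}" for t
    using measurable_F_P[OF _ JF[OF t]] t by auto
  have "J \<in> sq_martingales P F {0..T}"
  proof (rule sq_martingaleI)
    fix t assume t: "t \<in> {0..T}"
    show "J t \<in> borel_measurable (F t)" by (rule JF[OF t])
    show Jsq: "integrable P (\<lambda>\<omega>. (J t \<omega>)\<^sup>2)"
      by (subst integrable_cong_AE[where g="\<lambda>\<omega>. (W t \<omega>)\<^sup>2"]) (use JP[OF t] W[OF t] JW[OF t] in auto)
  next
    \<comment> \<open>Integrals over events converge because the L1 distance is at most the L2
      distance; this transports zero mean and the martingale test to the limit.\<close>
    have L: "(\<lambda>k. \<integral>\<omega>. indicator G \<omega> * Z k t \<omega> \<partial>P) \<longlonglongrightarrow> (\<integral>\<omega>. indicator G \<omega> * J t \<omega> \<partial>P)"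
      if t: "t \<in> {0..T}" and G: "G \<in> sets P" for t G
    proof -
      have "(\<lambda>k. (\<integral>\<omega>. indicator G \<omega> * Z k t \<omega> \<partial>P) - (\<integral>\<omega>. indicator G \<omega> * W t \<omega> \<partial>P)) \<longlonglongrightarrow> 0"
      proof (rule Lim_null_comparison)
        show "(\<lambda>k. sqrt (\<integral>\<omega>. (Z k t \<omega> - W t \<omega>)\<^sup>2 \<partial>P)) \<longlonglongrightarrow> 0"
          using tendsto_real_sqrt[OF lim0[OF t]] by simp
        have "norm ((\<integral>\<omega>. indicator G \<omega> * Z k t \<omega> \<partial>P) - (\<integral>\<omega>. indicator G \<omega> * W t \<omega> \<partial>P))
            \<le> sqrt (\<integral>\<omega>. (Z k t \<omega> - W t \<omega>)\<^sup>2 \<partial>P)" for k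
        proof -
          have i: "integrable P (Z k t)" "integrable P (W t)"
            by (intro integrable_of_square[OF D(2)[OF t] D(3)[OF t]] integrable_of_square[OF W(1)[OF t] W(2)[OF t]])+
          then have iG: "integrable P (\<lambda>\<omega>. indicator G \<omega> * Z k t \<omega>)" "integrable P (\<lambda>\<omega>. indicator G \<omega> * W t \<omega>)"
            using integrable_mult_indicator[OF G i(1)] integrable_mult_indicator[OF G i(2)] by simp_all
          have "norm ((\<integral>\<omega>. indicator G \<omega> * Z k t \<omega> \<partial>P) - (\<integral>\<omega>. indicator G \<omega> * W t \<omega> \<partial>P))
              = norm (\<integral>\<omega>. indicator G \<omega> * Z k t \<omega> - indicator G \<omega> * W t \<omega> \<partial>P)"
            using iG by simp
          also have "\<dots> \<le> (\<integral>\<omega>. norm (indicator G \<omega> * Z k t \<omega> - indicator G \<omega> * W t \<omega>) \<partial>P)"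
            by (rule integral_norm_bound)
          also have "\<dots> \<le> (\<integral>\<omega>. \<bar>Z k t \<omega> - W t \<omega>\<bar> \<partial>P)"
            using iG i by (intro integral_mono) (auto simp: indicator_def)
          also have "\<dots> \<le> sqrt (\<integral>\<omega>. (Z k t \<omega> - W t \<omega>)\<^sup>2 \<partial>P)"
          proof (rule real_le_rsqrt)
            \<comment> \<open>Non-negativity of the variance plays the part of Jensen's
              inequality.\<close>
            have "(\<integral>\<omega>. \<bar>Z k t \<omega> - W t \<omega>\<bar> \<partial>P)\<^sup>2 \<le> (\<integral>\<omega>. \<bar>Z k t \<omega> - W t \<omega>\<bar>\<^sup>2 \<partial>P)"
              using i sq[OF t, of k] variance_positive[of "\<lambda>\<omega>. \<bar>Z k t \<omega> - W t \<omega>\<bar>"]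
              by (subst (asm) variance_eq) auto
            then show "(\<integral>\<omega>. \<bar>Z k t \<omega> - W t \<omega>\<bar> \<partial>P)\<^sup>2 \<le> (\<integral>\<omega>. (Z k t \<omega> - W t \<omega>)\<^sup>2 \<partial>P)" by simp
          qed
          finally show ?thesis .
        qed
        then show "\<forall>\<^sub>F k in sequentially. norm ((\<integral>\<omega>. indicator G \<omega> * Z k t \<omega> \<partial>P) - (\<integral>\<omega>. indicator G \<omega> * W t \<omega> \<partial>P))
            \<le> sqrt (\<integral>\<omega>. (Z k t \<omega> - W t \<omega>)\<^sup>2 \<partial>P)" by simp
      qed
      moreover have "(\<integral>\<omega>. indicator G \<omega> * W t \<omega> \<partial>P) = (\<integral>\<omega>. indicator G \<omega> * J t \<omega> \<partial>P)"
        using JW[OF t] JP[OF t] W[OF t] G by (intro integral_cong_AE) auto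
      ultimately show ?thesis by (simp add: LIM_zero_iff)
    qed
    {
      fix t assume t: "t \<in> {0..T}"
      have "(\<lambda>k. \<integral>\<omega>. indicator (space P) \<omega> * Z k t \<omega> \<partial>P) = (\<lambda>k. \<integral>\<omega>. Z k t \<omega> \<partial>P)"
        by (intro ext Bochner_Integration.integral_cong) auto
      also have "\<dots> = (\<lambda>k. 0)" using sq_martingaleD(5)[OF Z t] t by auto
      finally have "(\<integral>\<omega>. indicator (space P) \<omega> * J t \<omega> \<partial>P) = 0"
        using L[OF t sets.top] by (metis LIMSEQ_unique tendsto_const)
      moreover have "(\<integral>\<omega>. indicator (space P) \<omega> * J t \<omega> \<partial>P) = (\<integral>\<omega>. J t \<omega> \<partial>P)"
        by (intro Bochner_Integration.integral_cong) auto
      ultimately show "(\<integral>\<omega>. J t \<omega> \<partial>P) = 0" by simp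
    }
    fix s t G assume st: "s \<in> {0..T}" "t \<in> {0..T}" "s \<le> t" and G: "G \<in> sets (F s)"
    have s0: "0 \<le> s" using st by auto
    have GP: "G \<in> sets P" using sets_F_P[OF s0 G] .
    have "(\<integral>\<omega>. indicator G \<omega> * Z k t \<omega> \<partial>P) = (\<integral>\<omega>. indicator G \<omega> * Z k s \<omega> \<partial>P)" for k
      using sq_martingale_mult(2)[OF Z st(1) s0 st(2,3) integrable_indicator_sq[OF s0 G]] .
    then show "(\<integral>\<omega>. indicator G \<omega> * J t \<omega> \<partial>P) = (\<integral>\<omega>. indicator G \<omega> * J s \<omega> \<partial>P)"
      using L[OF st(1) GP] L[OF st(2) GP] by (auto intro: LIMSEQ_unique)
  next
    fix \<omega> assume \<omega>: "\<omega> \<in> space P"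
    show "cadlag_on {0..T} (\<lambda>t. J t \<omega>)"
    proof (cases "\<omega> \<in> N")
      case True
      then show ?thesis by (simp add: J_def cadlag_on_const)
    next
      case False
      then show ?thesis
        by (intro cadlag_on_uniform_limit[OF _ ul] sq_martingaleD(6)[OF Z TT]) (use T \<omega> in simp_all)
    qed
  qed auto
  then show ?thesis using JW by blast
qed

section \<open>Predictable rectangles and predictable versions\<close>

lemma predictable_rectangle_measurable:
  assumes G: "space G = space P" and f: "f \<in> borel_measurable G"
    and K: "K \<subseteq> {0..T}" "\<And>E. E \<in> sets G \<Longrightarrow> K \<times> E \<in> sets (predictable_sigma P F T)"
  shows "(\<lambda>(t, \<omega>). indicator K t * f \<omega> :: real) \<in> borel_measurable (predictable_sigma P F T)"
proof (rule borel_measurableI)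
  fix B :: "real set" assume "open B"
  let ?Q = "predictable_sigma P F T"
  have sp: "space ?Q = {0..T} \<times> space P" by (simp add: predictable_sigma_def space_measure_of_conv)
  have KB: "K \<times> (f -` B \<inter> space G) \<in> sets ?Q"
    using \<open>open B\<close> by (intro K(2) measurable_sets[OF f]) auto
  have KO: "{0..T} \<times> space P - K \<times> space P \<in> sets ?Q"
    using sets.compl_sets[OF K(2)[OF sets.top]] by (simp add: sp G)
  \<comment> \<open>Off \<open>K\<close> the function vanishes, so the complement joins the preimage
    exactly when \<open>B\<close> contains 0.\<close>
  have "(\<lambda>(t, \<omega>). indicator K t * f \<omega> :: real) -` B \<inter> space ?Q =
      K \<times> (f -` B \<inter> space G) \<union> (if 0 \<in> B then {0..T} \<times> space P - K \<times> space P else {})"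
    using K(1) by (auto simp: sp G split: if_splits split_indicator split_indicator_asm)
  then show "(\<lambda>(t, \<omega>). indicator K t * f \<omega> :: real) -` B \<inter> space ?Q \<in> sets ?Q"
    using KB KO by auto
qed

lemma predictable_generator:
  assumes "0 < T"
  shows "{{0} \<times> E |E. E \<in> sets (F 0)} \<union>
      {{s<..t} \<times> E |s t E. 0 \<le> s \<and> s < t \<and> t \<le> T \<and> E \<in> sets (F s)} \<subseteq> Pow ({0..T} \<times> space P)"
proof -
  have "x \<in> space P" if "E \<in> sets (F s)" "0 \<le> s" "x \<in> E" for x E s
    using sets.sets_into_space[OF that(1)] space_F[OF that(2)] that(3) by auto
  from this this[of _ 0] show ?thesis using assms by auto
qed

lemma predictable_sets:
  assumes "0 < T"
  shows "E \<in> sets (F 0) \<Longrightarrow> {0} \<times> E \<in> sets (predictable_sigma P F T)"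
    and "0 \<le> s \<Longrightarrow> s < t \<Longrightarrow> t \<le> T \<Longrightarrow> E \<in> sets (F s) \<Longrightarrow> {s<..t} \<times> E \<in> sets (predictable_sigma P F T)"
  unfolding predictable_sigma_def sets_measure_of[OF predictable_generator[OF assms]]
  by (auto intro!: sigma_sets.Basic)

text \<open>Approximating \<open>t\<close> from the left by dyadic points gives predictable processes converging
  to the left limits; mean square continuity identifies these with the process itself.\<close>

lemma predictable_version:
  assumes T: "0 < T" and J: "J \<in> sq_martingales P F {0..T}" and cont: "mean_square_continuous P T J"
  shows "has_predictable_version P F T J"
proof -
  \<comment> \<open>The value used on each grid interval is that at its left end, where it is
    already known; hence each summand is predictable.\<close>
  define Y where "Y = (\<lambda>n t \<omega>. indicator {0} t * J 0 \<omega> +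
     (\<Sum>k<2 ^ n. indicator {dyadic T n k<..dyadic T n (Suc k)} t * J (dyadic T n k) \<omega>))"
  have D: "J t \<in> borel_measurable (F t)" "J t \<in> borel_measurable P" "integrable P (\<lambda>\<omega>. (J t \<omega>)\<^sup>2)"
    if "t \<in> {0..T}" for t
    using sq_martingaleD[OF J that] that by auto
  have mem: "dyadic T n k \<in> {0..T}" if "k \<le> 2 ^ n" for n k
    using T that by (intro dyadic_mem) auto
  have Ym: "(\<lambda>z. Y n (fst z) (snd z)) \<in> borel_measurable (predictable_sigma P F T)" for n
  proof -
    have "(\<lambda>(t, \<omega>). indicator {0} t * J 0 \<omega>) \<in> borel_measurable (predictable_sigma P F T)"
      using T by (intro predictable_rectangle_measurable[OF space_F[of 0] D(1)] predictable_sets) auto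
    moreover have "(\<lambda>(t, \<omega>). indicator {dyadic T n k<..dyadic T n (Suc k)} t * J (dyadic T n k) \<omega>)
        \<in> borel_measurable (predictable_sigma P F T)" if k: "k < 2 ^ n" for k
    proof (rule predictable_rectangle_measurable)
      have m: "dyadic T n k \<in> {0..T}" "dyadic T n (Suc k) \<in> {0..T}" using mem[of k n] mem[of "Suc k" n] k by simp_all
      show "space (F (dyadic T n k)) = space P" "J (dyadic T n k) \<in> borel_measurable (F (dyadic T n k))"
        using m D(1) space_F by auto
      show "{dyadic T n k<..dyadic T n (Suc k)} \<subseteq> {0..T}" using m by auto
      fix E assume "E \<in> sets (F (dyadic T n k))"
      moreover have "dyadic T n k < dyadic T n (Suc k)"
        using T by (simp add: dyadic_def divide_strict_right_mono)
      ultimately show "{dyadic T n k<..dyadic T n (Suc k)} \<times> E \<in> sets (predictable_sigma P F T)"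
        using m by (intro predictable_sets[OF T]) auto
    qed
    ultimately show ?thesis
      unfolding Y_def case_prod_unfold by (intro borel_measurable_add borel_measurable_sum) auto
  qed
  define L where "L = (\<lambda>t \<omega>. lim (\<lambda>n. Y n t \<omega>))"
  have "(\<lambda>(t, \<omega>). L t \<omega>) \<in> borel_measurable (predictable_sigma P F T)"
    unfolding L_def case_prod_beta by (rule borel_measurable_lim_metric[OF Ym])
  moreover have "AE \<omega> in P. L t \<omega> = J t \<omega>" if t: "t \<in> {0..T}" for t
  proof (cases "t = 0")
    case True
    have "Y n 0 \<omega> = J 0 \<omega>" for n \<omega>
      using mem T unfolding Y_def by (auto intro!: sum.neutral simp: indicator_def not_less[symmetric] dyadic_def)
    then show ?thesis by (simp add: L_def True limI[OF tendsto_const])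
  next
    case False
    with t have t0: "0 < t" by simp
    \<comment> \<open>Grid intervals are open on the left, so \<open>t\<close> lies in the one
      ending at the rounded up point. Subtracting 1 gives its left end, strictly below
      \<open>t\<close> even when \<open>t\<close> is a grid point.\<close>
    define k where "k = (\<lambda>n. nat (\<lceil>t * 2 ^ n / T\<rceil> - 1))"
    define l where "l = (\<lambda>n. dyadic T n (k n))"
    note r = dyadic_right_approx[OF T t]
    have pos: "1 \<le> \<lceil>t * 2 ^ n / T\<rceil>" for n
      using t0 T by (simp add: one_le_ceiling)
    have Sk: "nat \<lceil>t * 2 ^ n / T\<rceil> = Suc (k n)" for n
      using pos[of n] by (simp add: k_def Suc_nat_eq_nat_zadd1)
    have k_less: "k n < 2 ^ n" for n using r(1)[of n] Sk[of n] by simp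
    have kr: "real (k n) = of_int \<lceil>t * 2 ^ n / T\<rceil> - 1" for n
      using pos[of n] by (simp add: k_def)
    have l_less: "l n < t" for n
    proof -
      have "real (k n) < t * 2 ^ n / T" unfolding kr by linarith
      then show ?thesis using T by (simp add: l_def dyadic_def field_simps)
    qed
    have l_mem: "l n \<in> {0..T}" for n unfolding l_def using k_less[of n] by (intro mem) simp
    have l_lim: "l \<longlonglongrightarrow> t"
    proof -
      have eq: "l = (\<lambda>n. dyadic T n (nat \<lceil>t * 2 ^ n / T\<rceil>) - T * (1/2) ^ n)"
        unfolding Sk l_def by (simp add: fun_eq_iff dyadic_def field_simps power_divide)
      have "(\<lambda>n. dyadic T n (nat \<lceil>t * 2 ^ n / T\<rceil>) - T * (1/2) ^ n) \<longlonglongrightarrow> t - T * 0"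
        using r(3) by (intro tendsto_intros LIMSEQ_power_zero) auto
      then show ?thesis unfolding eq by simp
    qed
    have YJ: "Y n t \<omega> = J (l n) \<omega>" for n \<omega>
    proof -
      have "t \<in> {dyadic T n j<..dyadic T n (Suc j)} \<longleftrightarrow> j = k n" for j
      proof -
        have "t \<in> {dyadic T n j<..dyadic T n (Suc j)} \<longleftrightarrow> real j < t * 2 ^ n / T \<and> t * 2 ^ n / T \<le> real j + 1"
          using T by (auto simp: dyadic_def field_simps)
        also have "\<dots> \<longleftrightarrow> \<lceil>t * 2 ^ n / T\<rceil> = int j + 1"
          by (auto simp: ceiling_eq_iff)
        also have "\<dots> \<longleftrightarrow> j = k n"
          using pos[of n] by (auto simp: k_def)
        finally show ?thesis .
      qed
      then have "Y n t \<omega> = (\<Sum>j<2 ^ n. if j = k n then J (dyadic T n j) \<omega> else 0)"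
        unfolding Y_def using t0 by (auto intro!: sum.cong simp: indicator_def)
      also have "\<dots> = J (l n) \<omega>" using k_less[of n] by (simp add: l_def)
      finally show ?thesis .
    qed
    show ?thesis
    proof (rule AE_eq_of_L2_limit[where f="\<lambda>n. J (l n)"])
      show "J (l n) \<in> borel_measurable P" "J t \<in> borel_measurable P" for n
        using D l_mem t by auto
      show "integrable P (\<lambda>\<omega>. (J (l n) \<omega> - J t \<omega>)\<^sup>2)" for n
        by (rule integrable_square_diff[OF D(2) D(2) D(3) D(3), OF l_mem t l_mem t])
      have "filterlim l (at t within {0..T}) sequentially"
        using l_lim l_mem l_less by (auto simp: filterlim_at less_imp_neq)
      moreover have "((\<lambda>s. \<integral>\<omega>. (J s \<omega> - J t \<omega>)\<^sup>2 \<partial>P) \<longlongrightarrow> 0) (at t within {0..T})"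
        using cont t unfolding mean_square_continuous_def by blast
      ultimately show "(\<lambda>n. \<integral>\<omega>. (J (l n) \<omega> - J t \<omega>)\<^sup>2 \<partial>P) \<longlonglongrightarrow> 0"
        by (rule filterlim_compose[rotated])
      \<comment> \<open>Existence of left limits makes the \<open>lim\<close> defining
        \<open>L\<close> genuine; the L2 limit along \<open>l\<close> then identifies it with
        \<open>J t\<close>.\<close>
      show "AE \<omega> in P. (\<lambda>n. J (l n) \<omega>) \<longlonglongrightarrow> L t \<omega>"
      proof (rule AE_I2)
        fix \<omega> assume "\<omega> \<in> space P"
        then obtain c where "((\<lambda>t. J t \<omega>) \<longlongrightarrow> c) (at t within ({0..T} \<inter> {..<t}))"
          using sq_martingaleD(6)[OF J t] t unfolding cadlag_on_def by fastforce
        moreover have "filterlim l (at t within ({0..T} \<inter> {..<t})) sequentially"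
          using l_lim l_mem l_less by (auto simp: filterlim_at less_imp_neq)
        ultimately have "(\<lambda>n. J (l n) \<omega>) \<longlonglongrightarrow> c"
          by (rule filterlim_compose)
        then show "(\<lambda>n. J (l n) \<omega>) \<longlonglongrightarrow> L t \<omega>"
          unfolding L_def YJ by (simp add: limI)
      qed
    qed
  qed
  ultimately show ?thesis unfolding has_predictable_version_def by blast
qed

end

section \<open>The space of integrands\<close>

sublocale nuclear_cyl_mvm \<subseteq> filtered_prob P F
  by unfold_locales (rule filtration)

text \<open>\<open>Lambda_w\<close> without the finite norm: for a linear combination, measurability
  and the integral formula for the norm come before the norm is known to be finite.\<close>

definition measurable_integrands :: "'w measure \<Rightarrow> (real \<Rightarrow> 'w measure)
    \<Rightarrow> (real \<Rightarrow> 'u::topological_space \<Rightarrow> 'a::real_vector \<Rightarrow> 'a \<Rightarrow> real) \<Rightarrow> real \<Rightarrow> ('a, 'w, 'u) integrand set" where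
  "measurable_integrands P F q T = {X.
     (\<forall>r\<in>{0..T}. \<forall>\<omega>\<in>space P. \<forall>u. X r \<omega> u \<in> hcompletion (q r u)) \<and>
     (\<forall>\<phi>. (\<lambda>z. hform (q (fst (fst z)) (snd z)) (X (fst (fst z)) (snd (fst z)) (snd z)) (hembed \<phi>))
            \<in> borel_measurable (predictable_sigma P F T \<Otimes>\<^sub>M borel))}"

lemma Lambda_w_iff:
  "X \<in> Lambda_w P F \<mu> lam q T \<longleftrightarrow> X \<in> measurable_integrands P F q T \<and> w_norm_sq P \<mu> lam q T X < \<infinity>"
  unfolding Lambda_w_def measurable_integrands_def case_prod_unfold by blast

definition hnorm_sq_at :: "(real \<Rightarrow> 'u \<Rightarrow> 'a \<Rightarrow> 'a \<Rightarrow> real) \<Rightarrow> ('a, 'w, 'u) integrand \<Rightarrow> (real \<times> 'w) \<times> 'u \<Rightarrow> ennreal" where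
  "hnorm_sq_at q X z = ennreal ((hnorm (q (fst (fst z)) (snd z)) (X (fst (fst z)) (snd (fst z)) (snd z)))\<^sup>2)"

lemma hembed_zero: "hembed 0 = (\<lambda>_. 0)"
  by (simp add: hembed_def)

context nuclear_cyl_mvm
begin

lemma pos_form_q: "0 \<le> r \<Longrightarrow> pos_form (q r u)"
  using q_hilbertian[of r u] by unfold_locales (auto simp: cont_hilbertian_def)

lemma space_lam: "space lam = {0..}"
  using sets_eq_imp_space_eq[OF lam_sets] by (simp add: space_restrict_space)

lemma sets_lamI: "A \<in> sets borel \<Longrightarrow> A \<subseteq> {0..} \<Longrightarrow> A \<in> sets lam"
  by (auto simp: lam_sets sets_restrict_space)

lemma R_sets: "A \<in> R \<Longrightarrow> A \<in> sets borel"
  using ring_generates by (auto intro: sigma_sets.Basic)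

lemma space_predictable: "space (predictable_sigma P F T) = {0..T} \<times> space P"
  by (simp add: predictable_sigma_def space_measure_of_conv)

section \<open>Predictable functions under the product measure\<close>

lemma predictable_fst_borel:
  assumes T: "0 < T"
  shows "fst \<in> borel_measurable (predictable_sigma P F T)"
proof (rule borel_measurableI_le)
  fix a :: real
  have sp: "space P \<in> sets (F 0)" using space_F[of 0] sets.top[of "F 0"] by simp
  have "{w \<in> space (predictable_sigma P F T). fst w \<le> a} =
    (if a < 0 then {} else {0} \<times> space P \<union> (if a = 0 then {} else {0<..min a T} \<times> space P))"
    using T by (auto simp: space_predictable)
  also have "\<dots> \<in> sets (predictable_sigma P F T)"
    using predictable_sets(1)[OF T sp] predictable_sets(2)[OF T, of 0 "min a T" "space P"] sp T by auto
  finally show "{w \<in> space (predictable_sigma P F T). fst w \<le> a} \<in> sets (predictable_sigma P F T)" .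
qed

text \<open>Every predictable rectangle is measurable for the product of \<open>lam\<close> and
  \<open>P\<close>, so predictable functions can be integrated jointly over time and chance.\<close>

lemma predictable_subset_product:
  assumes T: "0 < T"
  shows "sets (predictable_sigma P F T) \<subseteq> sets (restrict_space (lam \<Otimes>\<^sub>M P) ({0..T} \<times> space P))"
proof -
  let ?G = "{{0} \<times> E |E. E \<in> sets (F 0)} \<union>
      {{s<..t} \<times> E |s t E. 0 \<le> s \<and> s < t \<and> t \<le> T \<and> E \<in> sets (F s)}"
  let ?N = "restrict_space (lam \<Otimes>\<^sub>M P) ({0..T} \<times> space P)"
  have spN: "space ?N = {0..T} \<times> space P"
    by (auto simp: space_restrict_space space_pair_measure space_lam)
  have rect: "C \<times> E \<in> sets (lam \<Otimes>\<^sub>M P)" if "C \<in> sets borel" "C \<subseteq> {0..}" "E \<in> sets (F s)" "0 \<le> s" for C E s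
    using that by (intro pair_measureI sets_lamI sets_F_P)
  have "?G \<subseteq> sets ?N"
  proof
    fix B assume B: "B \<in> ?G"
    then consider E where "B = {0} \<times> E" "E \<in> sets (F 0)"
      | s t E where "B = {s<..t} \<times> E" "0 \<le> s" "E \<in> sets (F s)"
      by blast
    then have "B \<in> sets (lam \<Otimes>\<^sub>M P)"
    proof cases
      case 1
      then show ?thesis using rect[of "{0}" _ 0] by simp
    next
      case (2 s t E)
      then have "{s<..t} \<subseteq> {0..}" by (auto intro: less_imp_le le_less_trans)
      then show ?thesis using 2 rect[of "{s<..t}" E s] by simp
    qed
    moreover have "B = ({0..T} \<times> space P) \<inter> B"
      using B predictable_generator[OF T] by blast
    ultimately show "B \<in> sets ?N" unfolding sets_restrict_space by blast
  qed
  then show ?thesis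
    unfolding predictable_sigma_def sets_measure_of[OF predictable_generator[OF T]]
    using sets.sigma_sets_subset[of ?G ?N] by (simp add: spN)
qed

abbreviation triple :: "((real \<times> 'w) \<times> 'u) measure" where
  "triple \<equiv> (lam \<Otimes>\<^sub>M P) \<Otimes>\<^sub>M \<mu>"

lemma space_mu: "space \<mu> = UNIV"
  using sets_eq_imp_space_eq[OF mu_sets] by simp

text \<open>Predictable measurability says nothing about \<open>f\<close> at times after
  \<open>T\<close>; multiplying by the indicator of \<open>{0<..t}\<close> removes that
  region.\<close>

lemma measurable_triple:
  assumes T: "0 < T"
    and f: "(f :: _ \<Rightarrow> ennreal) \<in> borel_measurable (predictable_sigma P F T \<Otimes>\<^sub>M borel)" and t: "t \<le> T"
  shows "(\<lambda>z. f z * indicator {0<..t} (fst (fst z))) \<in> borel_measurable triple"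
proof -
  let ?S = "({0..T} \<times> space P) \<times> (UNIV :: 'u set)"
  have S: "?S \<inter> space triple \<in> sets triple"
  proof -
    have "{0..T} \<in> sets lam" by (rule sets_lamI) auto
    then have "?S \<in> sets triple"
      using sets.top[of \<mu>] sets.top[of P] by (intro pair_measureI) (simp_all only: space_mu)
    then show ?thesis by auto
  qed
  have "(\<lambda>z. z) \<in> restrict_space triple ?S \<rightarrow>\<^sub>M predictable_sigma P F T \<Otimes>\<^sub>M borel"
  proof (rule measurable_pair)
    have "fst \<in> restrict_space triple ?S \<rightarrow>\<^sub>M restrict_space (lam \<Otimes>\<^sub>M P) ({0..T} \<times> space P)"
      by (intro measurable_restrict_space2 measurable_restrict_space1 measurable_fst)
        (auto simp: space_restrict_space)
    then show "fst \<circ> (\<lambda>z. z) \<in> restrict_space triple ?S \<rightarrow>\<^sub>M predictable_sigma P F T"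
      using predictable_subset_product[OF T]
      by (auto simp: comp_def measurable_def space_predictable space_restrict_space space_pair_measure space_lam)
    have "snd \<in> restrict_space triple ?S \<rightarrow>\<^sub>M borel"
      using measurable_restrict_space1[OF measurable_snd, of "lam \<Otimes>\<^sub>M P" \<mu> ?S]
      by (simp add: measurable_cong_sets[OF refl mu_sets])
    then show "snd \<circ> (\<lambda>z. z) \<in> restrict_space triple ?S \<rightarrow>\<^sub>M borel" by (simp add: comp_def)
  qed
  from measurable_compose[OF this f]
  have "(\<lambda>z. f z * indicator ?S z) \<in> borel_measurable triple"
    by (subst (asm) borel_measurable_restrict_space_iff_ennreal[OF S]) simp
  moreover have "(\<lambda>z. indicator {0<..t} (fst (fst z)) :: ennreal) \<in> borel_measurable triple"
  proof -
    have "{0<..t} \<in> sets lam" by (rule sets_lamI) auto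
    then show ?thesis by measurable
  qed
  ultimately have "(\<lambda>z. f z * indicator ?S z * indicator {0<..t} (fst (fst z))) \<in> borel_measurable triple"
    by (rule borel_measurable_times_ennreal)
  moreover have "f z * indicator ?S z * indicator {0<..t} (fst (fst z)) = f z * indicator {0<..t} (fst (fst z))"
    if "z \<in> space triple" for z
    using that t by (auto simp: space_pair_measure indicator_def)
  ultimately show ?thesis by (subst measurable_cong) auto
qed

lemma q_predictable_measurable:
  assumes T: "0 < T"
  shows "(\<lambda>z. q (fst (fst z)) (snd z) \<phi> \<psi>) \<in> borel_measurable (predictable_sigma P F T \<Otimes>\<^sub>M borel)"
proof -
  have "(\<lambda>z. fst (fst z)) \<in> predictable_sigma P F T \<Otimes>\<^sub>M (borel :: 'u measure) \<rightarrow>\<^sub>M restrict_space borel {0..}"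
    using measurable_compose[OF measurable_fst predictable_fst_borel[OF T]]
    by (intro measurable_restrict_space2) (auto simp: space_pair_measure space_predictable)
  then have "(\<lambda>z. (fst (fst z), snd z)) \<in> predictable_sigma P F T \<Otimes>\<^sub>M (borel :: 'u measure) \<rightarrow>\<^sub>M restrict_space borel {0..} \<Otimes>\<^sub>M borel"
    by (intro measurable_Pair measurable_snd)
  from measurable_compose[OF this q_measurable[of \<phi> \<psi>]] show ?thesis by simp
qed

text \<open>Membership gives only measurable pairings with fixed vectors. The countable set from
  \<open>separable\<close>, common to all \<open>r\<close> and \<open>u\<close>, turns the squared
  norm into a countable supremum of expressions in such pairings.\<close>

lemma hnorm_sq_measurable:
  assumes T: "0 < T" and X: "X \<in> measurable_integrands P F q T"
  shows "hnorm_sq_at q X \<in> borel_measurable (predictable_sigma P F T \<Otimes>\<^sub>M borel)"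
proof -
  let ?Q = "predictable_sigma P F T \<Otimes>\<^sub>M (borel :: 'u measure)"
  obtain D where D: "countable D" "\<And>r u. r \<in> {0..T} \<Longrightarrow> dense_in_hcompletion (q r u) D"
    using separable[OF T] by blast
  have "(\<lambda>z. SUP d\<in>D. ennreal (2 * hform (q (fst (fst z)) (snd z)) (X (fst (fst z)) (snd (fst z)) (snd z)) (hembed d)
      - q (fst (fst z)) (snd z) d d)) \<in> borel_measurable ?Q"
    using X q_predictable_measurable[OF T] unfolding measurable_integrands_def
    by (intro borel_measurable_SUP D(1) measurable_compose[OF _ measurable_ennreal]
        borel_measurable_diff borel_measurable_times borel_measurable_const) auto
  moreover have "hnorm_sq_at q X z = (SUP d\<in>D. ennreal (2 * hform (q (fst (fst z)) (snd z)) (X (fst (fst z)) (snd (fst z)) (snd z)) (hembed d)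
      - q (fst (fst z)) (snd z) d d))" if z: "z \<in> space ?Q" for z
  proof -
    have z': "fst (fst z) \<in> {0..T}" "snd (fst z) \<in> space P"
      using z by (auto simp: space_pair_measure space_predictable)
    interpret pos_form "q (fst (fst z)) (snd z)" using z' by (intro pos_form_q) auto
    show ?thesis
      unfolding hnorm_sq_at_def using X z' D(2)[of "fst (fst z)" "snd z"]
      by (intro hnorm_sq_eq_SUP) (auto simp: measurable_integrands_def)
  qed
  ultimately show ?thesis by (subst measurable_cong) auto
qed

text \<open>Tonelli's theorem. \<open>w_norm_sq\<close> integrates over \<open>u\<close>, then
  \<open>r\<close>, then \<open>\<omega>\<close>; as a single integral it admits pointwise estimates
  and dominated convergence.\<close>

lemma w_norm_sq_eq_triple:
  assumes T: "0 < T" and t: "t \<le> T" and X: "X \<in> measurable_integrands P F q T"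
  shows "w_norm_sq P \<mu> lam q t X = (\<integral>\<^sup>+z. hnorm_sq_at q X z * indicator {0<..t} (fst (fst z)) \<partial>triple)"
proof -
  interpret mu: sigma_finite_measure \<mu> by (rule mu_sigma_finite)
  interpret lam: sigma_finite_measure lam by (rule lam_sigma_finite)
  interpret pair_sigma_finite lam P ..
  let ?f = "\<lambda>z. hnorm_sq_at q X z * indicator {0<..t} (fst (fst z))"
  have m: "?f \<in> borel_measurable triple"
    by (rule measurable_triple[OF T hnorm_sq_measurable[OF T X] t])
  have "(\<integral>\<^sup>+z. ?f z \<partial>triple) = (\<integral>\<^sup>+x. \<integral>\<^sup>+u. ?f (x, u) \<partial>\<mu> \<partial>(lam \<Otimes>\<^sub>M P))"
    by (rule mu.nn_integral_fst[OF m, symmetric])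
  also have "\<dots> = (\<integral>\<^sup>+\<omega>. \<integral>\<^sup>+r. \<integral>\<^sup>+u. ?f ((r, \<omega>), u) \<partial>\<mu> \<partial>lam \<partial>P)"
    by (rule nn_integral_snd[symmetric]) (rule mu.borel_measurable_nn_integral_fst[OF m])
  also have "\<dots> = w_norm_sq P \<mu> lam q t X"
    unfolding w_norm_sq_def hnorm_sq_at_def
    by (intro nn_integral_cong) (auto simp: indicator_def)
  finally show ?thesis by simp
qed

section \<open>Linear combinations, truncations and simple families as integrands\<close>

lemma lin_comb_measurable_integrands:
  assumes X: "X \<in> measurable_integrands P F q T" and Y: "Y \<in> measurable_integrands P F q T"
  shows "lin_comb a X b Y \<in> measurable_integrands P F q T"
proof -
  have H: "X r \<omega> u \<in> hcompletion (q r u)" "Y r \<omega> u \<in> hcompletion (q r u)" if "r \<in> {0..T}" "\<omega> \<in> space P" for r \<omega> u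
    using X Y that by (auto simp: measurable_integrands_def)
  have "(\<lambda>z. hform (q (fst (fst z)) (snd z)) (lin_comb a X b Y (fst (fst z)) (snd (fst z)) (snd z)) (hembed \<phi>))
      \<in> borel_measurable (predictable_sigma P F T \<Otimes>\<^sub>M borel)" for \<phi>
  proof (subst measurable_cong)
    fix z assume "z \<in> space (predictable_sigma P F T \<Otimes>\<^sub>M (borel :: 'u measure))"
    then have z': "fst (fst z) \<in> {0..T}" "snd (fst z) \<in> space P"
      by (auto simp: space_pair_measure space_predictable)
    interpret pos_form "q (fst (fst z)) (snd z)" using z' by (intro pos_form_q) auto
    show "hform (q (fst (fst z)) (snd z)) (lin_comb a X b Y (fst (fst z)) (snd (fst z)) (snd z)) (hembed \<phi>) =
      a * hform (q (fst (fst z)) (snd z)) (X (fst (fst z)) (snd (fst z)) (snd z)) (hembed \<phi>) +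
      b * hform (q (fst (fst z)) (snd z)) (Y (fst (fst z)) (snd (fst z)) (snd z)) (hembed \<phi>)"
      unfolding lin_comb_def by (rule hform_lin_left[OF H(1)[OF z'] H(2)[OF z'] hcompletion_hembed])
  qed (use X Y in \<open>auto simp: measurable_integrands_def intro!: borel_measurable_add borel_measurable_times\<close>)
  moreover have "lin_comb a X b Y r \<omega> u \<in> hcompletion (q r u)" if "r \<in> {0..T}" "\<omega> \<in> space P" for r \<omega> u
    unfolding lin_comb_def using H[OF that] that by (intro pos_form.hcompletion_lin pos_form_q) auto
  ultimately show ?thesis by (simp add: measurable_integrands_def)
qed

text \<open>The pointwise parallelogram bound, integrated; it serves to keep norms of linear
  combinations finite.\<close>

lemma w_norm_sq_lin_comb_le:
  assumes T: "0 < T" and X: "X \<in> measurable_integrands P F q T" and Y: "Y \<in> measurable_integrands P F q T"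
  shows "w_norm_sq P \<mu> lam q T (lin_comb a X b Y) \<le>
    ennreal (2 * a\<^sup>2) * w_norm_sq P \<mu> lam q T X + ennreal (2 * b\<^sup>2) * w_norm_sq P \<mu> lam q T Y"
proof -
  let ?f = "\<lambda>X z. hnorm_sq_at q X z * indicator {0<..T} (fst (fst z))"
  note m = measurable_triple[OF T hnorm_sq_measurable[OF T X] order_refl]
    measurable_triple[OF T hnorm_sq_measurable[OF T Y] order_refl]
  note eq = w_norm_sq_eq_triple[OF T order_refl]
  have "w_norm_sq P \<mu> lam q T (lin_comb a X b Y) = (\<integral>\<^sup>+z. ?f (lin_comb a X b Y) z \<partial>triple)"
    by (rule eq[OF lin_comb_measurable_integrands[OF X Y]])
  also have "\<dots> \<le> (\<integral>\<^sup>+z. ennreal (2 * a\<^sup>2) * ?f X z + ennreal (2 * b\<^sup>2) * ?f Y z \<partial>triple)"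
  proof (rule nn_integral_mono)
    fix z assume "z \<in> space triple"
    show "?f (lin_comb a X b Y) z \<le> ennreal (2 * a\<^sup>2) * ?f X z + ennreal (2 * b\<^sup>2) * ?f Y z"
    proof (cases "fst (fst z) \<in> {0<..T}")
      case True
      then have z': "fst (fst z) \<in> {0..T}" "snd (fst z) \<in> space P"
        using \<open>z \<in> space triple\<close> by (auto simp: space_pair_measure)
      interpret pos_form "q (fst (fst z)) (snd z)" using z' by (intro pos_form_q) auto
      let ?x = "X (fst (fst z)) (snd (fst z)) (snd z)" and ?y = "Y (fst (fst z)) (snd (fst z)) (snd z)"
      let ?n = "hnorm (q (fst (fst z)) (snd z))"
      have "(?n (\<lambda>n. a *\<^sub>R ?x n + b *\<^sub>R ?y n))\<^sup>2 \<le> 2 * a\<^sup>2 * (?n ?x)\<^sup>2 + 2 * b\<^sup>2 * (?n ?y)\<^sup>2"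
        using X Y z' by (intro hnorm_sq_lin_le) (auto simp: measurable_integrands_def)
      from ennreal_leI[OF this] show ?thesis
        using True by (simp add: hnorm_sq_at_def lin_comb_def ennreal_plus ennreal_mult)
    qed simp
  qed
  also have "\<dots> = ennreal (2 * a\<^sup>2) * (\<integral>\<^sup>+z. ?f X z \<partial>triple) + ennreal (2 * b\<^sup>2) * (\<integral>\<^sup>+z. ?f Y z \<partial>triple)"
    using m by (subst nn_integral_add) (auto simp: nn_integral_cmult)
  finally show ?thesis unfolding eq[OF X] eq[OF Y] .
qed

lemma lin_comb_Lambda_w:
  assumes T: "0 < T" and X: "X \<in> Lambda_w P F \<mu> lam q T" and Y: "Y \<in> Lambda_w P F \<mu> lam q T"
  shows "lin_comb a X b Y \<in> Lambda_w P F \<mu> lam q T"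
proof -
  have XY: "X \<in> measurable_integrands P F q T" "Y \<in> measurable_integrands P F q T"
    "w_norm_sq P \<mu> lam q T X < \<infinity>" "w_norm_sq P \<mu> lam q T Y < \<infinity>"
    using X Y by (auto simp: Lambda_w_iff)
  have "w_norm_sq P \<mu> lam q T (lin_comb a X b Y) < \<infinity>"
    by (rule le_less_trans[OF w_norm_sq_lin_comb_le[OF T XY(1,2)]])
       (use XY(3,4) in \<open>auto simp: ennreal_mult_less_top\<close>)
  then show ?thesis using lin_comb_measurable_integrands[OF XY(1,2)] by (simp add: Lambda_w_iff)
qed

lemma hnorm_zero: "0 \<le> r \<Longrightarrow> hnorm (q r u) (\<lambda>_. 0) = 0"
  using pos_form.hform_hembed[OF pos_form_q, of r u 0 0] pos_form.form_simps(7)[OF pos_form_q, of r u 0]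
  by (simp add: hnorm_def hembed_zero)

lemma w_norm_sq_restrict:
  assumes t: "t \<in> {0..T}"
  shows "w_norm_sq P \<mu> lam q T (restrict_to t X) = w_norm_sq P \<mu> lam q t X"
  unfolding w_norm_sq_def
proof (intro nn_integral_cong)
  fix \<omega> r assume "r \<in> space lam"
  then have r: "0 \<le> r" by (simp add: space_lam)
  show "(\<integral>\<^sup>+u. ennreal ((hnorm (q r u) (restrict_to t X r \<omega> u))\<^sup>2) \<partial>\<mu>) * indicator {0<..T} r =
        (\<integral>\<^sup>+u. ennreal ((hnorm (q r u) (X r \<omega> u))\<^sup>2) \<partial>\<mu>) * indicator {0<..t} r"
    using t r by (auto simp: restrict_to_def hnorm_zero[OF r] indicator_def)
qed

lemma w_norm_sq_mono:
  assumes "t \<le> T"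
  shows "w_norm_sq P \<mu> lam q t X \<le> w_norm_sq P \<mu> lam q T X"
  unfolding w_norm_sq_def using assms
  by (intro nn_integral_mono mult_left_mono) (auto simp: indicator_def)

lemma restrict_Lambda_w:
  assumes T: "0 < T" and t: "t \<in> {0..T}" and X: "X \<in> Lambda_w P F \<mu> lam q T"
  shows "restrict_to t X \<in> Lambda_w P F \<mu> lam q T"
proof -
  have XM: "X \<in> measurable_integrands P F q T" using X by (simp add: Lambda_w_iff)
  have fin: "w_norm_sq P \<mu> lam q T (restrict_to t X) < \<infinity>"
    unfolding w_norm_sq_restrict[OF t]
    using le_less_trans[OF w_norm_sq_mono, of t T X] t X by (simp add: Lambda_w_iff)
  have "(\<lambda>z. hform (q (fst (fst z)) (snd z)) (restrict_to t X (fst (fst z)) (snd (fst z)) (snd z)) (hembed \<phi>))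
      \<in> borel_measurable (predictable_sigma P F T \<Otimes>\<^sub>M borel)" for \<phi>
  proof (subst measurable_cong)
    fix z assume "z \<in> space (predictable_sigma P F T \<Otimes>\<^sub>M (borel :: 'u measure))"
    then have z': "fst (fst z) \<in> {0..T}" "snd (fst z) \<in> space P"
      by (auto simp: space_pair_measure space_predictable)
    interpret pos_form "q (fst (fst z)) (snd z)" using z' by (intro pos_form_q) auto
    show "hform (q (fst (fst z)) (snd z)) (restrict_to t X (fst (fst z)) (snd (fst z)) (snd z)) (hembed \<phi>) =
      indicator {0..t} (fst (fst z)) * hform (q (fst (fst z)) (snd z)) (X (fst (fst z)) (snd (fst z)) (snd z)) (hembed \<phi>)"
      using z' hform_hembed[of 0 \<phi>] by (auto simp: restrict_to_def indicator_def hembed_zero form_simps)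
  next
    have "(\<lambda>z. fst (fst z)) \<in> borel_measurable (predictable_sigma P F T \<Otimes>\<^sub>M (borel :: 'u measure))"
      using measurable_compose[OF measurable_fst predictable_fst_borel[OF T]] .
    then have "(\<lambda>z. indicator {0..t} (fst (fst z)) :: real) \<in> borel_measurable (predictable_sigma P F T \<Otimes>\<^sub>M (borel :: 'u measure))"
      by measurable
    then show "(\<lambda>z. indicator {0..t} (fst (fst z)) * hform (q (fst (fst z)) (snd z)) (X (fst (fst z)) (snd (fst z)) (snd z)) (hembed \<phi>))
       \<in> borel_measurable (predictable_sigma P F T \<Otimes>\<^sub>M borel)"
      using XM by (intro borel_measurable_times) (auto simp: measurable_integrands_def)
  qed
  moreover have "restrict_to t X r \<omega> u \<in> hcompletion (q r u)" if "r \<in> {0..T}" "\<omega> \<in> space P" for r \<omega> u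
    using XM that pos_form.hcompletion_hembed[OF pos_form_q, of r 0 u]
    by (auto simp: restrict_to_def measurable_integrands_def hembed_zero)
  ultimately show ?thesis using fin by (simp add: Lambda_w_iff measurable_integrands_def)
qed

text \<open>The pairing is the indicator of a predictable rectangle times that of \<open>A\<close>
  times \<open>q r u \<phi> \<psi>\<close>. The norm is finite because
  \<open>q r u \<phi> \<phi>\<close> is bounded on \<open>{0..T}\<close>, while \<open>A\<close> has
  finite \<open>\<mu>\<close> measure and \<open>{0..T}\<close> finite \<open>lam\<close>
  measure.\<close>

lemma indicator_Lambda_w:
  assumes T: "0 < T" and st: "0 \<le> s" "s < t" "t \<le> T" and E: "E \<in> sets (F s)" and A: "A \<in> R"
  shows "(\<lambda>r \<omega> u k. (indicator {s<..t} r * indicator E \<omega> * indicator A u) *\<^sub>R hembed \<phi> k) \<in> Lambda_w P F \<mu> lam q T"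
    (is "?X \<in> _")
proof -
  have Xe: "?X r \<omega> u = hembed ((indicator {s<..t} r * indicator E \<omega> * indicator A u) *\<^sub>R \<phi>)" for r \<omega> u
    by (simp add: hembed_def)
  have H: "?X r \<omega> u \<in> hcompletion (q r u)" if "r \<in> {0..T}" for r \<omega> u
    unfolding Xe using that by (intro pos_form.hcompletion_hembed pos_form_q) auto
  have "(\<lambda>z. hform (q (fst (fst z)) (snd z)) (?X (fst (fst z)) (snd (fst z)) (snd z)) (hembed \<psi>))
      \<in> borel_measurable (predictable_sigma P F T \<Otimes>\<^sub>M borel)" for \<psi>
  proof (subst measurable_cong)
    fix z assume "z \<in> space (predictable_sigma P F T \<Otimes>\<^sub>M (borel :: 'u measure))"
    then have z': "fst (fst z) \<in> {0..T}" "snd (fst z) \<in> space P"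
      by (auto simp: space_pair_measure space_predictable)
    interpret pos_form "q (fst (fst z)) (snd z)" using z' by (intro pos_form_q) auto
    show "hform (q (fst (fst z)) (snd z)) (?X (fst (fst z)) (snd (fst z)) (snd z)) (hembed \<psi>) =
      indicator ({s<..t} \<times> E) (fst z) * indicator A (snd z) * q (fst (fst z)) (snd z) \<phi> \<psi>"
      unfolding Xe hform_hembed by (simp add: form_simps indicator_times)
  next
    have "{s<..t} \<times> E \<in> sets (predictable_sigma P F T)"
      using predictable_sets(2)[OF T st E] .
    then have "(\<lambda>z. indicator ({s<..t} \<times> E) (fst z) :: real) \<in> borel_measurable (predictable_sigma P F T \<Otimes>\<^sub>M (borel :: 'u measure))"
      by measurable
    moreover have "(\<lambda>z. indicator A (snd z) :: real) \<in> borel_measurable (predictable_sigma P F T \<Otimes>\<^sub>M (borel :: 'u measure))"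
      using R_sets[OF A] by measurable
    ultimately show "(\<lambda>z. indicator ({s<..t} \<times> E) (fst z) * indicator A (snd z) * q (fst (fst z)) (snd z) \<phi> \<psi>)
       \<in> borel_measurable (predictable_sigma P F T \<Otimes>\<^sub>M borel)"
      by (intro borel_measurable_times q_predictable_measurable[OF T])
  qed
  moreover have "w_norm_sq P \<mu> lam q T ?X < \<infinity>"
  proof -
    obtain K where K: "\<forall>r\<in>{0..T}. \<forall>u. \<bar>q r u \<phi> \<phi>\<bar> \<le> K"
      using q_bounded[OF T, of \<phi> \<phi>] unfolding bounded_iff by auto
    have [measurable]: "A \<in> sets \<mu>" using R_sets[OF A] by (simp add: mu_sets)
    have "w_norm_sq P \<mu> lam q T ?X \<le> (\<integral>\<^sup>+\<omega>. (\<integral>\<^sup>+r\<in>{0<..T}. (\<integral>\<^sup>+u. ennreal K * indicator A u \<partial>\<mu>) \<partial>lam) \<partial>P)"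
      unfolding w_norm_sq_def
    proof (intro nn_integral_mono)
      fix \<omega> r
      show "(\<integral>\<^sup>+u. ennreal ((hnorm (q r u) (?X r \<omega> u))\<^sup>2) \<partial>\<mu>) * indicator {0<..T} r
        \<le> (\<integral>\<^sup>+u. ennreal K * indicator A u \<partial>\<mu>) * indicator {0<..T} r"
      proof (cases "r \<in> {0<..T}")
        case True
        then have r: "r \<in> {0..T}" by auto
        have "ennreal ((hnorm (q r u) (?X r \<omega> u))\<^sup>2) \<le> ennreal K * indicator A u" for u
        proof -
          interpret pos_form "q r u" using r by (intro pos_form_q) auto
          have "(hnorm (q r u) (?X r \<omega> u))\<^sup>2 =
              (indicator {s<..t} r * indicator E \<omega> * indicator A u)\<^sup>2 * q r u \<phi> \<phi>"
            unfolding hnorm_sq[OF H[OF r]] unfolding Xe hform_hembed by (simp add: form_simps power2_eq_square)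
          also have "\<dots> \<le> K * indicator A u"
            using K[rule_format, OF r, of u] by (auto simp: indicator_def)
          finally show ?thesis by (auto simp: indicator_def intro: ennreal_leI)
        qed
        then show ?thesis by (intro mult_right_mono nn_integral_mono) auto
      qed simp
    qed
    also have "\<dots> = ennreal K * emeasure \<mu> A * emeasure lam {0<..T}"
    proof -
      have [measurable]: "{0<..T} \<in> sets lam" by (rule sets_lamI) auto
      show ?thesis by (simp add: nn_integral_cmult emeasure_space_1)
    qed
    also have "\<dots> < \<infinity>"
    proof -
      have "emeasure lam {0<..T} \<le> emeasure lam {0..T}"
        by (intro emeasure_mono sets_lamI) auto
      then show ?thesis using lam_finite[of T] mu_finite[OF A]
        by (auto simp: ennreal_mult_less_top)
    qed
    finally show ?thesis .
  qed
  ultimately show ?thesis using H by (simp add: Lambda_w_iff measurable_integrands_def)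
qed

lemma zero_Lambda_w:
  assumes T: "0 < T"
  shows "(\<lambda>_ _ _ _. 0) \<in> Lambda_w P F \<mu> lam q T"
proof -
  interpret ring_of_sets UNIV R by (rule ring)
  have "(\<lambda>r \<omega> u k. (indicator {0<..T} r * indicator {} \<omega> * indicator {} u) *\<^sub>R hembed 0 k) \<in> Lambda_w P F \<mu> lam q T"
    using T by (intro indicator_Lambda_w) auto
  then show ?thesis by simp
qed

lemma sum_Lambda_w:
  assumes T: "0 < T" and X: "\<And>i. i \<in> S \<Longrightarrow> X i \<in> Lambda_w P F \<mu> lam q T"
  shows "(\<lambda>r \<omega> u k. \<Sum>i\<in>S. X i r \<omega> u k) \<in> Lambda_w P F \<mu> lam q T"
  using X
proof (induction S rule: infinite_finite_induct)
  case (insert x S)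
  then show ?case
    using lin_comb_Lambda_w[OF T, of "X x" "\<lambda>r \<omega> u k. \<Sum>i\<in>S. X i r \<omega> u k" 1 1]
    by (simp add: lin_comb_def)
qed (simp_all add: zero_Lambda_w[OF T])

lemma simple_family_Lambda_w:
  assumes T: "0 < T" and d: "simple_data F R T n m s t E A"
  shows "simple_family n m s t E A \<phi> \<in> Lambda_w P F \<mu> lam q T"
  unfolding simple_family_def using d
  by (intro sum_Lambda_w[OF T] indicator_Lambda_w[OF T]) (auto simp: simple_data_def)

text \<open>The difference of two truncations is \<open>X\<close>, up to sign, between the two times
  and zero elsewhere. Its norm is dominated by that of \<open>X\<close> and tends to zero pointwise
  except possibly on the slice \<open>r = t\<close>, which is null without atoms.\<close>

lemma w_norm_sq_restrict_continuous:
  assumes T: "0 < T" and X: "X \<in> Lambda_w P F \<mu> lam q T" and t: "t \<in> {0..T}"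
    and atoms: "\<And>t. t \<in> {0<..T} \<Longrightarrow> emeasure lam {t} = 0"
  shows "((\<lambda>s. w_norm_sq P \<mu> lam q T (integrand_diff (restrict_to s X) (restrict_to t X))) \<longlongrightarrow> 0)
    (at t within {0..T})"
proof -
  have XM: "X \<in> measurable_integrands P F q T" and fin: "w_norm_sq P \<mu> lam q T X < \<infinity>"
    using X by (auto simp: Lambda_w_iff)
  let ?f = "\<lambda>X z. hnorm_sq_at q X z * indicator {0<..T} (fst (fst z))"
  have Y: "integrand_diff (restrict_to s X) (restrict_to t X) \<in> measurable_integrands P F q T" if "s \<in> {0..T}" for s
    using lin_comb_Lambda_w[OF T restrict_Lambda_w[OF T that X] restrict_Lambda_w[OF T t X]]
    by (simp add: Lambda_w_iff)
  note meas = measurable_triple[OF T hnorm_sq_measurable[OF T] order_refl]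
  have ptw: "?f (integrand_diff (restrict_to s X) (restrict_to t X)) z =
      ?f X z * indicator ({min s t<..max s t} \<times> UNIV) (fst z)"
    if s: "s \<in> {0..T}" and z: "z \<in> space triple" for s z
  proof (cases "fst (fst z) \<in> {0<..T}")
    case True
    then have z': "fst (fst z) \<in> {0..T}" "snd (fst z) \<in> space P"
      using z by (auto simp: space_pair_measure)
    interpret pos_form "q (fst (fst z)) (snd z)" using z' by (intro pos_form_q) auto
    let ?x = "X (fst (fst z)) (snd (fst z)) (snd z)"
    have x: "?x \<in> hcompletion (q (fst (fst z)) (snd z))"
      using XM z' by (auto simp: measurable_integrands_def)
    have n0: "hnorm (q (fst (fst z)) (snd z)) (\<lambda>_. 0) = 0" using z' by (intro hnorm_zero) auto
    have neg: "(hnorm (q (fst (fst z)) (snd z)) (\<lambda>n. - ?x n))\<^sup>2 = (hnorm (q (fst (fst z)) (snd z)) ?x)\<^sup>2"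
      by (simp add: hnorm_def hform_def bilinear_lneg[OF bil] bilinear_rneg[OF bil])
    have ind: "indicator ({min s t<..max s t} \<times> UNIV) (fst z) = (indicator {min s t<..max s t} (fst (fst z)) :: ennreal)"
      by (cases "fst z") (auto simp: indicator_def)
    show ?thesis
      using True s t z' unfolding ind hnorm_sq_at_def lin_comb_def restrict_to_def
      by (cases "fst (fst z) \<le> s"; cases "fst (fst z) \<le> t") (auto simp: n0 neg indicator_def min_def max_def)
  qed simp
  show ?thesis
    unfolding tendsto_at_iff_sequentially
  proof (intro allI impI)
    fix x :: "nat \<Rightarrow> real" assume x: "\<forall>i. x i \<in> {0..T} - {t}" and lim: "x \<longlonglongrightarrow> t"
    have xm: "x n \<in> {0..T}" for n using x by blast
    have "(\<lambda>n. \<integral>\<^sup>+z. ?f (integrand_diff (restrict_to (x n) X) (restrict_to t X)) z \<partial>triple)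
      \<longlonglongrightarrow> (\<integral>\<^sup>+z. 0 \<partial>triple)"
    proof (rule nn_integral_dominated_convergence[where w="?f X"])
      show "?f (integrand_diff (restrict_to (x n) X) (restrict_to t X)) \<in> borel_measurable triple" for n
        by (rule meas[OF Y[OF xm]])
      show "?f X \<in> borel_measurable triple" by (rule meas[OF XM])
      show "AE z in triple. ?f (integrand_diff (restrict_to (x n) X) (restrict_to t X)) z \<le> ?f X z" for n
      proof (rule AE_I2)
        fix z assume z: "z \<in> space triple"
        show "?f (integrand_diff (restrict_to (x n) X) (restrict_to t X)) z \<le> ?f X z"
          unfolding ptw[OF xm z] by (simp add: indicator_def)
      qed
      show "(\<integral>\<^sup>+z. ?f X z \<partial>triple) < \<infinity>"
        using fin unfolding w_norm_sq_eq_triple[OF T order_refl XM] .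
      \<comment> \<open>At \<open>t = 0\<close> nothing has to be excluded: the norm integrates over
        \<open>{0<..T}\<close>, so an atom of \<open>lam\<close> at 0 is harmless.\<close>
      have "AE z in triple. 0 < t \<longrightarrow> fst (fst z) \<noteq> t"
      proof (cases "0 < t")
        case True
        interpret mu: sigma_finite_measure \<mu> by (rule mu_sigma_finite)
        have tl: "{t} \<in> sets lam" using t by (intro sets_lamI) auto
        have "emeasure (lam \<Otimes>\<^sub>M P) ({t} \<times> space P) = 0"
          using atoms[of t] True t by (subst emeasure_pair_measure_Times[OF tl sets.top]) simp
        then have "emeasure triple (({t} \<times> space P) \<times> space \<mu>) = 0"
          by (subst mu.emeasure_pair_measure_Times[OF pair_measureI[OF tl sets.top] sets.top]) simp
        then show ?thesis
          using pair_measureI[OF pair_measureI[OF tl sets.top[of P]] sets.top[of \<mu>]]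
          by (intro AE_I[of _ _ "({t} \<times> space P) \<times> space \<mu>"]) (auto simp: space_pair_measure)
      qed simp
      then show "AE z in triple. (\<lambda>n. ?f (integrand_diff (restrict_to (x n) X) (restrict_to t X)) z) \<longlonglongrightarrow> 0"
      proof (rule AE_mp, intro AE_I2 impI)
        fix z assume z: "z \<in> space triple" and ne: "0 < t \<longrightarrow> fst (fst z) \<noteq> t"
        show "(\<lambda>n. ?f (integrand_diff (restrict_to (x n) X) (restrict_to t X)) z) \<longlonglongrightarrow> 0"
        proof (cases "fst (fst z) \<in> {0<..T} \<and> fst (fst z) \<noteq> t")
          case True
          have "\<forall>\<^sub>F n in sequentially. dist (x n) t < \<bar>fst (fst z) - t\<bar>"
            using lim True by (intro tendstoD) auto
          then have "\<forall>\<^sub>F n in sequentially. 0 = ?f (integrand_diff (restrict_to (x n) X) (restrict_to t X)) z"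
          proof eventually_elim
            fix n assume "dist (x n) t < \<bar>fst (fst z) - t\<bar>"
            then have "fst z \<notin> {min (x n) t<..max (x n) t} \<times> UNIV"
              by (cases "fst z") (auto simp: dist_real_def min_def max_def split: if_splits)
            then show "0 = ?f (integrand_diff (restrict_to (x n) X) (restrict_to t X)) z"
              unfolding ptw[OF xm z] by simp
          qed
          then show ?thesis by (rule Lim_transform_eventually[OF tendsto_const])
        next
          case False
          then have "fst (fst z) \<notin> {0<..T}" using ne t by auto
          then show ?thesis by simp
        qed
      qed
    qed simp
    then show "((\<lambda>s. w_norm_sq P \<mu> lam q T (integrand_diff (restrict_to s X) (restrict_to t X))) \<circ> x) \<longlonglongrightarrow> 0"
      by (simp add: comp_def w_norm_sq_eq_triple[OF T order_refl Y[OF xm]])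
  qed
qed

section \<open>The weak integral as a martingale\<close>

text \<open>Stopping at a deterministic time: for \<open>s \<le> b\<close> the martingale property
  is used between \<open>s\<close> and \<open>min t b\<close>; for \<open>b < s\<close> both sides
  are frozen at \<open>b\<close>.\<close>

lemma stopped_martingale:
  assumes A: "A \<in> R" and b: "0 \<le> b"
  shows "(\<lambda>t. M (min t b) A \<phi>) \<in> sq_martingales P F {0..T}"
proof (rule sq_martingaleI)
  note Mm = martingale[OF A, of \<phi>]
  fix t assume t: "t \<in> {0..T}"
  have m: "min t b \<in> {0..}" "0 \<le> min t b" using t b by auto
  note D = sq_martingaleD[OF Mm m]
  show "M (min t b) A \<phi> \<in> borel_measurable (F t)"
    by (rule measurable_F_mono[OF m(2) _ D(1)]) simp
  show "integrable P (\<lambda>\<omega>. (M (min t b) A \<phi> \<omega>)\<^sup>2)" "(\<integral>\<omega>. M (min t b) A \<phi> \<omega> \<partial>P) = 0"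
    using D by auto
next
  fix s t G assume st: "s \<in> {0..T}" "t \<in> {0..T}" "s \<le> t" and G: "G \<in> sets (F s)"
  show "(\<integral>\<omega>. indicator G \<omega> * M (min t b) A \<phi> \<omega> \<partial>P) = (\<integral>\<omega>. indicator G \<omega> * M (min s b) A \<phi> \<omega> \<partial>P)"
  proof (cases "s \<le> b")
    case True
    have s0: "0 \<le> s" using st by auto
    show ?thesis
      using sq_martingale_mult(2)[OF martingale[OF A, of \<phi>] _ s0 _ _ integrable_indicator_sq[OF s0 G], of "min t b"] st True
      by (simp add: min_absorb1)
  next
    case False
    then show ?thesis using st by (simp add: min_absorb2)
  qed
next
  fix \<omega> assume "\<omega> \<in> space P"
  then have "cadlag_on {0..} (\<lambda>t. M t A \<phi> \<omega>)"
    using sq_martingaleD(6)[OF martingale[OF A], of 0] by simp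
  then show "cadlag_on {0..T} (\<lambda>t. M (min t b) A \<phi> \<omega>)"
    by (rule cadlag_on_stop[OF _ b])
qed auto

text \<open>The stopped increment is zero up to time \<open>a\<close>, so the event
  \<open>E\<close>, known only from \<open>a\<close> on, spoils neither adaptedness nor the
  martingale property.\<close>

lemma elementary_martingale:
  assumes A: "A \<in> R" and ab: "0 \<le> a" "a < b" and E: "E \<in> sets (F a)"
  shows "(\<lambda>t \<omega>. indicator E \<omega> * (M (min t b) A \<phi> \<omega> - M (min t a) A \<phi> \<omega>)) \<in> sq_martingales P F {0..T}"
proof -
  define D where "D = (\<lambda>t \<omega>. M (min t b) A \<phi> \<omega> - M (min t a) A \<phi> \<omega>)"
  have D: "D \<in> sq_martingales P F {0..T}"
    using sq_martingale_lin[OF _ stopped_martingale[OF A, of b \<phi> T] stopped_martingale[OF A, of a \<phi> T], of 1 "-1"] ab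
    by (simp add: D_def)
  have D0: "D t = (\<lambda>_. 0)" if "t \<le> a" for t
    using that ab by (simp add: D_def min_absorb1)
  have EP: "E \<in> sets P" using sets_F_P[OF ab(1) E] .
  \<comment> \<open>From time \<open>a\<close> on, \<open>B \<inter> E\<close> is an event of
    \<open>F r\<close>. Earlier times are compared with time \<open>a\<close>, where
    \<open>D\<close> is still zero.\<close>
  have key: "(\<integral>\<omega>. indicator B \<omega> * (indicator E \<omega> * D t \<omega>) \<partial>P) = (\<integral>\<omega>. indicator B \<omega> * (indicator E \<omega> * D r \<omega>) \<partial>P)"
    if "a \<le> r" "r \<le> t" "t \<le> T" "B \<in> sets (F r)" for B r t
  proof -
    have r0: "0 \<le> r" using that ab by auto
    have BE: "B \<inter> E \<in> sets (F r)"
      using that(4) E F_mono[OF ab(1) that(1)] by (intro sets.Int) auto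
    have "(\<integral>\<omega>. indicator (B \<inter> E) \<omega> * D t \<omega> \<partial>P) = (\<integral>\<omega>. indicator (B \<inter> E) \<omega> * D r \<omega> \<partial>P)"
      using that r0 by (intro sq_martingale_mult(2)[OF D _ r0 _ _ integrable_indicator_sq[OF r0 BE]]) auto
    then show ?thesis by (simp add: indicator_inter_arith mult.assoc)
  qed
  have mart: "(\<integral>\<omega>. indicator G \<omega> * (indicator E \<omega> * D t \<omega>) \<partial>P) = (\<integral>\<omega>. indicator G \<omega> * (indicator E \<omega> * D s \<omega>) \<partial>P)"
    if st: "0 \<le> s" "s \<le> t" "t \<le> T" and G: "G \<in> sets (F s)" for s t G
  proof (cases "a \<le> s")
    case True
    then show ?thesis by (rule key[OF _ st(2,3) G])
  next
    case False
    show ?thesis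
    proof (cases "t \<le> a")
      case True
      then show ?thesis using False by (simp add: D0)
    next
      case f: False
      have "G \<in> sets (F a)" using G F_mono[OF st(1), of a] False by auto
      then have "(\<integral>\<omega>. indicator G \<omega> * (indicator E \<omega> * D t \<omega>) \<partial>P) = (\<integral>\<omega>. indicator G \<omega> * (indicator E \<omega> * D a \<omega>) \<partial>P)"
        using f st by (intro key) auto
      then show ?thesis using False by (simp add: D0)
    qed
  qed
  have "(\<lambda>t \<omega>. indicator E \<omega> * D t \<omega>) \<in> sq_martingales P F {0..T}"
  proof (rule sq_martingaleI)
    fix t assume t: "t \<in> {0..T}"
    then have t0: "0 \<le> t" by auto
    note Dt = sq_martingaleD[OF D t t0]
    show "(\<lambda>\<omega>. indicator E \<omega> * D t \<omega>) \<in> borel_measurable (F t)"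
    proof (cases "t \<le> a")
      case False
      then have "E \<in> sets (F t)" using E F_mono[OF ab(1), of t] by auto
      then show ?thesis using Dt(1) by (intro borel_measurable_times) auto
    qed (simp add: D0)
    show "integrable P (\<lambda>\<omega>. (indicator E \<omega> * D t \<omega>)\<^sup>2)"
    proof (rule Bochner_Integration.integrable_bound[OF Dt(3)])
      show "(\<lambda>\<omega>. (indicator E \<omega> * D t \<omega>)\<^sup>2) \<in> borel_measurable P"
        using EP Dt(2) by measurable
    qed (auto simp: indicator_def)
    \<comment> \<open>Zero mean is the martingale test from time 0 with the whole space as event,
      because \<open>D 0\<close> vanishes.\<close>
    have sp: "space P \<in> sets (F 0)" using sets.top[of "F 0"] space_F[of 0] by simp
    have "(\<integral>\<omega>. indicator E \<omega> * D t \<omega> \<partial>P) = (\<integral>\<omega>. indicator (space P) \<omega> * (indicator E \<omega> * D t \<omega>) \<partial>P)"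
      by (intro Bochner_Integration.integral_cong) auto
    also have "\<dots> = 0" using mart[OF _ t0 _ sp] t ab by (simp add: D0)
    finally show "(\<integral>\<omega>. indicator E \<omega> * D t \<omega> \<partial>P) = 0" .
  next
    fix \<omega> assume "\<omega> \<in> space P"
    then have "cadlag_on {0..T} (\<lambda>t. D t \<omega>)"
      using D by (simp add: sq_martingales_def)
    from cadlag_on_lin[OF this this, of "indicator E \<omega>" 0]
    show "cadlag_on {0..T} (\<lambda>t. indicator E \<omega> * D t \<omega>)" by simp
  qed (auto intro: mart)
  then show ?thesis by (simp add: D_def)
qed

definition simple_process :: "nat \<Rightarrow> nat \<Rightarrow> (nat \<Rightarrow> real) \<Rightarrow> (nat \<Rightarrow> real) \<Rightarrow> (nat \<Rightarrow> 'w set)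
    \<Rightarrow> (nat \<Rightarrow> 'u set) \<Rightarrow> (nat \<Rightarrow> nat \<Rightarrow> 'a) \<Rightarrow> real \<Rightarrow> 'w \<Rightarrow> real" where
  "simple_process n m s t E A \<phi> = (\<lambda>\<tau> \<omega>. \<Sum>i<n. \<Sum>j<m.
     indicator (E j) \<omega> * (M (min \<tau> (t j)) (A i) (\<phi> i j) \<omega> - M (min \<tau> (s j)) (A i) (\<phi> i j) \<omega>))"

lemma simple_process_martingale:
  assumes "simple_data F R T n m s t E A"
  shows "simple_process n m s t E A \<phi> \<in> sq_martingales P F {0..T}"
  unfolding simple_process_def using assms
  by (intro sq_martingale_sum elementary_martingale) (auto simp: simple_data_def)

text \<open>Stopping a simple family at \<open>\<tau>\<close>: an index whose interval lies beyond \<open>\<tau>\<close> keeps its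
  interval, so that \<open>s j < t j\<close> remains true, and gets the empty event.\<close>

lemma simple_data_stop:
  assumes d: "simple_data F R T n m s t E A"
  shows "simple_data F R T n m s (\<lambda>j. if s j < \<tau> then min (t j) \<tau> else t j) (\<lambda>j. if s j < \<tau> then E j else {}) A"
proof -
  let ?t = "\<lambda>j. if s j < \<tau> then min (t j) \<tau> else t j" and ?E = "\<lambda>j. if s j < \<tau> then E j else {}"
  have "s k = s j \<and> ?t k = ?t j \<and> ?E k \<inter> ?E j = {}"
    if "k < m" "j < m" "k \<noteq> j" "{s k<..?t k} \<inter> {s j<..?t j} \<noteq> {}" for k j
  proof -
    have "{s k<..?t k} \<subseteq> {s k<..t k}" "{s j<..?t j} \<subseteq> {s j<..t j}" by auto
    then have "{s k<..t k} \<inter> {s j<..t j} \<noteq> {}" using that(4) by blast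
    then have "s k = s j \<and> t k = t j \<and> E k \<inter> E j = {}"
      using d that(1-3) unfolding simple_data_def by blast
    then show ?thesis by auto
  qed
  then show ?thesis using d unfolding simple_data_def by auto
qed

text \<open>Up to \<open>\<tau>\<close> shortening the intervals loses no point, and the emptied
  events belong to intervals not yet begun. Outside \<open>{0..\<tau>}\<close> every term vanishes,
  through its interval or its emptied event; negative times are excluded by
  \<open>0 \<le> s j\<close>.\<close>

lemma restrict_simple_family:
  assumes d: "simple_data F R T n m s t E A"
  shows "restrict_to \<tau> (simple_family n m s t E A \<phi>) =
    simple_family n m s (\<lambda>j. if s j < \<tau> then min (t j) \<tau> else t j) (\<lambda>j. if s j < \<tau> then E j else {}) A \<phi>"
proof (intro ext)
  fix r \<omega> u k
  have s0: "0 \<le> s j" if "j < m" for j using d that by (simp add: simple_data_def)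
  show "restrict_to \<tau> (simple_family n m s t E A \<phi>) r \<omega> u k =
    simple_family n m s (\<lambda>j. if s j < \<tau> then min (t j) \<tau> else t j) (\<lambda>j. if s j < \<tau> then E j else {}) A \<phi> r \<omega> u k"
  proof (cases "r \<in> {0..\<tau>}")
    case True
    then show ?thesis
      unfolding restrict_to_def simple_family_def
      by (auto intro!: sum.cong simp: indicator_def)
  next
    case False
    have "indicator {s j<..if s j < \<tau> then min (t j) \<tau> else t j} r *
        indicator (if s j < \<tau> then E j else {}) \<omega> = (0::real)" if "j < m" for j
      using s0[OF that] False by (auto simp: indicator_def)
    then have "simple_family n m s (\<lambda>j. if s j < \<tau> then min (t j) \<tau> else t j)
        (\<lambda>j. if s j < \<tau> then E j else {}) A \<phi> r \<omega> u k = 0"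
      unfolding simple_family_def by (intro sum.neutral ballI) simp
    then show ?thesis using False by (auto simp: restrict_to_def)
  qed
qed

text \<open>If \<open>\<tau> \<le> s j\<close>, both values in \<open>simple_process\<close> are
  taken at \<open>\<tau>\<close> and cancel, which matches the empty event; otherwise
  \<open>min \<tau> (s j)\<close> is \<open>s j\<close>.\<close>

lemma simple_integral_stop:
  assumes d: "simple_data F R T n m s t E A"
  shows "simple_integral M n m s (\<lambda>j. if s j < \<tau> then min (t j) \<tau> else t j) (\<lambda>j. if s j < \<tau> then E j else {}) A \<phi> =
    simple_process n m s t E A \<phi> \<tau>"
proof -
  have st: "s j < t j" if "j < m" for j using d that by (simp add: simple_data_def)
  show ?thesis
    unfolding simple_integral_def simple_process_def increment_def
    by (intro ext sum.cong refl) (auto simp: min_def not_less dest!: st)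
qed

end

section \<open>The process of weak integrals and its cadlag version\<close>

locale nuclear_weak_integral = nuclear_cyl_mvm P F R M \<mu> lam q
  for P :: "'w measure" and F and R :: "'u::topological_space set set"
    and M :: "real \<Rightarrow> 'u set \<Rightarrow> 'a::{real_vector, topological_ab_group_add} \<Rightarrow> 'w \<Rightarrow> real"
    and \<mu> lam q +
  fixes T :: real and I :: "('a, 'w, 'u) integrand \<Rightarrow> 'w \<Rightarrow> real"
  assumes T_pos: "0 < T"
    and weak: "weak_integral P F R M \<mu> lam q T I"
begin

lemma density:
  "X \<in> Lambda_w P F \<mu> lam q T \<Longrightarrow> 0 < e \<Longrightarrow>
    \<exists>Y\<in>simple_w F R T. w_norm_sq P \<mu> lam q T (integrand_diff X Y) < ennreal (e\<^sup>2)"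
  and I_simple: "simple_data F R T n m s t E A \<Longrightarrow>
    AE \<omega> in P. I (simple_family n m s t E A \<phi>) \<omega> = simple_integral M n m s t E A \<phi> \<omega>"
  and I_measurable: "X \<in> Lambda_w P F \<mu> lam q T \<Longrightarrow> I X \<in> borel_measurable P"
  and I_square: "X \<in> Lambda_w P F \<mu> lam q T \<Longrightarrow> integrable P (\<lambda>\<omega>. (I X \<omega>)\<^sup>2)"
  and I_lin: "X \<in> Lambda_w P F \<mu> lam q T \<Longrightarrow> Y \<in> Lambda_w P F \<mu> lam q T \<Longrightarrow>
    AE \<omega> in P. I (lin_comb a X b Y) \<omega> = a * I X \<omega> + b * I Y \<omega>"
  and I_isometry: "X \<in> Lambda_w P F \<mu> lam q T \<Longrightarrow> ennreal (\<integral>\<omega>. (I X \<omega>)\<^sup>2 \<partial>P) = w_norm_sq P \<mu> lam q T X"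
  using weak unfolding weak_integral_def by simp_all

lemma restrict_lin_comb:
  "restrict_to t (lin_comb a X b Y) = lin_comb a (restrict_to t X) b (restrict_to t Y)"
  by (auto simp: restrict_to_def lin_comb_def fun_eq_iff)

lemmas restrict_Lambda = restrict_Lambda_w[OF T_pos]

lemma I_diff_isometry:
  assumes X: "X \<in> Lambda_w P F \<mu> lam q T" and Y: "Y \<in> Lambda_w P F \<mu> lam q T"
    and f: "AE \<omega> in P. f \<omega> = I X \<omega>" "f \<in> borel_measurable P"
    and g: "AE \<omega> in P. g \<omega> = I Y \<omega>" "g \<in> borel_measurable P"
  shows "ennreal (\<integral>\<omega>. (f \<omega> - g \<omega>)\<^sup>2 \<partial>P) = w_norm_sq P \<mu> lam q T (integrand_diff X Y)"
proof -
  have L: "integrand_diff X Y \<in> Lambda_w P F \<mu> lam q T" by (rule lin_comb_Lambda_w[OF T_pos X Y])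
  have "(\<integral>\<omega>. (f \<omega> - g \<omega>)\<^sup>2 \<partial>P) = (\<integral>\<omega>. (I (integrand_diff X Y) \<omega>)\<^sup>2 \<partial>P)"
  proof (rule integral_cong_AE)
    show "AE \<omega> in P. (f \<omega> - g \<omega>)\<^sup>2 = (I (integrand_diff X Y) \<omega>)\<^sup>2"
      using I_lin[OF X Y, of 1 "-1"] f(1) g(1) by eventually_elim simp
  qed (use f g I_measurable[OF L] in auto)
  then show ?thesis using I_isometry[OF L] by simp
qed

lemma I_simple_stopped:
  assumes d: "simple_data F R T n m s t E A"
  shows "AE \<omega> in P. simple_process n m s t E A \<phi> \<tau> \<omega> = I (restrict_to \<tau> (simple_family n m s t E A \<phi>)) \<omega>"
  using I_simple[OF simple_data_stop[OF d], of \<tau> \<phi>]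
  unfolding restrict_simple_family[OF d] simple_integral_stop[OF d] by eventually_elim simp

lemma integral_process_exists:
  assumes X: "X \<in> Lambda_w P F \<mu> lam q T"
  shows "\<exists>J\<in>sq_martingales P F {0..T}. \<forall>t\<in>{0..T}. AE \<omega> in P. J t \<omega> = I (restrict_to t X) \<omega>"
proof -
  \<comment> \<open>\<open>Z\<close> is to be the martingale of a simple family \<open>Y\<close>;
    \<open>Q\<close> keeps just the properties used in the limit, so that both sequences can be
    chosen together.\<close>
  define Q where "Q = (\<lambda>(k :: nat) Y Z. Y \<in> Lambda_w P F \<mu> lam q T \<and> Z \<in> sq_martingales P F {0..T} \<and>
      w_norm_sq P \<mu> lam q T (integrand_diff Y X) \<le> ennreal ((1/8) ^ k) \<and>
      (\<forall>t\<in>{0..T}. AE \<omega> in P. Z t \<omega> = I (restrict_to t Y) \<omega>))"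
  have "\<exists>Y Z. Q k Y Z" for k
  proof -
    obtain Y where Y: "Y \<in> simple_w F R T" "w_norm_sq P \<mu> lam q T (integrand_diff X Y) < ennreal ((sqrt ((1/8) ^ k))\<^sup>2)"
      using density[OF X, of "sqrt ((1/8) ^ k)"] by auto
    obtain n m s t E A \<phi> where Yd: "Y = simple_family n m s t E A \<phi>" "simple_data F R T n m s t E A"
      using Y(1) unfolding simple_w_def by blast
    have YL: "Y \<in> Lambda_w P F \<mu> lam q T"
      unfolding Yd(1) by (rule simple_family_Lambda_w[OF T_pos Yd(2)])
    \<comment> \<open>Symmetry of the distance is read off from the isometry, since squared
      differences in L2 are symmetric.\<close>
    have "w_norm_sq P \<mu> lam q T (integrand_diff Y X) = w_norm_sq P \<mu> lam q T (integrand_diff X Y)"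
      using I_diff_isometry[OF X YL AE_I2 I_measurable[OF X] AE_I2 I_measurable[OF YL]]
        I_diff_isometry[OF YL X AE_I2 I_measurable[OF YL] AE_I2 I_measurable[OF X]]
      by (simp add: power2_commute)
    then show ?thesis
      unfolding Q_def
      using YL Y(2) simple_process_martingale[OF Yd(2), of \<phi>] I_simple_stopped[OF Yd(2), of \<phi>]
      by (intro exI[of _ Y] exI[of _ "simple_process n m s t E A \<phi>"]) (auto simp: Yd(1)[symmetric] less_imp_le)
  qed
  then obtain Y Z where "\<And>k. Q k (Y k) (Z k)" by metis
  then have Y: "\<And>k. Y k \<in> Lambda_w P F \<mu> lam q T" and Z: "\<And>k. Z k \<in> sq_martingales P F {0..T}"
    and close: "\<And>k. w_norm_sq P \<mu> lam q T (integrand_diff (Y k) X) \<le> ennreal ((1/8) ^ k)"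
    and ZI: "\<And>k t. t \<in> {0..T} \<Longrightarrow> AE \<omega> in P. Z k t \<omega> = I (restrict_to t (Y k)) \<omega>"
    unfolding Q_def by simp_all
  show ?thesis
  proof (rule sq_martingale_limit[OF T_pos Z])
    fix t assume t: "t \<in> {0..T}"
    show "I (restrict_to t X) \<in> borel_measurable P" "integrable P (\<lambda>\<omega>. (I (restrict_to t X) \<omega>)\<^sup>2)"
      using restrict_Lambda[OF t X] I_measurable I_square by auto
    show "(\<integral>\<omega>. (Z k t \<omega> - I (restrict_to t X) \<omega>)\<^sup>2 \<partial>P) \<le> (1/8) ^ k" for k
    proof -
      \<comment> \<open>Truncation at \<open>t\<close> commutes with differences and can only
        decrease the norm, so the bound is uniform in \<open>t\<close>.\<close>
      have "ennreal (\<integral>\<omega>. (Z k t \<omega> - I (restrict_to t X) \<omega>)\<^sup>2 \<partial>P)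
          = w_norm_sq P \<mu> lam q T (restrict_to t (integrand_diff (Y k) X))"
        unfolding restrict_lin_comb using sq_martingaleD(2)[OF Z t] t
        by (intro I_diff_isometry restrict_Lambda t X Y ZI AE_I2 I_measurable) auto
      also have "\<dots> \<le> w_norm_sq P \<mu> lam q T (integrand_diff (Y k) X)"
        using t w_norm_sq_mono[of t T] by (simp add: w_norm_sq_restrict[OF t])
      also note close
      finally show ?thesis by simp
    qed
  qed
qed

text \<open>The choice is made separately for each representative \<open>X\<close>; relations
  between the processes of different \<open>X\<close> are therefore only almost sure.\<close>

definition integral_process :: "('a, 'w, 'u) integrand \<Rightarrow> real \<Rightarrow> 'w \<Rightarrow> real" where
  "integral_process X = (SOME J. J \<in> sq_martingales P F {0..T} \<and>
     (\<forall>t\<in>{0..T}. AE \<omega> in P. J t \<omega> = I (restrict_to t X) \<omega>))"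

lemma
  assumes X: "X \<in> Lambda_w P F \<mu> lam q T"
  shows integral_process_martingale: "integral_process X \<in> sq_martingales P F {0..T}"
    and integral_process_eq: "t \<in> {0..T} \<Longrightarrow> AE \<omega> in P. integral_process X t \<omega> = I (restrict_to t X) \<omega>"
proof -
  have "\<exists>J. J \<in> sq_martingales P F {0..T} \<and>
     (\<forall>t\<in>{0..T}. AE \<omega> in P. J t \<omega> = I (restrict_to t X) \<omega>)"
    using integral_process_exists[OF X] by blast
  from someI_ex[OF this]
  show "integral_process X \<in> sq_martingales P F {0..T}"
    "t \<in> {0..T} \<Longrightarrow> AE \<omega> in P. integral_process X t \<omega> = I (restrict_to t X) \<omega>"
    unfolding integral_process_def by auto
qed

lemma integral_process_measurable:
  "X \<in> Lambda_w P F \<mu> lam q T \<Longrightarrow> t \<in> {0..T} \<Longrightarrow> integral_process X t \<in> borel_measurable P"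
  using sq_martingaleD(2)[OF integral_process_martingale] by auto

lemma integral_process_isometry:
  assumes X: "X \<in> Lambda_w P F \<mu> lam q T" and t: "t \<in> {0..T}"
  shows "ennreal (\<integral>\<omega>. (integral_process X t \<omega>)\<^sup>2 \<partial>P) = w_norm_sq P \<mu> lam q t X"
proof -
  have R: "restrict_to t X \<in> Lambda_w P F \<mu> lam q T" by (rule restrict_Lambda[OF t X])
  have "(\<integral>\<omega>. (integral_process X t \<omega>)\<^sup>2 \<partial>P) = (\<integral>\<omega>. (I (restrict_to t X) \<omega>)\<^sup>2 \<partial>P)"
    using integral_process_eq[OF X t] integral_process_measurable[OF X t] I_measurable[OF R]
    by (intro integral_cong_AE) auto
  then show ?thesis using I_isometry[OF R] by (simp add: w_norm_sq_restrict[OF t])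
qed

text \<open>At a fixed time this is linearity of \<open>I\<close>, with a null set depending on the
  time. The null sets of the countably many grid points are united, and cadlag paths extend the
  identity to all of \<open>[0,T]\<close>.\<close>

lemma integral_process_lin:
  assumes X: "X \<in> Lambda_w P F \<mu> lam q T" and Y: "Y \<in> Lambda_w P F \<mu> lam q T"
  shows "AE \<omega> in P. \<forall>t\<in>{0..T}. integral_process (lin_comb a X b Y) t \<omega> =
    a * integral_process X t \<omega> + b * integral_process Y t \<omega>"
proof -
  have L: "lin_comb a X b Y \<in> Lambda_w P F \<mu> lam q T" by (rule lin_comb_Lambda_w[OF T_pos X Y])
  have ae: "AE \<omega> in P. integral_process (lin_comb a X b Y) t \<omega> =
    a * integral_process X t \<omega> + b * integral_process Y t \<omega>" if t: "t \<in> {0..T}" for t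
    using integral_process_eq[OF L t] integral_process_eq[OF X t] integral_process_eq[OF Y t]
      I_lin[OF restrict_Lambda[OF t X] restrict_Lambda[OF t Y], of a b]
    unfolding restrict_lin_comb by eventually_elim simp
  have "AE \<omega> in P. \<forall>n k. k \<le> 2 ^ n \<longrightarrow> integral_process (lin_comb a X b Y) (dyadic T n k) \<omega> =
    a * integral_process X (dyadic T n k) \<omega> + b * integral_process Y (dyadic T n k) \<omega>"
    unfolding AE_all_countable using ae dyadic_mem[OF less_imp_le[OF T_pos]] by (auto intro!: AE_impI)
  then show ?thesis
  proof (rule AE_mp, intro AE_I2 impI ballI)
    fix \<omega> t assume \<omega>: "\<omega> \<in> space P" and t: "t \<in> {0..T}"
      and eq: "\<forall>n k. k \<le> 2 ^ n \<longrightarrow> integral_process (lin_comb a X b Y) (dyadic T n k) \<omega> =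
        a * integral_process X (dyadic T n k) \<omega> + b * integral_process Y (dyadic T n k) \<omega>"
    have cadlag: "cadlag_on {0..T} (\<lambda>t. integral_process X t \<omega>)" if "X \<in> Lambda_w P F \<mu> lam q T" for X
      using sq_martingaleD(6)[OF integral_process_martingale[OF that] t _ \<omega>] t by simp
    show "integral_process (lin_comb a X b Y) t \<omega> = a * integral_process X t \<omega> + b * integral_process Y t \<omega>"
      using eq by (intro cadlag_on_eqI[OF T_pos cadlag[OF L] cadlag_on_lin[OF cadlag[OF X] cadlag[OF Y]] _ t]) auto
  qed
qed

text \<open>Two uses: \<open>X = Y\<close> at different times gives mean square continuity, and
  different integrands at the common time \<open>T\<close> give the norm estimate.\<close>

lemma integral_process_diff_isometry:
  assumes X: "X \<in> Lambda_w P F \<mu> lam q T" and Y: "Y \<in> Lambda_w P F \<mu> lam q T"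
    and s: "s \<in> {0..T}" and t: "t \<in> {0..T}"
  shows "ennreal (\<integral>\<omega>. (integral_process X s \<omega> - integral_process Y t \<omega>)\<^sup>2 \<partial>P) =
    w_norm_sq P \<mu> lam q T (integrand_diff (restrict_to s X) (restrict_to t Y))"
  by (intro I_diff_isometry restrict_Lambda integral_process_eq integral_process_measurable X Y s t)

lemma integral_process_mean_square_continuous:
  assumes X: "X \<in> Lambda_w P F \<mu> lam q T" and atoms: "\<And>t. t \<in> {0<..T} \<Longrightarrow> emeasure lam {t} = 0"
  shows "mean_square_continuous P T (integral_process X)"
  unfolding mean_square_continuous_def
proof
  fix t assume t: "t \<in> {0..T}"
  have "((\<lambda>s. w_norm_sq P \<mu> lam q T (integrand_diff (restrict_to s X) (restrict_to t X))) \<longlongrightarrow> 0)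
    (at t within {0..T})"
    by (rule w_norm_sq_restrict_continuous[OF T_pos X t atoms])
  moreover have "\<forall>\<^sub>F s in at t within {0..T}.
      w_norm_sq P \<mu> lam q T (integrand_diff (restrict_to s X) (restrict_to t X)) =
      ennreal (\<integral>\<omega>. (integral_process X s \<omega> - integral_process X t \<omega>)\<^sup>2 \<partial>P)"
    using integral_process_diff_isometry[OF X X _ t] by (auto simp: eventually_at_filter)
  ultimately have "((\<lambda>s. ennreal (\<integral>\<omega>. (integral_process X s \<omega> - integral_process X t \<omega>)\<^sup>2 \<partial>P)) \<longlongrightarrow> ennreal 0)
    (at t within {0..T})"
    by (simp add: tendsto_cong)
  then show "((\<lambda>s. \<integral>\<omega>. (integral_process X s \<omega> - integral_process X t \<omega>)\<^sup>2 \<partial>P) \<longlongrightarrow> 0) (at t within {0..T})"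
    by (rule tendsto_ennrealD) auto
qed

lemma integral_process_M2_le:
  assumes X: "X \<in> Lambda_w P F \<mu> lam q T" and Y: "Y \<in> Lambda_w P F \<mu> lam q T"
  shows "M2_norm_sq P T (\<lambda>t \<omega>. integral_process X t \<omega> - integral_process Y t \<omega>) \<le>
    4 * w_norm_sq P \<mu> lam q T (integrand_diff X Y)"
proof -
  have TT: "T \<in> {0..T}" using T_pos by auto
  have "(\<lambda>t \<omega>. integral_process X t \<omega> - integral_process Y t \<omega>) \<in> sq_martingales P F {0..T}"
    using sq_martingale_lin[OF _ integral_process_martingale[OF X] integral_process_martingale[OF Y], of 1 "-1"]
    by simp
  from doob_L2[OF T_pos this]
  have "M2_norm_sq P T (\<lambda>t \<omega>. integral_process X t \<omega> - integral_process Y t \<omega>) \<le>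
      4 * ennreal (\<integral>\<omega>. (integral_process X T \<omega> - integral_process Y T \<omega>)\<^sup>2 \<partial>P)"
    by (simp add: ennreal_mult)
  also have "\<dots> = 4 * w_norm_sq P \<mu> lam q T (integrand_diff X Y)"
    unfolding integral_process_diff_isometry[OF X Y TT TT] restrict_lin_comb[symmetric] w_norm_sq_restrict[OF TT] ..
  finally show ?thesis .
qed

end

theorem theorem4p7:
  fixes P :: "'w measure"
    and F :: "real \<Rightarrow> 'w measure"
    and R :: "'u::topological_space set set"
    and M :: "real \<Rightarrow> 'u set \<Rightarrow> 'a::{real_vector, topological_ab_group_add} \<Rightarrow> 'w \<Rightarrow> real"
    and \<mu> :: "'u measure"
    and lam :: "real measure"
    and q :: "real \<Rightarrow> 'u \<Rightarrow> 'a \<Rightarrow> 'a \<Rightarrow> real"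
    and T :: real
    and I :: "('a, 'w, 'u) integrand \<Rightarrow> 'w \<Rightarrow> real"
  assumes "locally_convex_tvs TYPE('a)"
    and "nuclear_cyl_mvm P F R M \<mu> lam q"
    and "0 < T"
    and "weak_integral P F R M \<mu> lam q T I"
  shows "\<exists>J :: ('a, 'w, 'u) integrand \<Rightarrow> real \<Rightarrow> 'w \<Rightarrow> real.
    (\<forall>X\<in>Lambda_w P F \<mu> lam q T.
       (\<forall>t\<in>{0..T}. AE \<omega> in P. J X t \<omega> = I (restrict_to t X) \<omega>) \<and>
       J X \<in> sq_martingales P F {0..T} \<and>
       (\<forall>t\<in>{0..T}. ennreal (\<integral>\<omega>. \<bar>J X t \<omega>\<bar>\<^sup>2 \<partial>P) =
          (\<integral>\<^sup>+\<omega>. (\<integral>\<^sup>+r\<in>{0<..t}. (\<integral>\<^sup>+u. ennreal ((hnorm (q r u) (X r \<omega> u))\<^sup>2) \<partial>\<mu>) \<partial>lam) \<partial>P)) \<and>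
       ((\<forall>t\<in>{0<..T}. emeasure lam {t} = 0) \<longrightarrow>
          mean_square_continuous P T (J X) \<and> has_predictable_version P F T (J X))) \<and>
    (\<forall>X\<in>Lambda_w P F \<mu> lam q T. \<forall>Y\<in>Lambda_w P F \<mu> lam q T. \<forall>a b.
       AE \<omega> in P. \<forall>t\<in>{0..T}. J (lin_comb a X b Y) t \<omega> = a * J X t \<omega> + b * J Y t \<omega>) \<and>
    (\<forall>X\<in>Lambda_w P F \<mu> lam q T. \<forall>e>0. \<exists>d>0. \<forall>Y\<in>Lambda_w P F \<mu> lam q T.
       w_norm_sq P \<mu> lam q T (integrand_diff X Y) < ennreal (d\<^sup>2) \<longrightarrow>
       M2_norm_sq P T (\<lambda>t \<omega>. J X t \<omega> - J Y t \<omega>) < ennreal (e\<^sup>2))"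
proof -
  interpret nuclear_weak_integral P F R M \<mu> lam q T I
    using assms by (simp add: nuclear_weak_integral_def nuclear_weak_integral_axioms_def)
  \<comment> \<open>The factor 4 in \<open>integral_process_M2_le\<close> belongs to squared norms,
    so a distance of \<open>e/2\<close> between the integrands suffices.\<close>
  have small: "M2_norm_sq P T (\<lambda>t \<omega>. integral_process X t \<omega> - integral_process Y t \<omega>) < ennreal (e\<^sup>2)"
    if "X \<in> Lambda_w P F \<mu> lam q T" "Y \<in> Lambda_w P F \<mu> lam q T"
      and w: "w_norm_sq P \<mu> lam q T (integrand_diff X Y) < ennreal ((e/2)\<^sup>2)" for X Y e
  proof -
    have "4 * w_norm_sq P \<mu> lam q T (integrand_diff X Y) < 4 * ennreal ((e/2)\<^sup>2)"
      using w by (intro ennreal_mult_strict_left_mono) auto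
    also have "\<dots> = ennreal (e\<^sup>2)"
      by (simp add: power_divide ennreal_mult[symmetric] flip: ennreal_numeral)
    finally show ?thesis
      using integral_process_M2_le[OF that(1,2)] by (rule le_less_trans[rotated])
  qed
  show ?thesis
  proof (intro exI[of _ integral_process] conjI ballI allI impI)
    fix X t assume "X \<in> Lambda_w P F \<mu> lam q T" "t \<in> {0..T}"
    then show "ennreal (\<integral>\<omega>. \<bar>integral_process X t \<omega>\<bar>\<^sup>2 \<partial>P) =
        (\<integral>\<^sup>+\<omega>. (\<integral>\<^sup>+r\<in>{0<..t}. (\<integral>\<^sup>+u. ennreal ((hnorm (q r u) (X r \<omega> u))\<^sup>2) \<partial>\<mu>) \<partial>lam) \<partial>P)"
      using integral_process_isometry by (simp add: w_norm_sq_def)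
  next
    fix X and e :: real assume "X \<in> Lambda_w P F \<mu> lam q T" "0 < e"
    then show "\<exists>d>0. \<forall>Y\<in>Lambda_w P F \<mu> lam q T.
       w_norm_sq P \<mu> lam q T (integrand_diff X Y) < ennreal (d\<^sup>2) \<longrightarrow>
       M2_norm_sq P T (\<lambda>t \<omega>. integral_process X t \<omega> - integral_process Y t \<omega>) < ennreal (e\<^sup>2)"
      using small by (intro exI[of _ "e / 2"]) auto
  qed (use integral_process_eq integral_process_martingale integral_process_lin
      integral_process_mean_square_continuous predictable_version[OF \<open>0 < T\<close>] in \<open>auto\<close>)
qed

end
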